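(* Let $N\ge 2$, $d\ge1$, $k\in\{0,\ldots,d-1\}$, $k<s<k+1$, and $\mathsf{A}=(A_1,\ldots,A_N)\in GL_d(\mathbb{R})^N$. If $\mathsf{A}^{\wedge k}$ and $\mathsf{A}^{\wedge(k+1)}$ are both irreducible, and one of them is strongly irreducible, then there exists a unique $\varphi^s$-equilibrium state of $\mathsf{A}$ and it is fully supported.
   Context: For $A\in GL_d(\mathbb{R})$, $A^{\wedge k}\colon\wedge^k\mathbb{R}^d\to\wedge^k\mathbb{R}^d$ is the induced linear map on the $k$th exterior power, $A^{\wedge k}(u_1\wedge\cdots\wedge u_k)=Au_1\wedge\cdots\wedge Au_k$; by convention $\wedge^0\mathbb{R}^d=\mathbb{R}$ and $A^{\wedge0}$ is the identity of $\mathbb{R}$. $\mathsf{A}^{\wedge k}=(A_1^{\wedge k},\ldots,A_N^{\wedge k})$. A tuple of invertible linear maps of a finite-dimensional real vector space $V$ is irreducible if no proper nontrivial (i.e. different from $\{0\}$ and $V$) linear subspace $U$ satisfies $B(U)\subset U$ for all $B$ in the tuple. It is strongly irreducible if there is no set $F$ which is a finite union of (one or more) proper nontrivial linear subspaces of $V$ and satisfies $B(F)\subset F$ for all $B$ in the tuple. Let $\Sigma=\{1,\ldots,N\}^{\mathbb{N}}$ with the product topology, and $\sigma\colon\Sigma\to\Sigma$, $\sigma(i_1i_2i_3\cdots)=i_2i_3\cdots$. Let $\Sigma_n=\{1,\ldots,N\}^n$ and let $\Sigma_*$ be the set of all finite words. For $\mathtt{i}\in\Sigma_*$ the cylinder $[\mathtt{i}]\subset\Sigma$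 is the set of infinite words beginning with $\mathtt{i}$. $\mathcal{M}_\sigma(\Sigma)$ is the set of $\sigma$-invariant Borel probability measures on $\Sigma$; $\mu$ is fully supported if $\mu([\mathtt{i}])>0$ for all $\mathtt{i}\in\Sigma_*$. For $A\in GL_d(\mathbb{R})$ with singular values $\alpha_1(A)\ge\cdots\ge\alpha_d(A)>0$, the singular value function is $\varphi^s(A)=\alpha_1(A)\cdots\alpha_k(A)\,\alpha_{k+1}(A)^{s-k}$ for $k\le s<k+1$. For $\mathtt{i}=i_1\cdots i_n$ write $A_{\mathtt{i}}=A_{i_1}\cdots A_{i_n}$. Define $P_{\mathsf{A}}(\varphi^s)=\lim_{n\to\infty}\frac1n\log\sum_{\mathtt{i}\in\Sigma_n}\varphi^s(A_{\mathtt{i}})$, and for $\mu\in\mathcal{M}_\sigma(\Sigma)$ define $h(\mu)=\lim_{n\to\infty}\frac1n\sum_{\mathtt{i}\in\Sigma_n}-\mu([\mathtt{i}])\log\mu([\mathtt{i}])$ and $\lambda_{\mathsf{A}}(\varphi^s,\mu)=\lim_{n\to\infty}\frac1n\sum_{\mathtt{i}\in\Sigma_n}\mu([\mathtt{i}])\log\varphi^s(A_{\mathtt{i}})$ (limits exist by subadditivity). $\mu\in\mathcal{M}_\sigma(\Sigma)$ is a $\varphi^s$-equilibrium state of $\mathsf{A}$ if $P_{\mathsf{A}}(\varphi^s)=h(\mu)+\lambda_{\mathsf{A}}(\varphi^s,\mu)$. *)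

theory Defs
  imports "HOL-Analysis.Analysis" "HOL-Probability.Probability_Measure"
begin

section \<open>Exterior powers of \<open>\<real>\<^sup>d\<close>\<close>

text \<open>The whole exterior algebra of \<open>\<real>\<^sup>d\<close> is modelled as \<^typ>\<open>real^('n set)\<close>, with \<open>d = CARD('n)\<close>.
  The standard basis vector at \<open>S\<close>, \<open>card S = k\<close>, stands for
  \<open>e\<^bsub>S\<^sub>0\<^esub> \<and> \<dots> \<and> e\<^bsub>S\<^sub>k\<^sub>-\<^sub>1\<^esub>\<close>, where
  \<^term>\<open>from_nat_into S\<close> is an arbitrary but fixed enumeration of \<open>S\<close> (it only affects the signs of
  the basis vectors). Accordingly, the coordinate at \<open>S\<close> of \<open>u\<^sub>0 \<and> \<dots> \<and> u\<^sub>k\<^sub>-\<^sub>1\<close> is the \<open>k \<times> k\<close>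
  minor with the components \<open>S\<close>, by the Leibniz formula; for \<open>k = 0\<close> it is \<open>1\<close> at \<open>S = {}\<close>.\<close>

definition wedge :: "nat \<Rightarrow> (nat \<Rightarrow> real^'n) \<Rightarrow> real^('n set)" where
  "wedge k u = (\<chi> S. if card S = k
     then (\<Sum>p | p permutes {..<k}. of_int (sign p) * (\<Prod>i<k. u i $ from_nat_into S (p i)))
     else 0)"

definition ext_power :: "nat \<Rightarrow> (real^('n::finite set)) set" where
  "ext_power k = span (range (wedge k))"

text \<open>Defined on basis vectors by \<open>e\<^bsub>S\<^sub>0\<^esub> \<and> \<dots> \<and> e\<^bsub>S\<^sub>k\<^sub>-\<^sub>1\<^esub> \<mapsto> A e\<^bsub>S\<^sub>0\<^esub> \<and> \<dots> \<and> A e\<^bsub>S\<^sub>k\<^sub>-\<^sub>1\<^esub>\<close>;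
  the lemmas \<open>linear_ext_map\<close> and \<open>ext_map_wedge\<close> below state that this is the induced linear map.\<close>

definition ext_map :: "nat \<Rightarrow> real^'n^'n \<Rightarrow> real^('n set) \<Rightarrow> real^('n set)" where
  "ext_map k A v =
     (\<Sum>S | card S = k. v $ S *\<^sub>R wedge k (\<lambda>j. A *v axis (from_nat_into S j) 1))"

lemma linear_ext_map: "linear (ext_map k A)"
  unfolding ext_map_def
  by (intro linearI)
     (auto simp: sum.distrib scaleR_add_left scaleR_sum_right)

lemma wedge_nth:
  "card S = k \<Longrightarrow> wedge k u $ S =
     (\<Sum>p | p permutes {..<k}. of_int (sign p) * (\<Prod>i<k. u i $ from_nat_into S (p i)))"
  by (simp add: wedge_def)

lemma wedge_nth_0: "card S \<noteq> k \<Longrightarrow> wedge k u $ S = 0"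
  by (simp add: wedge_def)

lemma wedge_cong: "(\<And>i. i < k \<Longrightarrow> u i = v i) \<Longrightarrow> wedge k u = wedge k v"
  unfolding wedge_def
  by (intro arg_cong[where f = vec_lambda] ext if_cong sum.cong refl
        arg_cong2[where f = "(*)"] prod.cong) simp

lemma wedge_permute:
  fixes u :: "nat \<Rightarrow> real^'n"
  assumes q: "q permutes {..<k}"
  shows "wedge k (\<lambda>i. u (q i)) = of_int (sign q) *\<^sub>R wedge k u"
proof (rule vec_eq_iff[THEN iffD2], rule allI)
  fix S :: "'n set"
  show "wedge k (\<lambda>i. u (q i)) $ S = (of_int (sign q) *\<^sub>R wedge k u) $ S"
  proof (cases "card S = k")
    case True
    let ?e = "from_nat_into S"
    have "wedge k (\<lambda>i. u (q i)) $ S =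
      (\<Sum>p | p permutes {..<k}. of_int (sign (p \<circ> q)) * (\<Prod>i<k. u (q i) $ ?e ((p \<circ> q) i)))"
      unfolding wedge_nth[OF True]
      by (rule sum_permutations_compose_right[OF q])
    also have "\<dots> = (\<Sum>p | p permutes {..<k}.
        of_int (sign q) * (of_int (sign p) * (\<Prod>i<k. u i $ ?e (p i))))"
    proof (rule sum.cong[OF refl])
      fix p assume "p \<in> {p. p permutes {..<k}}"
      hence p: "p permutes {..<k}" by simp
      have "(\<Prod>i<k. u (q i) $ ?e (p (q i))) = (\<Prod>i<k. u i $ ?e (p i))"
        using prod.permute[OF q, of "\<lambda>i. u i $ ?e (p i)"] by (simp add: o_def)
      moreover have "sign (p \<circ> q) = sign p * sign q"
        using p q by (intro sign_compose permutation_permutes[THEN iffD2]) auto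
      ultimately show "of_int (sign (p \<circ> q)) * (\<Prod>i<k. u (q i) $ ?e ((p \<circ> q) i)) =
        of_int (sign q) * (of_int (sign p) * (\<Prod>i<k. u i $ ?e (p i)))"
        by simp
    qed
    finally show ?thesis
      by (simp add: wedge_nth[OF True] sum_distrib_left)
  qed (simp add: wedge_nth_0)
qed

lemma wedge_alternating:
  fixes u :: "nat \<Rightarrow> real^'n"
  assumes "i < k" "j < k" "i \<noteq> j" "u i = u j"
  shows "wedge k u = 0"
proof -
  let ?q = "Transposition.transpose i j"
  have q: "?q permutes {..<k}"
    using assms by (intro permutes_swap_id) auto
  have "(\<lambda>l. u (?q l)) = u"
    using assms(4) by (auto simp: Transposition.transpose_def)
  hence "wedge k u = - wedge k u"
    using wedge_permute[OF q, of u] assms(3) by (simp add: sign_swap_id)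
  thus ?thesis
    by (simp add: vec_eq_iff)
qed

lemma wedge_expand:
  fixes A :: "real^'n^'n"
  shows "wedge k (\<lambda>j. A *v u j) =
    (\<Sum>f\<in>PiE {..<k} (\<lambda>_. UNIV). (\<Prod>i<k. u i $ f i) *\<^sub>R wedge k (\<lambda>j. A *v axis (f j) 1))"
    (is "_ = ?R")
proof (rule vec_eq_iff[THEN iffD2], rule allI)
  fix T :: "'n set"
  show "wedge k (\<lambda>j. A *v u j) $ T = ?R $ T"
  proof (cases "card T = k")
    case True
    let ?e = "from_nat_into T"
    let ?F = "PiE {..<k} (\<lambda>_. UNIV :: 'n set)"
    have "wedge k (\<lambda>j. A *v u j) $ T =
        (\<Sum>p | p permutes {..<k}. of_int (sign p) *
           (\<Prod>i<k. \<Sum>m\<in>UNIV. A $ ?e (p i) $ m * u i $ m))"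
      by (simp add: wedge_nth[OF True] matrix_vector_mult_def)
    also have "\<dots> = (\<Sum>p | p permutes {..<k}. of_int (sign p) *
           (\<Sum>f\<in>?F. \<Prod>i<k. A $ ?e (p i) $ f i * u i $ f i))"
      by (subst prod_sum_PiE) auto
    also have "\<dots> = (\<Sum>f\<in>?F. \<Sum>p | p permutes {..<k}. of_int (sign p) *
           (\<Prod>i<k. A $ ?e (p i) $ f i * u i $ f i))"
      unfolding sum_distrib_left by (rule sum.swap)
    also have "\<dots> = (\<Sum>f\<in>?F. (\<Prod>i<k. u i $ f i) *
          (\<Sum>p | p permutes {..<k}. of_int (sign p) * (\<Prod>i<k. A $ ?e (p i) $ f i)))"
      by (simp add: sum_distrib_left prod.distrib mult_ac)
    also have "\<dots> = ?R $ T"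
      by (simp add: wedge_nth[OF True] matrix_vector_mul_component inner_axis sum_component)
    finally show ?thesis .
  qed (simp add: wedge_nth_0 sum_component)
qed

lemma ext_map_wedge:
  fixes A :: "real^'n^'n"
  shows "ext_map k A (wedge k u) = wedge k (\<lambda>j. A *v u j)"
proof -
  let ?F = "PiE {..<k} (\<lambda>_. UNIV :: 'n set)"
  let ?G = "{f\<in>?F. inj_on f {..<k}}"
  let ?P = "{p. p permutes {..<k}}"
  let ?K = "{S :: 'n set. card S = k}"
  let ?h = "\<lambda>f. (\<Prod>i<k. u i $ f i) *\<^sub>R wedge k (\<lambda>j. A *v axis (f j) 1)"
  let ?c = "\<lambda>(S, q). restrict (\<lambda>i. from_nat_into S (q i)) {..<k}"
  have e: "bij_betw (from_nat_into S) {..<k} S" if "card S = k" for S :: "'n set"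
    using bij_betw_from_nat_into_finite[of S] that by simp
  have "wedge k (\<lambda>j. A *v u j) = (\<Sum>f\<in>?F. ?h f)"
    by (rule wedge_expand)
  also have "\<dots> = (\<Sum>f\<in>?G. ?h f)"
  proof (rule sum.mono_neutral_right)
    show "finite ?F" by (intro finite_PiE) auto
    show "\<forall>f\<in>?F - ?G. ?h f = 0"
    proof
      fix f assume "f \<in> ?F - ?G"
      then obtain i j where "i < k" "j < k" "i \<noteq> j" "f i = f j"
        by (auto simp: inj_on_def)
      thus "?h f = 0"
        using wedge_alternating[of i k j "\<lambda>j. A *v axis (f j) 1"] by simp
    qed
  qed auto
  also have "(\<Sum>f\<in>?G. ?h f) = (\<Sum>(S, q)\<in>?K \<times> ?P. ?h (?c (S, q)))"
  proof -
    have bij: "bij_betw ?c (?K \<times> ?P) ?G"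
      unfolding bij_betw_def
    proof (intro conjI inj_onI set_eqI iffI)
      fix x y assume x: "x \<in> ?K \<times> ?P" and y: "y \<in> ?K \<times> ?P" and xy: "?c x = ?c y"
      obtain S q S' q' where xe: "x = (S, q)" "y = (S', q')" by (cases x; cases y)
      have S: "card S = k" "card S' = k" and q: "q permutes {..<k}" "q' permutes {..<k}"
        using x y xe by auto
      have eq: "from_nat_into S (q i) = from_nat_into S' (q' i)" if "i < k" for i
        using fun_cong[OF xy, of i] that by (simp add: xe)
      have im: "(\<lambda>i. from_nat_into R (r i)) ` {..<k} = R"
        if "card R = k" "r permutes {..<k}" for R :: "'n set" and r
        using e[OF that(1)] permutes_image[OF that(2)]
        by (metis bij_betw_imp_surj_on image_image)
      have SS: "S = S'"
        using im[OF S(1) q(1)] im[OF S(2) q(2)] eq by (metis (no_types, lifting) image_cong lessThan_iff)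
      have "q i = q' i" for i
      proof (cases "i < k")
        case True
        have "q i \<in> {..<k}" "q' i \<in> {..<k}"
          using True permutes_in_image[OF q(1)] permutes_in_image[OF q(2)] by auto
        thus ?thesis
          using eq[OF True] e[OF S(1)] SS by (auto simp: bij_betw_def inj_on_def)
      qed (use q in \<open>simp add: permutes_def\<close>)
      thus "x = y" using SS xe by auto
    next
      fix f assume "f \<in> ?c ` (?K \<times> ?P)"
      then obtain S q where S: "card S = k" and q: "q permutes {..<k}" and f: "f = ?c (S, q)"
        by auto
      have "bij_betw (from_nat_into S \<circ> q) {..<k} S"
        using permutes_imp_bij[OF q] e[OF S] by (rule bij_betw_trans)
      hence "inj_on f {..<k}"
        unfolding f by (simp add: bij_betw_def inj_on_def)
      thus "f \<in> ?G" unfolding f by auto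
    next
      fix f assume f: "f \<in> ?G"
      define S where "S = f ` {..<k}"
      define q where "q = (\<lambda>i. if i < k then inv_into {..<k} (from_nat_into S) (f i) else i)"
      have S: "card S = k" using f by (simp add: S_def card_image)
      have fb: "bij_betw f {..<k} S" using f by (auto simp: S_def bij_betw_def)
      have "bij_betw (inv_into {..<k} (from_nat_into S) \<circ> f) {..<k} {..<k}"
        using fb bij_betw_inv_into[OF e[OF S]] by (rule bij_betw_trans)
      hence "bij_betw q {..<k} {..<k}"
        by (subst bij_betw_cong[of _ _ "inv_into {..<k} (from_nat_into S) \<circ> f"]) (auto simp: q_def)
      hence q: "q permutes {..<k}"
        by (rule bij_imp_permutes) (simp add: q_def)
      have "from_nat_into S (q i) = f i" if "i < k" for i
        using that e[OF S] by (simp add: q_def S_def bij_betw_inv_into_right)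
      hence "f = ?c (S, q)" using f by (auto simp: PiE_def extensional_def restrict_def)
      thus "f \<in> ?c ` (?K \<times> ?P)" using S q by blast
    qed
    have "(\<Sum>x\<in>?K \<times> ?P. ?h (?c x)) = (\<Sum>f\<in>?G. ?h f)"
      by (rule sum.reindex_bij_betw[OF bij])
    thus ?thesis
      unfolding case_prod_eta by (simp only: split_def prod.collapse)
  qed
  also have "\<dots> = (\<Sum>(S, q)\<in>?K \<times> ?P. (of_int (sign q) * (\<Prod>i<k. u i $ from_nat_into S (q i))) *\<^sub>R
      wedge k (\<lambda>j. A *v axis (from_nat_into S j) 1))"
  proof (rule sum.cong[OF refl], unfold split_paired_all prod.case)
    fix S :: "'n set" and q assume "(S, q) \<in> ?K \<times> ?P"
    hence q: "q permutes {..<k}" by simp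
    have "wedge k (\<lambda>j. A *v axis (?c (S, q) j) 1) =
        wedge k (\<lambda>j. A *v axis (from_nat_into S (q j)) 1)"
      by (rule wedge_cong) simp
    also have "\<dots> = of_int (sign q) *\<^sub>R wedge k (\<lambda>j. A *v axis (from_nat_into S j) 1)"
      by (rule wedge_permute[OF q, of "\<lambda>j. A *v axis (from_nat_into S j) 1"])
    finally show "?h (restrict (\<lambda>i. from_nat_into S (q i)) {..<k}) = (of_int (sign q) * (\<Prod>i<k. u i $ from_nat_into S (q i))) *\<^sub>R
        wedge k (\<lambda>j. A *v axis (from_nat_into S j) 1)"
      by (simp add: mult.commute)
  qed
  also have "\<dots> = ext_map k A (wedge k u)"
    unfolding ext_map_def sum.cartesian_product[symmetric]
    by (intro sum.cong refl) (simp add: wedge_nth scaleR_sum_left)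
  finally show ?thesis by simp
qed

lemma wedge_axis:
  fixes S :: "'n::finite set"
  assumes S: "card S = k"
  shows "wedge k (\<lambda>j. axis (from_nat_into S j) 1) = axis S 1"
proof (rule vec_eq_iff[THEN iffD2], rule allI)
  fix T :: "'n set"
  have e: "bij_betw (from_nat_into S) {..<k} S" if "card S = k" for S :: "'n set"
    using bij_betw_from_nat_into_finite[of S] that by simp
  let ?d = "\<lambda>p. (\<Prod>i<k. axis (from_nat_into S i) (1::real) $ from_nat_into T (p i))"
  show "wedge k (\<lambda>j. axis (from_nat_into S j) 1) $ T = (axis S 1 :: real^('n set)) $ T"
  proof (cases "card T = k")
    case T: True
    have d: "?d p = (if T = S \<and> p = id then 1 else 0)" if p: "p permutes {..<k}" for p
    proof (cases "\<forall>i<k. from_nat_into T (p i) = from_nat_into S i")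
      case True
      have "T = from_nat_into T ` p ` {..<k}"
        using e[OF T] permutes_image[OF p] by (simp add: bij_betw_def)
      also have "\<dots> = S" using True e[OF S] by (auto simp: bij_betw_def image_image)
      finally have TS: "T = S" .
      have "p i = i" for i
      proof (cases "i < k")
        case i: True
        thus ?thesis
          using True e[OF S] TS permutes_in_image[OF p, of i] by (auto simp: bij_betw_def inj_on_def)
      qed (use p in \<open>simp add: permutes_def\<close>)
      thus ?thesis using True TS by (auto simp: axis_def fun_eq_iff)
    next
      case False
      then obtain i where "i < k" "from_nat_into T (p i) \<noteq> from_nat_into S i" by auto
      moreover from this have "\<not> (T = S \<and> p = id)" by auto
      ultimately show ?thesis by (auto simp: axis_def intro!: prod_zero)
    qed
    have "wedge k (\<lambda>j. axis (from_nat_into S j) 1) $ T =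
        (\<Sum>p | p permutes {..<k}. of_int (sign p) * (if T = S \<and> p = id then 1 else 0))"
      unfolding wedge_nth[OF T] by (intro sum.cong) (auto simp: d)
    also have "\<dots> = (\<Sum>p | p permutes {..<k}. if p = id then (if T = S then 1 else 0) else 0)"
      by (intro sum.cong) (auto simp: sign_id)
    also have "\<dots> = (if T = S then 1 else 0)"
      by (subst sum.delta) (auto simp: finite_permutations permutes_id)
    finally show ?thesis by (auto simp: axis_def)
  qed (use S in \<open>auto simp: wedge_nth_0 axis_def\<close>)
qed

lemma ext_power_eq: "ext_power k = {v :: real^('n::finite set). \<forall>S. card S \<noteq> k \<longrightarrow> v $ S = 0}"
proof
  have "subspace {v :: real^('n set). \<forall>S. card S \<noteq> k \<longrightarrow> v $ S = 0}"
    by (auto simp: subspace_def)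
  thus "ext_power k \<subseteq> {v :: real^('n set). \<forall>S. card S \<noteq> k \<longrightarrow> v $ S = 0}"
    unfolding ext_power_def by (intro span_minimal) (auto simp: wedge_nth_0)
next
  show "{v :: real^('n set). \<forall>S. card S \<noteq> k \<longrightarrow> v $ S = 0} \<subseteq> ext_power k"
  proof
    fix v :: "real^('n set)" assume v: "v \<in> {v. \<forall>S. card S \<noteq> k \<longrightarrow> v $ S = 0}"
    have "v = (\<Sum>S\<in>UNIV. v $ S *\<^sub>R axis S 1)"
      by (simp add: vec_eq_iff axis_def sum_component if_distrib cong: if_cong)
    also have "\<dots> \<in> ext_power k"
    proof (unfold ext_power_def, intro span_sum)
      fix S :: "'n set"
      show "v $ S *\<^sub>R axis S 1 \<in> span (range (wedge k))"
      proof (cases "card S = k")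
        case True
        thus ?thesis by (metis wedge_axis span_base span_scale rangeI)
      qed (use v in \<open>simp add: span_zero\<close>)
    qed
    finally show "v \<in> ext_power k" .
  qed
qed


section \<open>Irreducibility\<close>

definition proper_nontrivial_subspace :: "'v::real_vector set \<Rightarrow> 'v set \<Rightarrow> bool" where
  "proper_nontrivial_subspace V U \<longleftrightarrow> subspace U \<and> U \<subseteq> V \<and> U \<noteq> {0} \<and> U \<noteq> V"

definition irreducible_tuple ::
    "'v::real_vector set \<Rightarrow> nat \<Rightarrow> (nat \<Rightarrow> 'v \<Rightarrow> 'v) \<Rightarrow> bool" where
  "irreducible_tuple V N B \<longleftrightarrow>
     \<not> (\<exists>U. proper_nontrivial_subspace V U \<and> (\<forall>i\<in>{1..N}. B i ` U \<subseteq> U))"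

definition strongly_irreducible_tuple ::
    "'v::real_vector set \<Rightarrow> nat \<Rightarrow> (nat \<Rightarrow> 'v \<Rightarrow> 'v) \<Rightarrow> bool" where
  "strongly_irreducible_tuple V N B \<longleftrightarrow>
     \<not> (\<exists>\<U>. finite \<U> \<and> \<U> \<noteq> {} \<and> (\<forall>U\<in>\<U>. proper_nontrivial_subspace V U) \<and>
            (\<forall>i\<in>{1..N}. B i ` (\<Union>\<U>) \<subseteq> \<Union>\<U>))"


section \<open>Symbolic space and invariant measures\<close>

text \<open>Infinite words are indexed from \<open>0\<close>. The topology on \<^typ>\<open>nat \<Rightarrow> nat\<close> is the product of
  the discrete topologies, so \<^term>\<open>restrict_space borel (shift_space N)\<close> is the Borel
  \<open>\<sigma>\<close>-algebra of the product topology on \<open>{1..N}\<^sup>\<nat>\<close>.\<close>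

definition shift_space :: "nat \<Rightarrow> (nat \<Rightarrow> nat) set" where
  "shift_space N = {\<omega>. \<forall>n. \<omega> n \<in> {1..N}}"

definition shift :: "(nat \<Rightarrow> nat) \<Rightarrow> nat \<Rightarrow> nat" where
  "shift \<omega> = (\<lambda>n. \<omega> (Suc n))"

definition words :: "nat \<Rightarrow> nat \<Rightarrow> nat list set" where
  "words N n = {w. length w = n \<and> set w \<subseteq> {1..N}}"

definition cylinder :: "nat \<Rightarrow> nat list \<Rightarrow> (nat \<Rightarrow> nat) set" where
  "cylinder N w = {\<omega> \<in> shift_space N. \<forall>j<length w. \<omega> j = w ! j}"

definition invariant_measures :: "nat \<Rightarrow> (nat \<Rightarrow> nat) measure set" where
  "invariant_measures N =
     {\<mu>. prob_space \<mu> \<and> space \<mu> = shift_space N \<and>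
         sets \<mu> = sets (restrict_space borel (shift_space N)) \<and>
         (\<forall>E\<in>sets \<mu>. emeasure \<mu> (shift -` E \<inter> space \<mu>) = emeasure \<mu> E)}"

definition fully_supported :: "nat \<Rightarrow> (nat \<Rightarrow> nat) measure \<Rightarrow> bool" where
  "fully_supported N \<mu> \<longleftrightarrow> (\<forall>n. \<forall>w\<in>words N n. measure \<mu> (cylinder N w) > 0)"


section \<open>Singular value function, pressure and equilibrium states\<close>

text \<open>The singular values are the square roots of the eigenvalues of \<open>A\<^sup>T A\<close>, repeated according to
  multiplicity (geometric and algebraic multiplicities agree by symmetry) and listed in
  decreasing order; \<open>singular_values A ! i\<close> is \<open>\<alpha>\<^sub>i\<^sub>+\<^sub>1(A)\<close>.\<close>

definition eigenspace :: "real^'n^'n \<Rightarrow> real \<Rightarrow> (real^'n) set" where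
  "eigenspace B t = {v. B *v v = t *\<^sub>R v}"

definition singular_values :: "real^'n^'n \<Rightarrow> real list" where
  "singular_values A = (let B = transpose A ** A in
     rev (sorted_list_of_multiset
       (\<Sum>t | eigenspace B t \<noteq> {0}. replicate_mset (dim (eigenspace B t)) (sqrt t))))"

definition singular_value_function :: "real \<Rightarrow> real^'n^'n \<Rightarrow> real" where
  "singular_value_function s A = (let k = nat \<lfloor>s\<rfloor> in
     (\<Prod>i<k. singular_values A ! i) * (singular_values A ! k) powr (s - real k))"

definition word_product :: "(nat \<Rightarrow> real^'n^'n) \<Rightarrow> nat list \<Rightarrow> real^'n^'n" where
  "word_product A w = foldr (\<lambda>i B. A i ** B) w (mat 1)"

definition pressure :: "nat \<Rightarrow> (nat \<Rightarrow> real^'n^'n) \<Rightarrow> real \<Rightarrow> real" where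
  "pressure N A s =
     lim (\<lambda>n. 1 / real n * ln (\<Sum>w\<in>words N n. singular_value_function s (word_product A w)))"

definition entropy :: "nat \<Rightarrow> (nat \<Rightarrow> nat) measure \<Rightarrow> real" where
  "entropy N \<mu> =
     lim (\<lambda>n. 1 / real n *
       (\<Sum>w\<in>words N n. - measure \<mu> (cylinder N w) * ln (measure \<mu> (cylinder N w))))"

definition lyapunov ::
    "nat \<Rightarrow> (nat \<Rightarrow> real^'n^'n) \<Rightarrow> real \<Rightarrow> (nat \<Rightarrow> nat) measure \<Rightarrow> real" where
  "lyapunov N A s \<mu> =
     lim (\<lambda>n. 1 / real n *
       (\<Sum>w\<in>words N n. measure \<mu> (cylinder N w) *
          ln (singular_value_function s (word_product A w))))"

definition equilibrium_state ::
    "nat \<Rightarrow> (nat \<Rightarrow> real^'n^'n) \<Rightarrow> real \<Rightarrow> (nat \<Rightarrow> nat) measure \<Rightarrow> bool" where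
  "equilibrium_state N A s \<mu> \<longleftrightarrow>
     \<mu> \<in> invariant_measures N \<and> pressure N A s = entropy N \<mu> + lyapunov N A s \<mu>"

end

theory Submission
  imports Defs "HOL-Probability.Projective_Family"
begin

text \<open>
  Put \<open>t = s - k\<close>, so \<open>0 < t < 1\<close>. The singular value function at \<open>s\<close> is the geometric mean
  \<open>(\<alpha>\<^sub>1\<cdots>\<alpha>\<^sub>k)\<^bsup>1-t\<^esup> (\<alpha>\<^sub>1\<cdots>\<alpha>\<^bsub>k+1\<^esub>)\<^bsup>t\<^esup>\<close>, and a singular value decomposition shows that \<open>\<alpha>\<^sub>1\<cdots>\<alpha>\<^sub>l\<close> agrees
  with the operator norm of the \<open>l\<close>-th exterior power up to a factor that depends only on \<open>l\<close> and
  the dimension (\<open>onorm_ext_map_singular_values\<close>). Hence it may be replaced by the submultiplicative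
  potential \<open>\<psi> w\<close>, the corresponding mean of the norms of the \<open>k\<close>-th and \<open>(k+1)\<close>-st exterior
  powers of the matrix product along \<open>w\<close>: bounded factors change neither the pressure nor any
  Lyapunov exponent.

  The irreducibility hypotheses enter only through quasi-multiplicativity: for all words \<open>u\<close>, \<open>v\<close> there is a
  connecting word \<open>w\<close> of bounded length with \<open>\<psi> (u w v) \<ge> c \<psi> u \<psi> v\<close>. Irreducibility of one
  representation gives a connecting word for that representation, but here the same \<open>w\<close> has to
  serve both exterior powers. This is where strong irreducibility of one of them is used: the orbit
  of a pair of nonzero vectors has a smallest finite union of subspaces of the direct sum
  containing it, this union is forward invariant, and its projections contradict one of the two
  irreducibility assumptions if every word fails for one of the two factors
  (\<open>strongly_irreducible_jointly_connecting\<close>). Compactness of unit spheres makes the statement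
  uniform (\<open>jointly_connecting_quasi_multiplicative\<close>).

  The rest is thermodynamic formalism for a quasi-multiplicative potential. The partition sums
  satisfy \<open>exp (n P) \<le> Z n \<le> C exp (n P)\<close>, and averaging the normalized weights
  \<open>\<psi> w / Z n\<close> along the shift yields in the limit an invariant Gibbs measure \<open>\<mu>\<close>, one with
  \<open>\<mu>[w]\<close> comparable to \<open>\<psi> w exp (- |w| P)\<close> (\<open>exists_gibbs\<close>). Such a measure is fully supported,
  an equilibrium state, and, again by quasi-multiplicativity, ergodic (\<open>gibbs_ergodic\<close>). If \<open>\<nu>\<close> is
  any equilibrium state, then by subadditivity its entropy and energy over words of length \<open>n\<close> add
  up to at least \<open>n P\<close>, so the relative entropy of \<open>\<nu>\<close> with respect to \<open>\<mu>\<close> on cylinders of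
  length \<open>n\<close> is bounded independently of \<open>n\<close>. Therefore \<open>\<nu>\<close> is absolutely continuous with respect
  to \<open>\<mu>\<close> (\<open>gibbs_dominates_equilibrium\<close>), and an invariant probability measure dominated by an
  ergodic one equals it (\<open>gibbs_dominated_unique\<close>).
\<close>


section \<open>Subadditive sequences\<close>

text \<open>Fekete's lemma: the limit is the infimum of the quotients \<open>a n / n\<close>. The second conclusion,
  that every \<open>a n\<close> lies above the limiting line, is what turns information on limits into
  information at each finite length.\<close>

lemma fekete:
  fixes a :: "nat \<Rightarrow> real"
  assumes sub: "\<And>m n. a (m + n) \<le> a m + a n" and lb: "\<And>n. - B * real n \<le> a n"
  obtains L where "(\<lambda>n. a n / real n) \<longlonglongrightarrow> L" "\<And>n. real n * L \<le> a n"
proof -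
  define S where "S = (\<lambda>n. a n / real n) ` {1..}"
  define L where "L = Inf S"
  have bdd: "bdd_below S"
    unfolding S_def using lb by (intro bdd_belowI2[of _ "- B"]) (auto simp: field_simps)
  have mult: "a (q * m + r) \<le> real q * a m + a r" for q m r
  proof (induction q)
    case (Suc q)
    have "a (Suc q * m + r) = a (m + (q * m + r))" by (simp add: algebra_simps)
    also have "\<dots> \<le> a m + a (q * m + r)" by (rule sub)
    finally show ?case using Suc by (simp add: algebra_simps)
  qed simp
  have le: "L \<le> a n / real n" if "n \<ge> 1" for n
    unfolding L_def using that bdd by (intro cInf_lower) (auto simp: S_def)
  have lim: "(\<lambda>n. a n / real n) \<longlonglongrightarrow> L"
  proof (rule LIMSEQ_I)
    fix e :: real assume e: "e > 0"
    have "S \<noteq> {}" by (auto simp: S_def)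
    then obtain x where "x \<in> S" "x < L + e / 2"
      using cInf_lessD[of S "L + e / 2"] e by (auto simp: L_def)
    then obtain m where m: "m \<ge> 1" and am: "a m / real m < L + e / 2"
      by (auto simp: S_def)
    define b where "b = a m / real m"
    define M where "M = (\<Sum>r<m. \<bar>a r\<bar>)"
    define C where "C = real m * \<bar>b\<bar> + M"
    have "M \<ge> 0" by (simp add: M_def sum_nonneg)
    \<comment> \<open>Division with remainder by \<open>m\<close>; the remainder costs a constant.\<close>
    have up: "a n / real n \<le> b + C / real n" if n: "n \<ge> 1" for n
    proof -
      have "a n \<le> real (n div m) * a m + a (n mod m)"
        using mult[of "n div m" m "n mod m"] by simp
      moreover have "real (n div m) * a m = real n * b - real (n mod m) * b"
      proof -
        have "real (n div m) * a m = real (n div m * m) * b"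
          using m by (simp add: b_def)
        also have "n div m * m = n - n mod m" by (simp add: minus_mod_eq_div_mult)
        finally show ?thesis by (simp add: algebra_simps of_nat_diff)
      qed
      moreover have "a (n mod m) \<le> M"
        unfolding M_def using m by (intro order_trans[OF _ member_le_sum[of "n mod m"]]) auto
      moreover have "- (real (n mod m) * b) \<le> real (n mod m) * \<bar>b\<bar>"
        by (metis abs_ge_minus_self abs_mult abs_of_nat)
      moreover have "real (n mod m) * \<bar>b\<bar> \<le> real m * \<bar>b\<bar>"
        using m by (intro mult_right_mono) (auto intro: less_imp_le)
      ultimately have "a n \<le> real n * b + C" by (simp add: C_def)
      thus ?thesis using n by (simp add: field_simps)
    qed
    obtain n0 where n0: "real n0 > 2 * C / e" using reals_Archimedean2 by blast
    show "\<exists>no. \<forall>n\<ge>no. norm (a n / real n - L) < e"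
    proof (intro exI allI impI)
      fix n assume n: "n \<ge> max 1 n0"
      have "real n > 2 * C / e" using n n0 by linarith
      hence "C / real n < e / 2" using e n by (simp add: field_simps)
      hence "a n / real n < L + e"
        using up[of n] n am unfolding b_def by linarith
      moreover have "L \<le> a n / real n" using le n by simp
      ultimately show "norm (a n / real n - L) < e" using e by simp
    qed
  qed
  have "real n * L \<le> a n" for n
  proof (cases "n = 0")
    case True
    thus ?thesis using lb[of 0] by simp
  next
    case False
    thus ?thesis using le[of n] by (simp add: field_simps)
  qed
  thus ?thesis using lim that by blast
qed


section \<open>Finite words and cylinders\<close>

lemma finite_words [simp]: "finite (words N n)"
proof -
  have "words N n = {w. set w \<subseteq> {1..N} \<and> length w = n}" by (auto simp: words_def)
  thus ?thesis using finite_lists_length_eq[of "{1..N}" n] by simp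
qed

lemma words_0 [simp]: "words N 0 = {[]}"
  by (auto simp: words_def)

lemma sum_words_append:
  "(\<Sum>w\<in>words N (m + n). f w) = (\<Sum>u\<in>words N m. \<Sum>v\<in>words N n. f (u @ v))"
proof -
  have "bij_betw (\<lambda>(u, v). u @ v) (words N m \<times> words N n) (words N (m + n))"
  proof (rule bij_betw_byWitness[where f' = "\<lambda>w. (take m w, drop m w)"])
    show "(\<lambda>w. (take m w, drop m w)) ` words N (m + n) \<subseteq> words N m \<times> words N n"
      by (auto simp: words_def dest!: in_set_takeD in_set_dropD)
    show "(\<lambda>(u, v). u @ v) ` (words N m \<times> words N n) \<subseteq> words N (m + n)"
      by (clarsimp simp: words_def)
  qed (auto simp: words_def)
  from sum.reindex_bij_betw[OF this, of f, symmetric]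
  show ?thesis by (simp add: sum.cartesian_product split_def)
qed

lemma words_append: "u \<in> words N m \<Longrightarrow> v \<in> words N n \<Longrightarrow> u @ v \<in> words N (m + n)"
  by (auto simp: words_def)

lemma words_length: "w \<in> words N n \<Longrightarrow> length w = n"
  by (simp add: words_def)

definition all_words :: "nat \<Rightarrow> nat list set" where
  "all_words N = (\<Union>n. words N n)"

lemma words_length_iff: "w \<in> all_words N \<longleftrightarrow> w \<in> words N (length w)"
  by (auto simp: all_words_def words_def)

lemma words_imp_all_words: "w \<in> words N n \<Longrightarrow> w \<in> all_words N"
  by (auto simp: all_words_def)

lemma all_words_Nil [simp]: "[] \<in> all_words N"
  by (auto simp: all_words_def words_def)

lemma all_words_append [simp]: "u @ v \<in> all_words N \<longleftrightarrow> u \<in> all_words N \<and> v \<in> all_words N"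
  by (auto simp: all_words_def words_def)

definition letters :: "nat \<Rightarrow> nat set" where
  "letters N = {1..N}"

lemma finite_letters [simp]: "finite (letters N)"
  by (simp add: letters_def)

lemma all_words_Cons [simp]: "a # w \<in> all_words N \<longleftrightarrow> a \<in> letters N \<and> w \<in> all_words N"
  by (auto simp: letters_def all_words_def words_def)

lemma words_letters: "words N n = {w. length w = n \<and> set w \<subseteq> letters N}"
  by (simp only: words_def letters_def)

lemma shift_space_letters: "shift_space N = {\<omega>. \<forall>n. \<omega> n \<in> letters N}"
  by (simp only: shift_space_def letters_def)

lemma sum_words_1: "(\<Sum>w\<in>words N (Suc 0). f w) = (\<Sum>a\<in>letters N. f [a])"
proof -
  have "words N (Suc 0) = (\<lambda>a. [a]) ` letters N"
    by (auto simp: words_letters length_Suc_conv)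
  thus ?thesis by (simp add: sum.reindex inj_on_def)
qed

lemma words_nonempty: "N \<ge> 1 \<Longrightarrow> words N n \<noteq> {}"
proof -
  assume "N \<ge> 1"
  hence "replicate n 1 \<in> words N n" by (auto simp: words_def)
  thus ?thesis by blast
qed

definition cylinders :: "nat \<Rightarrow> (nat \<Rightarrow> nat) set set" where
  "cylinders N = insert {} (cylinder N ` all_words N)"

lemma cylinder_subset: "cylinder N w \<subseteq> shift_space N"
  by (auto simp: cylinder_def)

lemma cylinder_Nil [simp]: "cylinder N [] = shift_space N"
  by (auto simp: cylinder_def)

lemma shift_funpow: "(shift ^^ n) \<omega> j = \<omega> (n + j)"
  by (induction n arbitrary: \<omega>) (auto simp: shift_def funpow_swap1)

lemma shift_funpow_space: "\<omega> \<in> shift_space N \<Longrightarrow> (shift ^^ n) \<omega> \<in> shift_space N"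
  by (auto simp: shift_space_def shift_funpow)

lemma shift_in_space: "\<omega> \<in> shift_space N \<Longrightarrow> shift \<omega> \<in> shift_space N"
  by (auto simp: shift_space_def shift_def)

text \<open>Invariance of a measure acts on cylinders through this identity: the second half of a word is
  read off after shifting by the length of the first.\<close>

lemma cylinder_append:
  "cylinder N (u @ v) = cylinder N u \<inter> ((shift ^^ length u) -` cylinder N v \<inter> shift_space N)"
proof (intro set_eqI iffI)
  fix \<omega> assume *: "\<omega> \<in> cylinder N (u @ v)"
  have "\<omega> j = u ! j" if "j < length u" for j
    using * that by (auto simp: cylinder_def nth_append)
  moreover have "\<omega> (length u + j) = v ! j" if "j < length v" for j
  proof -
    have "\<omega> (length u + j) = (u @ v) ! (length u + j)" using * that by (simp add: cylinder_def)
    thus ?thesis by simp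
  qed
  ultimately show "\<omega> \<in> cylinder N u \<inter> ((shift ^^ length u) -` cylinder N v \<inter> shift_space N)"
    using * by (auto simp: cylinder_def shift_funpow shift_funpow_space)
next
  fix \<omega> assume "\<omega> \<in> cylinder N u \<inter> ((shift ^^ length u) -` cylinder N v \<inter> shift_space N)"
  hence *: "\<omega> \<in> shift_space N" "\<And>j. j < length u \<Longrightarrow> \<omega> j = u ! j"
     "\<And>j. j < length v \<Longrightarrow> \<omega> (length u + j) = v ! j"
    by (auto simp: cylinder_def shift_funpow)
  have "\<omega> j = (u @ v) ! j" if "j < length u + length v" for j
    using *(2)[of j] *(3)[of "j - length u"] that by (auto simp: nth_append)
  thus "\<omega> \<in> cylinder N (u @ v)" using *(1) by (auto simp: cylinder_def)
qed

lemma cylinder_disjoint: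
  assumes "u \<in> words N n" "v \<in> words N n" "u \<noteq> v"
  shows "cylinder N u \<inter> cylinder N v = {}"
proof (rule ccontr)
  assume "cylinder N u \<inter> cylinder N v \<noteq> {}"
  then obtain \<omega> where "\<omega> \<in> cylinder N u" "\<omega> \<in> cylinder N v" by auto
  hence "u ! j = v ! j" if "j < n" for j
    using assms that by (auto simp: cylinder_def words_def)
  hence "u = v" using assms by (intro nth_equalityI) (auto simp: words_def)
  thus False using assms by simp
qed

lemma cylinder_prefix:
  "\<omega> \<in> shift_space N \<Longrightarrow> \<omega> \<in> cylinder N (map \<omega> [0..<n]) \<and> map \<omega> [0..<n] \<in> words N n"
  by (auto simp: cylinder_def words_def shift_space_def)

lemma cylinders_cover: "(\<Union>w\<in>words N n. cylinder N w) = shift_space N"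
  using cylinder_prefix[of _ N n] cylinder_subset by fast

lemma cylinder_union_complement:
  assumes "U \<subseteq> words N n"
  shows "(\<Union>w\<in>words N n - U. cylinder N w) = shift_space N - (\<Union>w\<in>U. cylinder N w)"
proof (intro equalityI subsetI)
  fix \<omega> assume "\<omega> \<in> (\<Union>w\<in>words N n - U. cylinder N w)"
  then obtain w where w: "w \<in> words N n" "w \<notin> U" "\<omega> \<in> cylinder N w" by blast
  hence "\<omega> \<notin> cylinder N u" if "u \<in> U" for u
    using cylinder_disjoint[of w N n u] that assms by blast
  thus "\<omega> \<in> shift_space N - (\<Union>w\<in>U. cylinder N w)" using w cylinder_subset by blast
next
  fix \<omega> assume "\<omega> \<in> shift_space N - (\<Union>w\<in>U. cylinder N w)"
  thus "\<omega> \<in> (\<Union>w\<in>words N n - U. cylinder N w)" using cylinders_cover[of N n] by blast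
qed

lemma shift_vimage_cylinder:
  "shift -` cylinder N w \<inter> shift_space N = (\<Union>a\<in>letters N. cylinder N ([a] @ w))"
proof (intro equalityI subsetI)
  fix \<omega> assume *: "\<omega> \<in> shift -` cylinder N w \<inter> shift_space N"
  hence "\<omega> \<in> cylinder N ([\<omega> 0] @ w)" "\<omega> 0 \<in> letters N"
    unfolding cylinder_append by (auto simp: cylinder_def shift_space_letters)
  thus "\<omega> \<in> (\<Union>a\<in>letters N. cylinder N ([a] @ w))" by blast
next
  fix \<omega> assume "\<omega> \<in> (\<Union>a\<in>letters N. cylinder N ([a] @ w))"
  thus "\<omega> \<in> shift -` cylinder N w \<inter> shift_space N"
    unfolding cylinder_append by auto
qed

lemma Int_stable_cylinders: "Int_stable (cylinders N)"
proof -
  have *: "cylinder N u \<inter> cylinder N v \<in> cylinders N"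
    if "length u \<le> length v" "u \<in> all_words N" "v \<in> all_words N" for u v
  proof (cases "take (length u) v = u")
    case True
    have "cylinder N (u @ drop (length u) v) \<subseteq> cylinder N u" 
      unfolding cylinder_append by auto
    hence "cylinder N v \<subseteq> cylinder N u"
      using True by (metis append_take_drop_id)
    hence "cylinder N u \<inter> cylinder N v = cylinder N v" by auto
    thus ?thesis using that by (auto simp: cylinders_def)
  next
    case False
    have "\<exists>j<length u. v ! j \<noteq> u ! j"
    proof (rule ccontr)
      assume "\<not> (\<exists>j<length u. v ! j \<noteq> u ! j)"
      hence "take (length u) v = u" using that(1) by (intro nth_equalityI) auto
      thus False using False by simp
    qed
    then obtain j where j: "j < length u" "v ! j \<noteq> u ! j" by blast
    hence "cylinder N u \<inter> cylinder N v = {}"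
      using that(1) by (fastforce simp: cylinder_def)
    thus ?thesis by (auto simp: cylinders_def)
  qed
  show ?thesis
  proof (rule Int_stableI)
    fix a b assume ab: "a \<in> cylinders N" "b \<in> cylinders N"
    show "a \<inter> b \<in> cylinders N"
    proof (cases "a = {} \<or> b = {}")
      case True
      thus ?thesis by (auto simp: cylinders_def)
    next
      case False
      then obtain u v where uv: "a = cylinder N u" "b = cylinder N v" "u \<in> all_words N" "v \<in> all_words N"
        using ab unfolding cylinders_def by auto
      show ?thesis
      proof (cases "length u \<le> length v")
        case True
        thus ?thesis using *[of u v] uv by simp
      next
        case False
        thus ?thesis using *[of v u] uv by (simp add: Int_commute)
      qed
    qed
  qed
qed

lemma open_prefix_set: "open {\<omega> :: nat \<Rightarrow> nat. \<forall>j<n. \<omega> j = w ! j}"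
  using product_topology_basis'[of "{..<n}" "\<lambda>j. {w ! j}" "\<lambda>j. j"] 
  by (simp add: open_discrete Ball_def)

lemma open_contains_prefix_set:
  fixes S :: "(nat \<Rightarrow> nat) set"
  assumes "open S" "\<omega> \<in> S"
  obtains n where "{\<omega>'. \<forall>j<n. \<omega>' j = \<omega> j} \<subseteq> S"
proof -
  obtain X where X: "\<omega> \<in> Pi\<^sub>E UNIV X" "\<And>i. open (X i)" "finite {i. X i \<noteq> UNIV}" "Pi\<^sub>E UNIV X \<subseteq> S"
    using product_topology_open_contains_basis[of "\<lambda>_. euclidean" UNIV S \<omega>] assms
    by (auto simp: open_fun_def)
  obtain n where n: "{i. X i \<noteq> UNIV} \<subseteq> {..<n}"
    using X(3) by (meson finite_nat_iff_bounded)
  have "\<omega>' \<in> S" if "\<forall>j<n. \<omega>' j = \<omega> j" for \<omega>'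
  proof -
    have "\<omega>' i \<in> X i" for i
    proof (cases "i < n")
      case True
      thus ?thesis using that X(1) by (auto simp: PiE_iff)
    next
      case False
      hence "X i = UNIV" using n by auto
      thus ?thesis by simp
    qed
    thus ?thesis using X(4) by (auto simp: PiE_iff)
  qed
  thus ?thesis using that[of n] by blast
qed

text \<open>A basic open set restricts finitely many letters, so an open set is a union of cylinders, and
  there are only countably many finite words.\<close>

lemma sets_shift_space_sigma:
  "sets (restrict_space borel (shift_space N)) = sigma_sets (shift_space N) (cylinders N)"
proof -
  let ?\<Omega> = "shift_space N"
  have "closed ?\<Omega>"
  proof -
    have "?\<Omega> = (\<Inter>n. (\<lambda>\<omega>. \<omega> n) -` {1..N})" by (auto simp: shift_space_def)
    moreover have "closed ((\<lambda>\<omega> :: nat \<Rightarrow> nat. \<omega> n) -` {1..N})" for n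
      by (intro closed_vimage continuous_on_product_coordinates) (simp add: closed_def open_discrete)
    ultimately show ?thesis by auto
  qed
  hence \<Omega>: "?\<Omega> \<in> sets borel" by simp
  have "sets (restrict_space borel ?\<Omega>) = (\<inter>) ?\<Omega> ` sigma_sets UNIV {S. open S}"
    by (simp add: sets_restrict_space borel_def)
  also have "\<dots> = sigma_sets ?\<Omega> ((\<inter>) ?\<Omega> ` {S. open S})"
    using \<Omega> by (intro sigma_sets_Int) (auto simp: borel_def)
  also have "\<dots> = sigma_sets ?\<Omega> (cylinders N)"
  proof (rule sigma_sets_eqI)
    fix a assume "a \<in> (\<inter>) ?\<Omega> ` {S. open S}"
    then obtain S where S: "open S" "a = ?\<Omega> \<inter> S" by auto
    define W where "W = {w \<in> all_words N. cylinder N w \<subseteq> S}"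
    have "a = (\<Union>w\<in>W. cylinder N w)"
    proof (intro equalityI subsetI)
      fix \<omega> assume \<omega>: "\<omega> \<in> a"
      then obtain n where n: "{\<omega>'. \<forall>j<n. \<omega>' j = \<omega> j} \<subseteq> S"
        using S open_contains_prefix_set[of S \<omega>] by auto
      have "cylinder N (map \<omega> [0..<n]) \<subseteq> S"
        using n by (auto simp: cylinder_def)
      thus "\<omega> \<in> (\<Union>w\<in>W. cylinder N w)"
        using cylinder_prefix[of \<omega> N n] \<omega> S(2) words_imp_all_words[of "map \<omega> [0..<n]" N n] by (auto simp: W_def)
    next
      fix \<omega> assume "\<omega> \<in> (\<Union>w\<in>W. cylinder N w)"
      thus "\<omega> \<in> a" using S cylinder_subset by (auto simp: W_def)
    qed
    moreover have "countable W" by (rule countableI_type)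
    ultimately show "a \<in> sigma_sets ?\<Omega> (cylinders N)"
      by (auto simp: W_def cylinders_def intro!: sigma_sets_UNION)
  next
    fix b assume "b \<in> cylinders N"
    hence "b = {} \<or> (\<exists>w. b = ?\<Omega> \<inter> {\<omega>. \<forall>j<length w. \<omega> j = w ! j})"
      by (auto simp: cylinders_def cylinder_def)
    thus "b \<in> sigma_sets ?\<Omega> ((\<inter>) ?\<Omega> ` {S. open S})"
      using open_prefix_set by (auto intro!: sigma_sets.Basic sigma_sets.Empty)
  qed
  finally show ?thesis .
qed

lemma cylinders_Pow: "cylinders N \<subseteq> Pow (shift_space N)"
  using cylinder_subset by (auto simp: cylinders_def)

lemma shift_measurable:
  assumes sets: "sets \<mu> = sigma_sets (shift_space N) (cylinders N)" and space: "space \<mu> = shift_space N"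
  shows "shift \<in> measurable \<mu> \<mu>"
proof (rule measurable_sigma_sets[OF sets cylinders_Pow])
  fix y assume "y \<in> cylinders N"
  then consider "y = {}" | w where "y = cylinder N w" "w \<in> all_words N"
    by (auto simp: cylinders_def)
  thus "shift -` y \<inter> space \<mu> \<in> sets \<mu>"
  proof cases
    case 2
    have "cylinder N ([a] @ w) \<in> sets \<mu>" if "a \<in> letters N" for a
      unfolding sets using that 2(2) by (auto simp: cylinders_def)
    thus ?thesis unfolding 2 space shift_vimage_cylinder by (intro sets.finite_UN) auto
  qed auto
qed (auto simp: space shift_in_space)


section \<open>Invariant measures and their cylinder weights\<close>

locale invariant_measure =
  fixes N :: nat and \<mu> :: "(nat \<Rightarrow> nat) measure"
  assumes inv: "\<mu> \<in> invariant_measures N"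
begin

sublocale prob_space \<mu>
  using inv by (simp add: invariant_measures_def)

lemma space_eq: "space \<mu> = shift_space N"
  using inv by (simp add: invariant_measures_def)

lemma sets_eq: "sets \<mu> = sigma_sets (shift_space N) (cylinders N)"
  using inv by (simp add: invariant_measures_def sets_shift_space_sigma)

lemma cylinder_sets: "w \<in> all_words N \<Longrightarrow> cylinder N w \<in> sets \<mu>"
  unfolding sets_eq by (auto simp: cylinders_def)

lemma measurable_shift: "shift \<in> measurable \<mu> \<mu>"
  by (rule shift_measurable[OF sets_eq space_eq])

lemma measurable_shift_funpow: "shift ^^ n \<in> measurable \<mu> \<mu>"
proof (induction n)
  case 0
  show ?case by (simp add: id_def)
next
  case (Suc n)
  show ?case unfolding funpow.simps by (rule measurable_comp[OF Suc measurable_shift])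
qed

lemma measure_shift:
  assumes "E \<in> sets \<mu>"
  shows "measure \<mu> (shift -` E \<inter> space \<mu>) = measure \<mu> E"
proof -
  have "emeasure \<mu> (shift -` E \<inter> space \<mu>) = emeasure \<mu> E"
    using inv[unfolded invariant_measures_def mem_Collect_eq] assms by blast
  thus ?thesis by (simp add: measure_def)
qed

lemma measure_shift_funpow:
  assumes "E \<in> sets \<mu>"
  shows "measure \<mu> ((shift ^^ n) -` E \<inter> space \<mu>) = measure \<mu> E"
proof (induction n)
  case 0
  have "E \<inter> space \<mu> = E" using assms sets.sets_into_space by blast
  thus ?case by simp
next
  case (Suc n)
  have "(shift ^^ Suc n) -` E \<inter> space \<mu> = shift -` ((shift ^^ n) -` E \<inter> space \<mu>) \<inter> space \<mu>"
    by (auto simp del: funpow.simps simp: funpow_Suc_right space_eq shift_in_space)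
  thus ?case
    using measure_shift[OF measurable_sets[OF measurable_shift_funpow assms, of n]] Suc by (simp only:)
qed

text \<open>The measure enters entropy and Lyapunov exponents only through the weights of cylinders.\<close>

abbreviation wt :: "nat list \<Rightarrow> real" where
  "wt w \<equiv> measure \<mu> (cylinder N w)"

lemma wt_Nil: "wt [] = 1"
  using prob_space by (simp add: space_eq)

lemma measure_UN_cylinders:
  assumes "U \<subseteq> words N n" 
  shows "measure \<mu> (\<Union>w\<in>U. cylinder N w) = (\<Sum>w\<in>U. wt w)"
proof (rule finite_measure_finite_Union)
  show "finite U" using assms finite_subset finite_words by blast
  show "cylinder N ` U \<subseteq> sets \<mu>" using assms words_imp_all_words cylinder_sets by blast
  show "disjoint_family_on (cylinder N) U"
    using assms cylinder_disjoint by (fastforce simp: disjoint_family_on_def)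
qed

lemma UN_cylinders_sets: "U \<subseteq> words N n \<Longrightarrow> (\<Union>w\<in>U. cylinder N w) \<in> sets \<mu>"
  using finite_subset[OF _ finite_words, of U N n]
  by (intro sets.finite_UN cylinder_sets) (auto dest!: subsetD intro: words_imp_all_words)

lemma sum_measure_Int_cylinders:
  assumes "E \<in> sets \<mu>"
  shows "(\<Sum>w\<in>words N n. measure \<mu> (E \<inter> cylinder N w)) = measure \<mu> E"
proof -
  have "(\<Sum>w\<in>words N n. measure \<mu> (E \<inter> cylinder N w)) = measure \<mu> (\<Union>w\<in>words N n. E \<inter> cylinder N w)"
  proof (rule finite_measure_finite_Union[symmetric])
    show "(\<lambda>w. E \<inter> cylinder N w) ` words N n \<subseteq> sets \<mu>"
      using assms words_imp_all_words cylinder_sets by blast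
    show "disjoint_family_on (\<lambda>w. E \<inter> cylinder N w) (words N n)"
      using cylinder_disjoint by (fastforce simp: disjoint_family_on_def)
  qed simp
  also have "(\<Union>w\<in>words N n. E \<inter> cylinder N w) = E \<inter> shift_space N"
    using cylinders_cover by blast
  also have "\<dots> = E" using sets.sets_into_space[OF assms] by (auto simp: space_eq)
  finally show ?thesis .
qed

lemma sum_wt_append_right:
  assumes "u \<in> all_words N"
  shows "(\<Sum>v\<in>words N n. wt (u @ v)) = wt u"
proof -
  have "(\<Sum>v\<in>words N n. wt (u @ v)) = measure \<mu> (\<Union>v\<in>words N n. cylinder N (u @ v))"
  proof (rule finite_measure_finite_Union[symmetric])
    show "(\<lambda>v. cylinder N (u @ v)) ` words N n \<subseteq> sets \<mu>"
      using assms by (auto intro!: cylinder_sets dest: words_imp_all_words)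
    show "disjoint_family_on (\<lambda>v. cylinder N (u @ v)) (words N n)"
      unfolding disjoint_family_on_def
    proof (intro ballI impI)
      fix v v' assume "v \<in> words N n" "v' \<in> words N n" "v \<noteq> v'"
      hence "cylinder N v \<inter> cylinder N v' = {}" by (rule cylinder_disjoint)
      thus "cylinder N (u @ v) \<inter> cylinder N (u @ v') = {}" unfolding cylinder_append by blast
    qed
  qed simp
  also have "(\<Union>v\<in>words N n. cylinder N (u @ v)) = cylinder N u"
  proof (intro equalityI subsetI)
    fix \<omega> assume \<omega>: "\<omega> \<in> cylinder N u"
    hence "\<omega> \<in> shift_space N" using cylinder_subset by blast
    moreover from this have "(shift ^^ length u) \<omega> \<in> (\<Union>v\<in>words N n. cylinder N v)"
      unfolding cylinders_cover by (rule shift_funpow_space)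
    ultimately show "\<omega> \<in> (\<Union>v\<in>words N n. cylinder N (u @ v))"
      unfolding cylinder_append using \<omega> by blast
  qed (auto simp: cylinder_append)
  finally show ?thesis .
qed

lemma sum_wt_append_left:
  assumes "v \<in> all_words N"
  shows "(\<Sum>u\<in>words N n. wt (u @ v)) = wt v"
proof -
  let ?E = "(shift ^^ n) -` cylinder N v \<inter> space \<mu>"
  have "wt v = measure \<mu> ?E"
    using measure_shift_funpow[OF cylinder_sets[OF assms]] by simp
  also have "\<dots> = (\<Sum>u\<in>words N n. measure \<mu> (?E \<inter> cylinder N u))"
    by (rule sum_measure_Int_cylinders[symmetric])
      (intro measurable_sets[OF measurable_shift_funpow] cylinder_sets assms)
  also have "\<dots> = (\<Sum>u\<in>words N n. wt (u @ v))"
    by (intro sum.cong refl) (simp add: cylinder_append words_length space_eq Int_commute)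
  finally show ?thesis by simp
qed

lemma sum_wt: "(\<Sum>w\<in>words N n. wt w) = 1"
  using sum_wt_append_right[of "[]" n] wt_Nil by simp

definition block_entropy :: "nat \<Rightarrow> real" where
  "block_entropy n = (\<Sum>w\<in>words N n. - wt w * ln (wt w))"

text \<open>The joint entropy of two blocks is at most the sum of their entropies, because the relative entropy
  of the joint weights with respect to the product weights is nonnegative. Invariance identifies
  the distribution of the second block with that of a first block of the same length.\<close>

lemma block_entropy_subadditive: "block_entropy (m + n) \<le> block_entropy m + block_entropy n"
proof -
  have *: "wt (u @ v) * (ln (wt u) + ln (wt v)) - wt (u @ v) * ln (wt (u @ v)) \<le> wt u * wt v - wt (u @ v)"
    if uv: "u \<in> words N m" "v \<in> words N n" for u v
  proof (cases "wt (u @ v) > 0")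
    case True
    have "wt (u @ v) \<le> wt u"
      unfolding cylinder_append using uv
      by (intro finite_measure_mono cylinder_sets words_imp_all_words) auto
    moreover have "wt (u @ v) \<le> wt v"
    proof -
      have "wt (u @ v) \<le> (\<Sum>u\<in>words N m. wt (u @ v))"
        using uv by (intro member_le_sum) auto
      thus ?thesis using sum_wt_append_left[OF words_imp_all_words[OF uv(2)], of m] by simp
    qed
    ultimately have pos: "wt u > 0" "wt v > 0" using True by linarith+
    \<comment> \<open>Summing this form of \<open>ln x \<le> x - 1\<close> over all pairs leaves \<open>1 - 1 = 0\<close> on the right.\<close>
    have "ln (wt u * wt v / wt (u @ v)) \<le> wt u * wt v / wt (u @ v) - 1"
      using pos True by (intro ln_le_minus_one) auto
    hence "wt (u @ v) * ln (wt u * wt v / wt (u @ v)) \<le> wt u * wt v - wt (u @ v)"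
      using True by (simp add: field_simps)
    thus ?thesis using pos True by (simp add: ln_div ln_mult algebra_simps)
  next
    case False
    hence "wt (u @ v) = 0" using measure_nonneg[of \<mu> "cylinder N (u @ v)"] by linarith
    thus ?thesis by simp
  qed
  have "(\<Sum>u\<in>words N m. \<Sum>v\<in>words N n. wt (u @ v) * (ln (wt u) + ln (wt v)) - wt (u @ v) * ln (wt (u @ v)))
     \<le> (\<Sum>u\<in>words N m. \<Sum>v\<in>words N n. wt u * wt v - wt (u @ v))"
    using * by (intro sum_mono) auto
  also have "\<dots> = (\<Sum>u\<in>words N m. wt u * (\<Sum>v\<in>words N n. wt v)) - (\<Sum>w\<in>words N (m + n). wt w)"
    by (simp add: sum_subtractf sum_distrib_left sum_words_append)
  also have "\<dots> = 0" by (simp add: sum_wt)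
  finally have le: "(\<Sum>u\<in>words N m. \<Sum>v\<in>words N n. wt (u @ v) * (ln (wt u) + ln (wt v)) - wt (u @ v) * ln (wt (u @ v))) \<le> 0" .
  have 1: "(\<Sum>u\<in>words N m. \<Sum>v\<in>words N n. wt (u @ v) * ln (wt u)) = - block_entropy m"
  proof -
    have "(\<Sum>u\<in>words N m. \<Sum>v\<in>words N n. wt (u @ v) * ln (wt u)) = (\<Sum>u\<in>words N m. wt u * ln (wt u))"
      by (intro sum.cong refl) (simp add: sum_distrib_right[symmetric] sum_wt_append_right words_imp_all_words)
    thus ?thesis by (simp add: block_entropy_def sum_negf)
  qed
  have 2: "(\<Sum>u\<in>words N m. \<Sum>v\<in>words N n. wt (u @ v) * ln (wt v)) = - block_entropy n"
  proof -
    have "(\<Sum>v\<in>words N n. \<Sum>u\<in>words N m. wt (u @ v) * ln (wt v)) = (\<Sum>v\<in>words N n. wt v * ln (wt v))"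
      by (intro sum.cong refl) (simp add: sum_distrib_right[symmetric] sum_wt_append_left words_imp_all_words)
    thus ?thesis by (subst sum.swap) (simp add: block_entropy_def sum_negf)
  qed
  show ?thesis
    using le 1 2
    by (simp add: sum_subtractf distrib_left sum.distrib block_entropy_def[of "m + n"] sum_words_append sum_negf)
qed

lemma block_entropy_nonneg: "block_entropy n \<ge> 0"
  unfolding block_entropy_def
proof (intro sum_nonneg)
  fix w
  have "ln (wt w) \<le> 0"
    using prob_le_1[of "cylinder N w"] by (cases "wt w = 0") (auto simp: less_le)
  thus "- wt w * ln (wt w) \<ge> 0" by (simp add: mult_nonneg_nonpos)
qed

lemma weighted_log_subadditive:
  assumes pos: "\<And>w. w \<in> all_words N \<Longrightarrow> 0 < \<psi> w"
    and sub: "\<And>u v. u \<in> all_words N \<Longrightarrow> v \<in> all_words N \<Longrightarrow> \<psi> (u @ v) \<le> \<psi> u * \<psi> v"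
  shows "(\<Sum>w\<in>words N (m + n). wt w * ln (\<psi> w))
    \<le> (\<Sum>w\<in>words N m. wt w * ln (\<psi> w)) + (\<Sum>w\<in>words N n. wt w * ln (\<psi> w))"
proof -
  have "(\<Sum>w\<in>words N (m + n). wt w * ln (\<psi> w))
     \<le> (\<Sum>u\<in>words N m. \<Sum>v\<in>words N n. wt (u @ v) * ln (\<psi> u) + wt (u @ v) * ln (\<psi> v))"
    unfolding sum_words_append
  proof (intro sum_mono)
    fix u v assume uv: "u \<in> words N m" "v \<in> words N n"
    hence l: "u \<in> all_words N" "v \<in> all_words N" using words_imp_all_words by blast+
    have "u @ v \<in> all_words N" using l by simp
    hence "ln (\<psi> (u @ v)) \<le> ln (\<psi> u * \<psi> v)"
      using sub[OF l] pos by (subst ln_le_cancel_iff) (auto simp: l pos)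
    also have "\<dots> = ln (\<psi> u) + ln (\<psi> v)" using pos[OF l(1)] pos[OF l(2)] by (simp add: ln_mult)
    finally show "wt (u @ v) * ln (\<psi> (u @ v)) \<le> wt (u @ v) * ln (\<psi> u) + wt (u @ v) * ln (\<psi> v)"
      by (simp add: distrib_left[symmetric] mult_left_mono)
  qed
  also have "\<dots> = (\<Sum>u\<in>words N m. \<Sum>v\<in>words N n. wt (u @ v) * ln (\<psi> u))
     + (\<Sum>v\<in>words N n. \<Sum>u\<in>words N m. wt (u @ v) * ln (\<psi> v))"
    by (subst (3) sum.swap) (simp add: sum.distrib)
  also have "\<dots> = (\<Sum>w\<in>words N m. wt w * ln (\<psi> w)) + (\<Sum>w\<in>words N n. wt w * ln (\<psi> w))"
    using words_imp_all_words
    by (intro arg_cong2[where f="(+)"] sum.cong refl)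
      (simp_all only: sum_distrib_right[symmetric] sum_wt_append_left[OF words_imp_all_words] sum_wt_append_right[OF words_imp_all_words])
  finally show ?thesis .
qed

end

text \<open>The sets that admit approximations form a \<open>\<sigma>\<close>-algebra. One union of cylinders has to
  approximate with respect to both measures at once, since it will transfer smallness from \<open>\<mu>\<close> to
  \<open>\<nu>\<close>.\<close>

lemma approximation_by_cylinders:
  assumes \<mu>: "\<mu> \<in> invariant_measures N" and \<nu>: "\<nu> \<in> invariant_measures N"
    and E: "E \<in> sets \<mu>" and "e > 0"
  shows "\<exists>n U. U \<subseteq> words N n \<and>
     measure \<mu> (E - (\<Union>w\<in>U. cylinder N w)) + measure \<mu> ((\<Union>w\<in>U. cylinder N w) - E) < e \<and>
     measure \<nu> (E - (\<Union>w\<in>U. cylinder N w)) + measure \<nu> ((\<Union>w\<in>U. cylinder N w) - E) < e"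
proof -
  interpret M: invariant_measure N \<mu> using \<mu> by unfold_locales
  interpret V: invariant_measure N \<nu> using \<nu> by unfold_locales
  let ?C = "\<lambda>U. \<Union>w\<in>U. cylinder N w"
  let ?d = "\<lambda>\<rho> A B. measure \<rho> (A - B) + measure \<rho> (B - A)"
  have sets: "sets \<nu> = sets \<mu>" by (simp add: M.sets_eq V.sets_eq)
  have Csets: "?C U \<in> sets \<mu>" if "U \<subseteq> words N n" for U n
    by (rule M.UN_cylinders_sets[OF that])
  \<comment> \<open>Approximations of different lengths can be brought to a common length.\<close>
  have refine: "\<exists>U'. U' \<subseteq> words N (n + k) \<and> ?C U' = ?C U" if U: "U \<subseteq> words N n" for n k U
  proof (intro exI conjI)
    let ?U' = "(\<lambda>(u, v). u @ v) ` (U \<times> words N k)"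
    show "?U' \<subseteq> words N (n + k)" using U by (auto intro!: words_append)
    show "?C ?U' = ?C U"
    proof (intro equalityI subsetI)
      fix \<omega> assume "\<omega> \<in> ?C ?U'"
      thus "\<omega> \<in> ?C U" by (auto simp: cylinder_append)
    next
      fix \<omega> assume "\<omega> \<in> ?C U"
      then obtain u where u: "u \<in> U" "\<omega> \<in> cylinder N u" by blast
      hence \<omega>: "\<omega> \<in> shift_space N" using cylinder_subset by blast
      hence "(shift ^^ length u) \<omega> \<in> (\<Union>v\<in>words N k. cylinder N v)"
        unfolding cylinders_cover by (rule shift_funpow_space)
      then obtain v where v: "v \<in> words N k" "(shift ^^ length u) \<omega> \<in> cylinder N v" by blast
      hence "\<omega> \<in> cylinder N (u @ v)" unfolding cylinder_append using u \<omega> by blast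
      moreover have "u @ v \<in> ?U'" using u v by (intro image_eqI[of _ _ "(u, v)"]) auto
      ultimately show "\<omega> \<in> ?C ?U'" by (rule UN_I[rotated])
    qed
  qed
  define good where "good E \<longleftrightarrow> (\<forall>e>0. \<exists>n U. U \<subseteq> words N n \<and> ?d \<mu> E (?C U) < e \<and> ?d \<nu> E (?C U) < e)" for E
  have "E \<in> sigma_sets (shift_space N) (cylinders N)" using E by (simp add: M.sets_eq)
  hence "E \<in> sets \<mu> \<and> good E"
  proof (induction rule: sigma_sets.induct)
    case (Basic a)
    have "\<exists>n U. U \<subseteq> words N n \<and> ?C U = a"
    proof (cases "a = {}")
      case True
      thus ?thesis by (intro exI[of _ 0] exI[of _ "{}"]) auto
    next
      case False
      then obtain w where "w \<in> all_words N" "a = cylinder N w" using Basic by (auto simp: cylinders_def)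
      thus ?thesis by (intro exI[of _ "length w"] exI[of _ "{w}"]) (auto simp: words_length_iff)
    qed
    then obtain n U where U: "U \<subseteq> words N n" "?C U = a" by blast
    have "good a" unfolding good_def U(2)[symmetric]
      by (intro allI impI exI[of _ n] exI[of _ U] conjI U(1)) auto
    moreover have "a \<in> sets \<mu>" using Csets[OF U(1)] U(2) by (simp only:)
    ultimately show ?case by blast
  next
    case Empty
    show ?case unfolding good_def by (auto intro!: exI[of _ "{}"])
  next
    case (Compl a)
    have "good (shift_space N - a)" unfolding good_def
    proof (intro allI impI)
      fix e :: real assume "e > 0"
      then obtain n U where U: "U \<subseteq> words N n" "?d \<mu> a (?C U) < e" "?d \<nu> a (?C U) < e"
        using Compl unfolding good_def by blast
      have a: "a \<subseteq> shift_space N" using Compl sets.sets_into_space[of a \<mu>] by (simp add: M.space_eq)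
      have C: "?C (words N n - U) = shift_space N - ?C U"
        by (rule cylinder_union_complement[OF U(1)])
      have "?C U \<subseteq> shift_space N" using cylinder_subset by blast
      hence eq: "shift_space N - a - ?C (words N n - U) = ?C U - a"
        "?C (words N n - U) - (shift_space N - a) = a - ?C U"
        unfolding C using a by blast+
      show "\<exists>n U. U \<subseteq> words N n \<and> ?d \<mu> (shift_space N - a) (?C U) < e \<and> ?d \<nu> (shift_space N - a) (?C U) < e"
        by (rule exI[of _ n], rule exI[of _ "words N n - U"]) (use U(2,3) in \<open>simp only: eq, auto simp: add.commute\<close>)
    qed
    moreover have "shift_space N - a \<in> sets \<mu>"
      using sets.compl_sets[of a \<mu>] Compl by (simp add: M.space_eq)
    ultimately show ?case by blast
  next
    case (Union a)
    have a: "\<And>i. a i \<in> sets \<mu>" using Union by blast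
    have "good (\<Union>i. a i)" unfolding good_def
    proof (intro allI impI)
      fix e :: real assume e: "e > 0"
      \<comment> \<open>A countable union is replaced by a finite one; the \<open>k\<close> pieces then share \<open>e / 2\<close>.\<close>
      have tail: "\<exists>m. \<forall>k\<ge>m. measure \<rho> ((\<Union>i. a i) - (\<Union>i<k. a i)) < e / 2"
        if "prob_space \<rho>" "sets \<rho> = sets \<mu>" for \<rho>
      proof -
        interpret P: prob_space \<rho> by fact
        have am: "\<And>i. a i \<in> sets \<rho>" using a that by simp
        have "(\<lambda>k. measure \<rho> ((\<Union>i. a i) - (\<Union>i<k. a i))) \<longlonglongrightarrow> measure \<rho> (\<Inter>k. (\<Union>i. a i) - (\<Union>i<k. a i))"
          using am by (intro P.finite_Lim_measure_decseq) (auto simp: decseq_def)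
        moreover have "(\<Inter>k. (\<Union>i. a i) - (\<Union>i<k. a i)) = {}" by blast
        ultimately have "(\<lambda>k. measure \<rho> ((\<Union>i. a i) - (\<Union>i<k. a i))) \<longlonglongrightarrow> 0"
          by (simp only: measure_empty)
        from order_tendstoD(2)[OF this, of "e / 2"] e show ?thesis by (simp add: eventually_sequentially)
      qed
      obtain m1 where m1: "\<And>k. k \<ge> m1 \<Longrightarrow> measure \<mu> ((\<Union>i. a i) - (\<Union>i<k. a i)) < e / 2"
        using tail[OF M.prob_space_axioms refl] by blast
      obtain m2 where m2: "\<And>k. k \<ge> m2 \<Longrightarrow> measure \<nu> ((\<Union>i. a i) - (\<Union>i<k. a i)) < e / 2"
        using tail[OF V.prob_space_axioms sets] by blast
      define k where "k = max 1 (max m1 m2)"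
      define e' where "e' = e / (2 * real k)"
      have e': "e' > 0" using e by (simp add: e'_def k_def)
      have "\<forall>i. \<exists>n U. U \<subseteq> words N n \<and> ?d \<mu> (a i) (?C U) < e' \<and> ?d \<nu> (a i) (?C U) < e'"
        using Union e' unfolding good_def by blast
      then obtain n U where nU: "\<And>i. U i \<subseteq> words N (n i)"
        "\<And>i. ?d \<mu> (a i) (?C (U i)) < e'" "\<And>i. ?d \<nu> (a i) (?C (U i)) < e'" by metis
      define n' where "n' = (\<Sum>i<k. n i)"
      have "\<exists>U'. U' \<subseteq> words N n' \<and> ?C U' = ?C (U i)" if "i < k" for i
      proof -
        have "n i \<le> n'" unfolding n'_def using that by (intro member_le_sum) auto
        thus ?thesis using refine[OF nU(1)[of i], of "n' - n i"] by simp
      qed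
      then obtain U' where U': "\<And>i. i < k \<Longrightarrow> U' i \<subseteq> words N n'" "\<And>i. i < k \<Longrightarrow> ?C (U' i) = ?C (U i)"
        by metis
      define W where "W = (\<Union>i<k. U' i)"
      have W: "W \<subseteq> words N n'" using U' by (auto simp: W_def)
      have CW: "?C W = (\<Union>i<k. ?C (U i))"
      proof -
        have "?C W = (\<Union>i<k. ?C (U' i))" by (auto simp: W_def)
        thus ?thesis using U'(2) by auto
      qed
      have est: "?d \<rho> (\<Union>i. a i) (?C W) < e"
        if "prob_space \<rho>" and sr: "sets \<rho> = sets \<mu>" and t: "measure \<rho> ((\<Union>i. a i) - (\<Union>i<k. a i)) < e / 2"
          and d: "\<And>i. ?d \<rho> (a i) (?C (U i)) < e'" for \<rho>
      proof -
        interpret P: prob_space \<rho> by fact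
        have am: "\<And>i. a i \<in> sets \<rho>" using a sr by simp
        define D where "D i = ?C (U i)" for i
        have Dm: "\<And>i. D i \<in> sets \<rho>" using Csets[OF nU(1)] sr by (simp add: D_def)
        have CD: "?C W = (\<Union>i<k. D i)" unfolding CW D_def ..
        let ?T = "(\<Union>i. a i) - (\<Union>i<k. a i)"
        have T: "?T \<in> sets \<rho>" and TD: "(\<Union>i<k. a i - D i) \<in> sets \<rho>" "(\<Union>i<k. D i - a i) \<in> sets \<rho>"
          using am Dm by auto
        have "measure \<rho> ((\<Union>i. a i) - (\<Union>i<k. D i)) \<le> measure \<rho> (?T \<union> (\<Union>i<k. a i - D i))"
          using T TD by (intro P.finite_measure_mono) auto
        also have "\<dots> \<le> measure \<rho> ?T + measure \<rho> (\<Union>i<k. a i - D i)"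
          using T TD by (intro measure_Un_le)
        also have "measure \<rho> (\<Union>i<k. a i - D i) \<le> (\<Sum>i<k. measure \<rho> (a i - D i))"
          using am Dm by (intro measure_UNION_le) auto
        finally have 1: "measure \<rho> ((\<Union>i. a i) - (\<Union>i<k. D i)) \<le> measure \<rho> ?T + (\<Sum>i<k. measure \<rho> (a i - D i))" by simp
        have "measure \<rho> ((\<Union>i<k. D i) - (\<Union>i. a i)) \<le> measure \<rho> (\<Union>i<k. D i - a i)"
          using TD by (intro P.finite_measure_mono) auto
        also have "\<dots> \<le> (\<Sum>i<k. measure \<rho> (D i - a i))"
          using am Dm by (intro measure_UNION_le) auto
        finally have "?d \<rho> (\<Union>i. a i) (?C W) \<le> measure \<rho> ?T + (\<Sum>i<k. ?d \<rho> (a i) (?C (U i)))"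
          unfolding CD D_def[symmetric] using 1 by (simp add: sum.distrib)
        also have "(\<Sum>i<k. ?d \<rho> (a i) (?C (U i))) \<le> (\<Sum>i<k. e')"
          using d by (intro sum_mono less_imp_le) auto
        also have "\<dots> = e / 2" by (simp add: e'_def k_def)
        finally show ?thesis using t by linarith
      qed
      show "\<exists>n U. U \<subseteq> words N n \<and> ?d \<mu> (\<Union>i. a i) (?C U) < e \<and> ?d \<nu> (\<Union>i. a i) (?C U) < e"
        using W est[OF M.prob_space_axioms refl m1 nU(2)] est[OF V.prob_space_axioms sets m2 nU(3)]
        by (intro exI[of _ n'] exI[of _ W] conjI) (simp_all add: k_def)
    qed
    thus ?case using a by blast
  qed
  thus ?thesis using \<open>e > 0\<close> unfolding good_def by blast
qed


section \<open>Measures with prescribed cylinder weights\<close>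

text \<open>Weights that are consistent under appending a letter come from a measure; consistency under
  prepending a letter makes it invariant. Positivity lets the conditional probabilities of the
  next letter be written as quotients.\<close>

locale cylinder_weights =
  fixes N :: nat and m :: "nat list \<Rightarrow> real"
  assumes m_pos: "w \<in> all_words N \<Longrightarrow> 0 < m w"
    and m_Nil: "m [] = 1"
    and m_right: "w \<in> all_words N \<Longrightarrow> (\<Sum>a\<in>letters N. m (w @ [a])) = m w"
    and m_left: "w \<in> all_words N \<Longrightarrow> (\<Sum>a\<in>letters N. m ([a] @ w)) = m w"
begin

definition next_letter :: "nat \<Rightarrow> (nat \<Rightarrow> nat) \<Rightarrow> nat measure" where
  "next_letter n x = point_measure (letters N)
     (\<lambda>a. ennreal (m (map x [0..<n] @ [a]) / m (map x [0..<n])))"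

lemma prefix_all_words: "x \<in> PiE {0..<n} (\<lambda>_. letters N) \<Longrightarrow> map x [0..<n] \<in> all_words N"
  by (force simp: all_words_def words_letters)

lemma prob_space_next_letter:
  assumes "x \<in> PiE {0..<n} (\<lambda>_. letters N)"
  shows "prob_space (next_letter n x)"
proof (rule prob_spaceI)
  let ?w = "map x [0..<n]"
  have w: "?w \<in> all_words N" by (rule prefix_all_words[OF assms])
  have "emeasure (next_letter n x) (space (next_letter n x)) = (\<Sum>a\<in>letters N. ennreal (m (?w @ [a]) / m ?w))"
    unfolding next_letter_def by (simp add: space_point_measure emeasure_point_measure_finite)
  also have "\<dots> = ennreal (\<Sum>a\<in>letters N. m (?w @ [a]) / m ?w)"
    using w by (intro sum_ennreal) (auto intro!: less_imp_le divide_pos_pos m_pos)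
  also have "(\<Sum>a\<in>letters N. m (?w @ [a]) / m ?w) = 1"
    using m_right[OF w] m_pos[OF w] by (simp add: sum_divide_distrib[symmetric])
  finally show "emeasure (next_letter n x) (space (next_letter n x)) = 1" by simp
qed

sublocale IT: Ionescu_Tulcea next_letter "\<lambda>_. count_space (letters N)"
proof (rule Ionescu_Tulcea.intro)
  fix i :: nat
  have eq: "PiM {0..<i} (\<lambda>_. count_space (letters N)) = count_space (PiE {0..<i} (\<lambda>_. letters N))"
    by (rule count_space_PiM_finite) auto
  show "next_letter i \<in> PiM {0..<i} (\<lambda>_. count_space (letters N)) \<rightarrow>\<^sub>M subprob_algebra (count_space (letters N))"
    unfolding eq measurable_count_space_eq1
  proof
    fix x assume "x \<in> PiE {0..<i} (\<lambda>_. letters N)"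
    hence "subprob_space (next_letter i x)"
      by (intro prob_space_imp_subprob_space prob_space_next_letter)
    moreover have "sets (next_letter i x) = sets (count_space (letters N))"
      unfolding next_letter_def by (simp only: sets_point_measure sets_count_space)
    ultimately show "next_letter i x \<in> space (subprob_algebra (count_space (letters N)))"
      by (simp add: space_subprob_algebra)
  qed
  fix x assume "x \<in> space (PiM {0..<i} (\<lambda>_. count_space (letters N)))"
  thus "prob_space (next_letter i x)"
    by (intro prob_space_next_letter) (auto simp: space_PiM)
qed

text \<open>The product of the conditional probabilities of the letters telescopes.\<close>

lemma emeasure_prefix:
  assumes "x \<in> PiE {0..<n} (\<lambda>_. letters N)"
  shows "emeasure (IT.C 0 n (\<lambda>_. undefined)) {x} = ennreal (m (map x [0..<n]))"
proof -
  have "\<forall>x\<in>PiE {0..<n} (\<lambda>_. letters N). emeasure (IT.C 0 n (\<lambda>_. undefined)) {x} = ennreal (m (map x [0..<n]))"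
  proof (induction n)
    case 0
    have "{\<lambda>_. undefined} \<in> sets (PiM {} (\<lambda>_::nat. count_space (letters N)))"
      by (simp add: sets_PiM_empty)
    thus ?case by (simp add: m_Nil)
  next
    case (Suc n)
    show ?case
    proof
      fix x assume Suc_prems: "x \<in> PiE {0..<Suc n} (\<lambda>_. letters N)"
      let ?M = "\<lambda>n. PiM {0..<n} (\<lambda>_. count_space (letters N))"
      have cnt: "?M n = count_space (PiE {0..<n} (\<lambda>_. letters N))" for n :: nat
        by (rule count_space_PiM_finite) auto
      let ?C = "IT.C 0 n (\<lambda>_. undefined)"
      have C: "sets ?C = sets (?M n)" "space ?C = space (?M n)"
        using IT.sets_C[of "\<lambda>_. undefined" 0 n] IT.space_C[of "\<lambda>_. undefined" 0 n] by (simp_all add: space_PiM)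
      have sne: "space ?C \<noteq> {}"
        using prob_space.not_empty[OF IT.prob_space_C[of "\<lambda>_. undefined" 0 n]] by (simp add: space_PiM)
      define y where "y = restrict x {0..<n}"
      have y: "y \<in> PiE {0..<n} (\<lambda>_. letters N)" using Suc_prems by (simp add: y_def PiE_iff)
      have my: "map y [0..<n] = map x [0..<n]" by (simp add: y_def)
      have xn: "x n \<in> letters N" using PiE_mem[OF Suc_prems] by simp
      have pw: "map x [0..<n] \<in> all_words N" using prefix_all_words[OF y] my by simp
      define c where "c = ennreal (m (map x [0..<n] @ [x n]) / m (map x [0..<n]))"
      have xs: "{x} \<in> sets (?M (Suc n))" unfolding cnt using Suc_prems by simp
      have eP: "emeasure (IT.eP n \<omega>) {x} = c * indicator {y} \<omega>" if \<omega>: "\<omega> \<in> space (?M n)" for \<omega>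
      proof -
        have \<omega>': "\<omega> \<in> PiE {0..<n} (\<lambda>_. letters N)" using \<omega> by (simp add: space_PiM)
        have "emeasure (IT.eP n \<omega>) {x} = emeasure (next_letter n \<omega>) ((\<lambda>a. fun_upd \<omega> n a) -` {x} \<inter> letters N)"
          using IT.emeasure_eP[OF \<omega> xs] by simp
        also have "\<dots> = c * indicator {y} \<omega>"
        proof (cases "\<omega> = y")
          case True
          have "(\<lambda>a. fun_upd \<omega> n a) -` {x} \<inter> letters N = {x n}"
          proof (intro equalityI subsetI)
            fix a assume "a \<in> (\<lambda>a. fun_upd \<omega> n a) -` {x} \<inter> letters N"
            hence "fun_upd \<omega> n a = x" by simp
            from fun_cong[OF this, of n] show "a \<in> {x n}" by simp
          next
            fix a assume a: "a \<in> {x n}"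
            have "fun_upd y n (x n) i = x i" for i
              using PiE_arb[OF Suc_prems, of i] by (auto simp: y_def less_Suc_eq)
            thus "a \<in> (\<lambda>a. fun_upd \<omega> n a) -` {x} \<inter> letters N" using a xn True by auto
          qed
          thus ?thesis using True xn
            by (simp add: next_letter_def emeasure_point_measure_finite my c_def)
        next
          case False
          have "fun_upd \<omega> n a \<noteq> x" for a
          proof
            assume eq: "fun_upd \<omega> n a = x"
            have "\<omega> i = y i" for i
            proof (cases "i \<in> {0..<n}")
              case True
              thus ?thesis using fun_cong[OF eq, of i] by (simp add: y_def)
            next
              case False
              thus ?thesis using PiE_arb[OF \<omega>' False] by (simp add: y_def)
            qed
            thus False using False by auto
          qed
          hence "(\<lambda>a. fun_upd \<omega> n a) -` {x} \<inter> letters N = {}" by blast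
          thus ?thesis using False by (simp only:) simp
        qed
        finally show ?thesis .
      qed
      have ePm: "IT.eP n \<in> ?C \<rightarrow>\<^sub>M subprob_algebra (?M (Suc n))"
        using IT.measurable_eP[of n] by (simp only: measurable_cong_sets[OF C(1) refl])
      have "emeasure (IT.C 0 (Suc n) (\<lambda>_. undefined)) {x} = (\<integral>\<^sup>+\<omega>. emeasure (IT.eP n \<omega>) {x} \<partial>IT.C 0 n (\<lambda>_. undefined))"
        unfolding IT.C.simps
        using emeasure_bind[OF sne ePm xs] by simp
      also have "\<dots> = (\<integral>\<^sup>+\<omega>. c * indicator {y} \<omega> \<partial>IT.C 0 n (\<lambda>_. undefined))"
        using eP unfolding C(2)[symmetric] by (rule nn_integral_cong)
      also have "\<dots> = c * emeasure (IT.C 0 n (\<lambda>_. undefined)) {y}"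
        by (rule nn_integral_cmult_indicator) (simp only: C cnt, simp add: y)
      also have "\<dots> = c * ennreal (m (map x [0..<n]))"
        using bspec[OF Suc.IH y] my by simp
      also have "\<dots> = ennreal (m (map x [0..<Suc n]))"
        using m_pos[OF pw] xn pw m_pos[of "map x [0..<n] @ [x n]"] unfolding c_def
        by (subst ennreal_mult[symmetric]) auto
      finally show "emeasure (IT.C 0 (Suc n) (\<lambda>_. undefined)) {x} = ennreal (m (map x [0..<Suc n]))" .
    qed
  qed
  thus ?thesis using assms by blast
qed

lemma emeasure_lim_cylinder:
  assumes "w \<in> all_words N"
  shows "cylinder N w \<in> sets IT.PF.lim" "emeasure IT.PF.lim (cylinder N w) = ennreal (m w)"
proof -
  define n where "n = length w"
  define x where "x = (\<lambda>i\<in>{0..<n}. w ! i)"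
  let ?M = "\<lambda>n. PiM {0..<n} (\<lambda>_. count_space (letters N))"
  have cnt: "?M n = count_space (PiE {0..<n} (\<lambda>_. letters N))"
    by (rule count_space_PiM_finite) auto
  have wi: "w ! i \<in> letters N" if "i < n" for i
    using assms that nth_mem[of i w] by (auto simp: all_words_def words_letters n_def)
  have x: "x \<in> PiE {0..<n} (\<lambda>_. letters N)" using wi by (auto simp: x_def)
  have mx: "map x [0..<n] = w" by (intro nth_equalityI) (auto simp: x_def n_def)
  have xs: "{x} \<in> sets (?M n)" unfolding cnt using x by simp
  have cyl: "cylinder N w = IT.PF.emb UNIV {0..<n} {x}"
  proof -
    have "restrict \<omega> {0..<n} = x \<longleftrightarrow> (\<forall>j<n. \<omega> j = w ! j)" for \<omega> :: "nat \<Rightarrow> nat"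
      by (auto simp: x_def fun_eq_iff restrict_def)
    thus ?thesis
      by (auto simp: prod_emb_def cylinder_def space_PiM shift_space_letters n_def PiE_UNIV_domain)
  qed
  show "cylinder N w \<in> sets IT.PF.lim"
    unfolding cyl IT.PF.sets_lim using xs by (intro measurable_prod_emb) auto
  have "emeasure IT.PF.lim (cylinder N w) = emeasure (IT.CI {0..<n}) {x}"
    unfolding cyl using xs by (intro IT.lim) auto
  also have "\<dots> = emeasure (IT.C 0 n (\<lambda>_. undefined)) (IT.PF.emb {0..<n} {0..<n} {x})"
    using xs by (intro IT.emeasure_CI) auto
  also have "IT.PF.emb {0..<n} {0..<n} {x} = {x}"
    using sets.sets_into_space[OF xs] by (intro prod_emb_id) (auto simp: space_PiM)
  finally show "emeasure IT.PF.lim (cylinder N w) = ennreal (m w)"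
    using emeasure_prefix[OF x] mx by simp
qed

text \<open>The infinite composition of the kernels \<open>next_letter\<close> has the prescribed weights; it is
  transported by the identity to the Borel \<open>\<sigma>\<close>-algebra of the shift space.\<close>

theorem exists_invariant_measure:
  obtains \<mu> where "\<mu> \<in> invariant_measures N" "\<And>w. w \<in> all_words N \<Longrightarrow> measure \<mu> (cylinder N w) = m w"
proof -
  define \<mu> where "\<mu> = distr IT.PF.lim (restrict_space borel (shift_space N)) (\<lambda>\<omega>. \<omega>)"
  have sets: "sets \<mu> = sigma_sets (shift_space N) (cylinders N)" by (simp add: \<mu>_def sets_shift_space_sigma)
  have space: "space \<mu> = shift_space N" by (simp add: \<mu>_def space_restrict_space)
  have slim: "space IT.PF.lim = shift_space N"
    by (auto simp: IT.PF.space_lim space_PiM shift_space_letters PiE_UNIV_domain)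
  have id: "(\<lambda>\<omega>. \<omega>) \<in> measurable IT.PF.lim (restrict_space borel (shift_space N))"
  proof (rule measurable_sigma_sets[OF sets_shift_space_sigma cylinders_Pow])
    fix y assume "y \<in> cylinders N"
    hence "y \<in> sets IT.PF.lim"
      unfolding cylinders_def using emeasure_lim_cylinder(1) by auto
    thus "(\<lambda>\<omega>. \<omega>) -` y \<inter> space IT.PF.lim \<in> sets IT.PF.lim" by auto
  qed (use slim in auto)
  have cs: "cylinder N w \<in> sets \<mu>" if "w \<in> all_words N" for w
    unfolding sets using that by (auto simp: cylinders_def)
  have em: "emeasure \<mu> (cylinder N w) = ennreal (m w)" if "w \<in> all_words N" for w
  proof -
    have "emeasure \<mu> (cylinder N w) = emeasure IT.PF.lim ((\<lambda>\<omega>. \<omega>) -` cylinder N w \<inter> space IT.PF.lim)"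
      unfolding \<mu>_def using id cs[OF that] by (intro emeasure_distr) (simp_all add: \<mu>_def)
    also have "(\<lambda>\<omega>. \<omega>) -` cylinder N w \<inter> space IT.PF.lim = cylinder N w"
      using cylinder_subset[of N w] slim by auto
    finally show ?thesis using emeasure_lim_cylinder(2)[OF that] by simp
  qed
  have prob: "prob_space \<mu>"
  proof
    show "emeasure \<mu> (space \<mu>) = 1" using em[of "[]"] by (simp add: space m_Nil)
  qed
  have ms: "shift \<in> measurable \<mu> \<mu>" by (rule shift_measurable[OF sets space])
  have "distr \<mu> \<mu> shift = \<mu>"
  proof (rule measure_eqI_generator_eq[OF Int_stable_cylinders cylinders_Pow])
    fix X assume X: "X \<in> cylinders N"
    then consider "X = {}" | w where "X = cylinder N w" "w \<in> all_words N"
      by (auto simp: cylinders_def)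
    thus "emeasure (distr \<mu> \<mu> shift) X = emeasure \<mu> X"
    proof cases
      case 2
      have "emeasure (distr \<mu> \<mu> shift) X = emeasure \<mu> (\<Union>a\<in>letters N. cylinder N ([a] @ w))"
        unfolding 2 using cs[OF 2(2)] by (subst emeasure_distr[OF ms]) (simp_all only: space shift_vimage_cylinder)
      also have "\<dots> = (\<Sum>a\<in>letters N. emeasure \<mu> (cylinder N ([a] @ w)))"
      proof (rule sum_emeasure[symmetric])
        show "(\<lambda>a. cylinder N ([a] @ w)) ` (letters N) \<subseteq> sets \<mu>" using 2 by (auto intro!: cs)
        show "disjoint_family_on (\<lambda>a. cylinder N ([a] @ w)) (letters N)"
          unfolding cylinder_append by (auto simp: disjoint_family_on_def cylinder_def)
      qed simp
      also have "\<dots> = (\<Sum>a\<in>letters N. ennreal (m ([a] @ w)))"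
        using 2 by (intro sum.cong refl em) auto
      also have "\<dots> = ennreal (\<Sum>a\<in>letters N. m ([a] @ w))"
        using 2 by (intro sum_ennreal) (auto intro!: less_imp_le m_pos)
      finally show ?thesis using m_left[OF 2(2)] em[OF 2(2)] 2 by simp
    qed simp
  next
    show "range (\<lambda>_::nat. shift_space N) \<subseteq> cylinders N"
      by (auto simp: cylinders_def intro!: image_eqI[of _ _ "[]"])
    show "emeasure (distr \<mu> \<mu> shift) (shift_space N) \<noteq> \<infinity>"
      using prob_space.emeasure_space_1[OF prob_space.prob_space_distr[OF prob ms]] by (simp add: space)
  qed (simp_all add: sets)
  hence "emeasure \<mu> (shift -` E \<inter> space \<mu>) = emeasure \<mu> E" if "E \<in> sets \<mu>" for E
    using emeasure_distr[OF ms that] by simp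
  hence "\<mu> \<in> invariant_measures N"
    using prob space unfolding invariant_measures_def by (simp add: \<mu>_def)
  moreover have "measure \<mu> (cylinder N w) = m w" if "w \<in> all_words N" for w
    using em[OF that] m_pos[OF that] by (simp add: measure_def)
  ultimately show ?thesis using that by blast
qed

end


section \<open>Gibbs measures of quasi-multiplicative potentials\<close>

text \<open>Pointwise convergence is convergence in the product of countably many compact intervals, which is
  a compact metrizable space.\<close>

lemma bounded_pointwise_convergent_subsequence:
  fixes f :: "nat \<Rightarrow> 'a::countable \<Rightarrow> real"
  assumes "\<And>n x. f n x \<in> {a..b}"
  obtains k where "strict_mono (k :: nat \<Rightarrow> nat)" "\<And>x. \<exists>l. (\<lambda>n. f (k n) x) \<longlonglongrightarrow> l"
proof -
  have "compactin (product_topology (\<lambda>_::'a. euclidean) UNIV) (PiE UNIV (\<lambda>_. {a..b}))"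
    by (subst compactin_PiE) simp
  hence "compact (PiE (UNIV :: 'a set) (\<lambda>_. {a..b}))"
    by (simp add: euclidean_product_topology)
  hence "seq_compact (PiE (UNIV :: 'a set) (\<lambda>_. {a..b}))" by (simp add: compact_eq_seq_compact_metric)
  moreover have "\<forall>n. f n \<in> PiE UNIV (\<lambda>_. {a..b})" using assms by (simp add: PiE_UNIV_domain)
  ultimately obtain g k where k: "strict_mono (k :: nat \<Rightarrow> nat)" "(f \<circ> k) \<longlonglongrightarrow> g"
    by (rule seq_compactE)
  have "(\<lambda>n. f (k n) x) \<longlonglongrightarrow> g x" for x
    using continuous_on_tendsto_compose[OF continuous_on_product_coordinates[of x] k(2)] by (simp add: o_def)
  thus ?thesis using that k(1) by blast
qed

text \<open>The potential need not be close to multiplicative along every pair of words: only some connecting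
  word of length at most \<open>K\<close> has to lose no more than the factor \<open>c\<close>.\<close>

locale quasi_multiplicative =
  fixes N :: nat and \<psi> :: "nat list \<Rightarrow> real" and c \<delta> :: real and K :: nat
  assumes N: "1 \<le> N"
    and c: "0 < c" and \<delta>: "0 < \<delta>"
    and submult: "u \<in> all_words N \<Longrightarrow> v \<in> all_words N \<Longrightarrow> \<psi> (u @ v) \<le> \<psi> u * \<psi> v"
    and quasi: "u \<in> all_words N \<Longrightarrow> v \<in> all_words N \<Longrightarrow>
      \<exists>w\<in>all_words N. length w \<le> K \<and> c * \<psi> u * \<psi> v \<le> \<psi> (u @ w @ v)"
    and lower: "w \<in> all_words N \<Longrightarrow> \<delta> ^ length w \<le> \<psi> w"
begin

lemma pos: "w \<in> all_words N \<Longrightarrow> 0 < \<psi> w"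
  using lower[of w] \<delta> by (meson less_le_trans zero_less_power)

definition Z :: "nat \<Rightarrow> real" where
  "Z n = (\<Sum>w\<in>words N n. \<psi> w)"

lemma Z_pos: "0 < Z n"
  unfolding Z_def using words_nonempty[OF N] by (intro sum_pos) (auto intro: pos words_imp_all_words)

lemma Z_submult: "Z (m + n) \<le> Z m * Z n"
proof -
  have "Z (m + n) \<le> (\<Sum>u\<in>words N m. \<Sum>v\<in>words N n. \<psi> u * \<psi> v)"
    unfolding Z_def sum_words_append by (intro sum_mono submult words_imp_all_words)
  thus ?thesis by (simp add: Z_def sum_product)
qed

definition connector_sum :: real where "connector_sum = (\<Sum>l\<le>K. Z l)"

lemma connector_sum_pos: "0 < connector_sum"
  unfolding connector_sum_def using Z_pos by (intro sum_pos) auto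

text \<open>The loss when one sums over all continuations of a fixed length instead of choosing a connecting
  word: of the connecting word it only remains that it is one of finitely many.\<close>

definition \<kappa> :: real where "\<kappa> = c / connector_sum"

lemma \<kappa>_pos: "0 < \<kappa>"
  using c connector_sum_pos by (simp add: \<kappa>_def)

text \<open>The connecting word depends on \<open>u\<close> and \<open>v\<close>; summing over all candidates removes this
  dependence, at no cost since all terms are positive.\<close>

lemma quasi_sum:
  assumes "u \<in> all_words N" "v \<in> all_words N"
  shows "c * \<psi> u * \<psi> v \<le> (\<Sum>l\<le>K. \<Sum>w\<in>words N l. \<psi> (u @ w @ v))"
proof -
  obtain w where w: "w \<in> all_words N" "length w \<le> K" "c * \<psi> u * \<psi> v \<le> \<psi> (u @ w @ v)"
    using quasi[OF assms] by blast
  note w(3)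
  also have "\<psi> (u @ w @ v) \<le> (\<Sum>w\<in>words N (length w). \<psi> (u @ w @ v))"
    using w(1) assms
    by (intro member_le_sum) (auto simp: words_length_iff[symmetric] dest!: words_imp_all_words intro!: less_imp_le[OF pos])
  also have "\<dots> \<le> (\<Sum>l\<le>K. \<Sum>w\<in>words N l. \<psi> (u @ w @ v))"
    using w(2) assms
    by (intro member_le_sum[of "length w" _ "\<lambda>l. \<Sum>w\<in>words N l. \<psi> (u @ w @ v)"] sum_nonneg)
      (auto dest!: words_imp_all_words intro!: less_imp_le[OF pos])
  finally show ?thesis .
qed

text \<open>After summation the connecting word may be moved to the far end of the continuation, where
  submultiplicativity splits it off. So the sum runs over continuations of length exactly \<open>r\<close>,
  although the lengths of the connecting words vary.\<close>

lemma right_extension: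
  assumes "x \<in> all_words N"
  shows "\<kappa> * \<psi> x * Z r \<le> (\<Sum>v\<in>words N r. \<psi> (x @ v))"
proof -
  have "c * \<psi> x * Z r = (\<Sum>v\<in>words N r. c * \<psi> x * \<psi> v)"
    by (simp add: Z_def sum_distrib_left)
  also have "\<dots> \<le> (\<Sum>v\<in>words N r. \<Sum>l\<le>K. \<Sum>w\<in>words N l. \<psi> (x @ w @ v))"
    using assms by (intro sum_mono quasi_sum) (auto dest: words_imp_all_words)
  also have "\<dots> = (\<Sum>l\<le>K. \<Sum>w\<in>words N l. \<Sum>v\<in>words N r. \<psi> (x @ w @ v))"
    by (simp only: sum.swap[of _ _ "words N r"])
  \<comment> \<open>Regrouping: a word of length \<open>l + r\<close> is cut after \<open>r\<close> instead of after \<open>l\<close> letters.\<close>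
  also have "\<dots> = (\<Sum>l\<le>K. \<Sum>y\<in>words N (r + l). \<psi> (x @ y))"
  proof (rule sum.cong[OF refl])
    fix l
    show "(\<Sum>w\<in>words N l. \<Sum>v\<in>words N r. \<psi> (x @ w @ v)) = (\<Sum>y\<in>words N (r + l). \<psi> (x @ y))"
      using sum_words_append[of "\<lambda>y. \<psi> (x @ y)" N l r] by (simp add: add.commute)
  qed
  also have "\<dots> = (\<Sum>l\<le>K. \<Sum>v\<in>words N r. \<Sum>w\<in>words N l. \<psi> ((x @ v) @ w))"
    by (simp add: sum_words_append)
  also have "\<dots> \<le> (\<Sum>l\<le>K. \<Sum>v\<in>words N r. \<Sum>w\<in>words N l. \<psi> (x @ v) * \<psi> w)"
    using assms words_imp_all_words by (intro sum_mono submult) auto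
  also have "\<dots> = connector_sum * (\<Sum>v\<in>words N r. \<psi> (x @ v))"
    by (simp add: connector_sum_def Z_def sum_distrib_left[symmetric] sum_distrib_right[symmetric] mult.commute)
  finally show ?thesis using connector_sum_pos by (simp add: \<kappa>_def field_simps)
qed

lemma left_extension:
  assumes "x \<in> all_words N"
  shows "\<kappa> * \<psi> x * Z r \<le> (\<Sum>u\<in>words N r. \<psi> (u @ x))"
proof -
  have "c * \<psi> x * Z r = (\<Sum>u\<in>words N r. c * \<psi> u * \<psi> x)"
    by (simp add: Z_def sum_distrib_left mult_ac)
  also have "\<dots> \<le> (\<Sum>u\<in>words N r. \<Sum>l\<le>K. \<Sum>w\<in>words N l. \<psi> (u @ w @ x))"
    using assms by (intro sum_mono quasi_sum) (auto dest: words_imp_all_words)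
  also have "\<dots> = (\<Sum>l\<le>K. \<Sum>u\<in>words N r. \<Sum>w\<in>words N l. \<psi> ((u @ w) @ x))"
    by (subst sum.swap) simp
  also have "\<dots> = (\<Sum>l\<le>K. \<Sum>y\<in>words N (l + r). \<psi> (y @ x))"
  proof (rule sum.cong[OF refl])
    fix l
    show "(\<Sum>u\<in>words N r. \<Sum>w\<in>words N l. \<psi> ((u @ w) @ x)) = (\<Sum>y\<in>words N (l + r). \<psi> (y @ x))"
      using sum_words_append[of "\<lambda>y. \<psi> (y @ x)" N r l] by (simp add: add.commute)
  qed
  also have "\<dots> = (\<Sum>l\<le>K. \<Sum>w\<in>words N l. \<Sum>u\<in>words N r. \<psi> (w @ (u @ x)))"
    by (simp add: sum_words_append)
  also have "\<dots> \<le> (\<Sum>l\<le>K. \<Sum>w\<in>words N l. \<Sum>u\<in>words N r. \<psi> w * \<psi> (u @ x))"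
    using assms words_imp_all_words by (intro sum_mono submult) auto
  also have "\<dots> = connector_sum * (\<Sum>u\<in>words N r. \<psi> (u @ x))"
    by (simp add: connector_sum_def Z_def sum_distrib_left[symmetric] sum_distrib_right[symmetric])
  finally show ?thesis using connector_sum_pos by (simp add: \<kappa>_def field_simps)
qed

lemma Z_supermult: "\<kappa> * Z m * Z n \<le> Z (m + n)"
proof -
  have "\<kappa> * Z m * Z n = (\<Sum>u\<in>words N m. \<kappa> * \<psi> u * Z n)"
    by (simp add: Z_def[of m] sum_distrib_left sum_distrib_right)
  also have "\<dots> \<le> (\<Sum>u\<in>words N m. \<Sum>v\<in>words N n. \<psi> (u @ v))"
    by (intro sum_mono right_extension words_imp_all_words)
  finally show ?thesis by (simp add: Z_def sum_words_append)
qed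

definition P :: real where "P = lim (\<lambda>n. ln (Z n) / real n)"

text \<open>Both bounds are Fekete's lemma: \<open>ln (Z n)\<close> is subadditive, and by \<open>Z_supermult\<close> so is
  \<open>- ln (Z n) - ln \<kappa>\<close>. The growth of \<open>Z\<close> is thus exactly exponential up to a constant.\<close>

lemma shows P_tendsto: "(\<lambda>n. ln (Z n) / real n) \<longlonglongrightarrow> P"
  and Z_lower: "exp (real n * P) \<le> Z n"
  and Z_upper: "Z n \<le> exp (real n * P) / \<kappa>"
proof -
  define a where "a n = ln (Z n)" for n
  define b where "b n = - a n - ln \<kappa>" for n
  have asub: "a (m + n) \<le> a m + a n" for m n
  proof -
    have "ln (Z (m + n)) \<le> ln (Z m * Z n)"
      using Z_submult[of m n] Z_pos by (subst ln_le_cancel_iff) auto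
    thus ?thesis using Z_pos[of m] Z_pos[of n] by (simp add: a_def ln_mult)
  qed
  have alow: "- (- ln \<delta>) * real n \<le> a n" for n
  proof -
    obtain w where w: "w \<in> words N n" using words_nonempty[OF N] by blast
    have "\<delta> ^ n \<le> \<psi> w" using lower[OF words_imp_all_words[OF w]] w by (simp add: words_length)
    also have "\<dots> \<le> Z n" unfolding Z_def
      using w by (intro member_le_sum) (auto intro!: less_imp_le[OF pos] words_imp_all_words)
    finally have "ln (\<delta> ^ n) \<le> a n" unfolding a_def using \<delta> Z_pos by (subst ln_le_cancel_iff) auto
    thus ?thesis using \<delta> by (simp add: ln_realpow mult.commute)
  qed
  obtain L where L: "(\<lambda>n. a n / real n) \<longlonglongrightarrow> L" "\<And>n. real n * L \<le> a n"
    using fekete[of a "- ln \<delta>", OF asub alow] by blast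
  have PL: "P = L" using limI[OF L(1)] by (simp add: P_def a_def)
  have bsub: "b (m + n) \<le> b m + b n" for m n
  proof -
    have "ln (\<kappa> * Z m * Z n) \<le> ln (Z (m + n))"
      using Z_supermult[of m n] Z_pos \<kappa>_pos by (subst ln_le_cancel_iff) auto
    thus ?thesis using Z_pos[of m] Z_pos[of n] \<kappa>_pos by (simp add: b_def a_def ln_mult)
  qed
  have a_up: "a n \<le> a 0 + real n * a 1" for n
  proof (induction n)
    case (Suc n)
    thus ?case using asub[of n 1] by (simp add: algebra_simps)
  qed simp
  have b0: "0 \<le> b 0" using bsub[of 0 0] by simp
  have a0: "0 \<le> a 0" using asub[of 0 0] by simp
  have blow: "- (\<bar>a 1\<bar> + a 0) * real n \<le> b n" for n
  proof (cases "n = 0")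
    case True
    thus ?thesis using b0 by simp
  next
    case False
    have "ln \<kappa> \<le> 0" using b0 a0 by (simp add: b_def)
    moreover have "a 0 \<le> a 0 * real n" using False a0 by (simp add: mult_le_cancel_left1)
    moreover have "real n * a 1 \<le> real n * \<bar>a 1\<bar>" by (simp add: mult_left_mono)
    ultimately show ?thesis using a_up[of n] by (simp add: b_def algebra_simps)
  qed
  obtain L' where L': "(\<lambda>n. b n / real n) \<longlonglongrightarrow> L'" "\<And>n. real n * L' \<le> b n"
    using fekete[of b "\<bar>a 1\<bar> + a 0", OF bsub blow] by blast
  have "(\<lambda>n. - (a n / real n) - ln \<kappa> / real n) \<longlonglongrightarrow> - L - 0"
    by (intro tendsto_intros L lim_const_over_n)
  hence "(\<lambda>n. b n / real n) \<longlonglongrightarrow> - L" by (simp add: b_def diff_divide_distrib)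
  hence "L' = - L" using L'(1) LIMSEQ_unique by blast
  hence up: "a n \<le> real n * P - ln \<kappa>" using L'(2)[of n] PL by (simp add: b_def)
  show "(\<lambda>n. ln (Z n) / real n) \<longlonglongrightarrow> P" using L PL by (simp add: a_def)
  have "exp (real n * P) \<le> exp (a n)" using L(2)[of n] PL by simp
  thus "exp (real n * P) \<le> Z n" using Z_pos by (simp add: a_def)
  have "exp (a n) \<le> exp (real n * P - ln \<kappa>)" using up by simp
  thus "Z n \<le> exp (real n * P) / \<kappa>" using Z_pos \<kappa>_pos by (simp add: a_def exp_diff)
qed

definition gibbs_weight :: "nat list \<Rightarrow> real" where
  "gibbs_weight w = \<psi> w * exp (- real (length w) * P)"

lemma gibbs_weight_pos: "w \<in> all_words N \<Longrightarrow> 0 < gibbs_weight w"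
  by (simp add: gibbs_weight_def pos)

text \<open>The total potential of the words of length \<open>j + |w| + r\<close> in which \<open>w\<close> stands after the first
  \<open>j\<close> letters. Divided by \<open>Z (j + |w| + r)\<close>, it is the probability of \<open>w\<close> at position \<open>j\<close>.\<close>

definition middle_sum :: "nat \<Rightarrow> nat \<Rightarrow> nat list \<Rightarrow> real" where
  "middle_sum j r w = (\<Sum>u\<in>words N j. \<Sum>v\<in>words N r. \<psi> (u @ w @ v))"

lemma middle_sum_le:
  assumes "w \<in> all_words N"
  shows "middle_sum j r w \<le> \<psi> w * Z j * Z r"
proof -
  have "middle_sum j r w \<le> (\<Sum>u\<in>words N j. \<Sum>v\<in>words N r. \<psi> u * (\<psi> w * \<psi> v))"
    unfolding middle_sum_def
  proof (intro sum_mono)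
    fix u v assume "u \<in> words N j" "v \<in> words N r"
    hence uv: "u \<in> all_words N" "v \<in> all_words N" by (auto intro: words_imp_all_words)
    have "\<psi> (u @ w @ v) \<le> \<psi> u * \<psi> (w @ v)" using uv assms by (intro submult) auto
    also have "\<dots> \<le> \<psi> u * (\<psi> w * \<psi> v)"
      using uv assms by (intro mult_left_mono submult less_imp_le[OF pos]) auto
    finally show "\<psi> (u @ w @ v) \<le> \<psi> u * (\<psi> w * \<psi> v)" .
  qed
  also have "\<dots> = \<psi> w * Z j * Z r"
    by (simp add: Z_def sum_product sum_distrib_left sum_distrib_right mult_ac)
  finally show ?thesis .
qed

lemma middle_sum_ge:
  assumes "w \<in> all_words N"
  shows "\<kappa>\<^sup>2 * \<psi> w * Z j * Z r \<le> middle_sum j r w"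
proof -
  have "\<kappa>\<^sup>2 * \<psi> w * Z j * Z r = \<kappa> * (\<kappa> * \<psi> w * Z j) * Z r" by (simp add: power2_eq_square)
  also have "\<dots> \<le> \<kappa> * (\<Sum>u\<in>words N j. \<psi> (u @ w)) * Z r"
    using left_extension[OF assms, of j] \<kappa>_pos Z_pos[of r]
    by (intro mult_right_mono mult_left_mono) auto
  also have "\<dots> = (\<Sum>u\<in>words N j. \<kappa> * \<psi> (u @ w) * Z r)"
    by (simp add: sum_distrib_left sum_distrib_right)
  also have "\<dots> \<le> (\<Sum>u\<in>words N j. \<Sum>v\<in>words N r. \<psi> ((u @ w) @ v))"
    using assms by (intro sum_mono right_extension) (auto intro: words_imp_all_words)
  finally show ?thesis by (simp add: middle_sum_def)
qed

lemma middle_sum_le_Z: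
  assumes "w \<in> all_words N"
  shows "middle_sum j r w \<le> Z (j + length w + r)"
proof -
  have "middle_sum j r w \<le> (\<Sum>u\<in>words N j. \<Sum>w\<in>words N (length w). \<Sum>v\<in>words N r. \<psi> (u @ w @ v))"
    unfolding middle_sum_def
  proof (intro sum_mono)
    fix u assume "u \<in> words N j"
    thus "(\<Sum>v\<in>words N r. \<psi> (u @ w @ v)) \<le> (\<Sum>w\<in>words N (length w). \<Sum>v\<in>words N r. \<psi> (u @ w @ v))"
      using assms
      by (intro member_le_sum[of w _ "\<lambda>w. \<Sum>v\<in>words N r. \<psi> (u @ w @ v)"])
        (auto simp: words_length_iff[symmetric] dest!: words_imp_all_words intro!: sum_nonneg less_imp_le[OF pos])
  qed
  also have "\<dots> = Z (j + length w + r)"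
    unfolding Z_def add.assoc by (simp add: sum_words_append)
  finally show ?thesis .
qed

lemma middle_sum_nonneg: "w \<in> all_words N \<Longrightarrow> 0 \<le> middle_sum j r w"
  unfolding middle_sum_def by (intro sum_nonneg less_imp_le[OF pos]) (auto intro: words_imp_all_words)

lemma middle_sum_right: "(\<Sum>a\<in>letters N. middle_sum j r (w @ [a])) = middle_sum j (Suc r) w"
proof -
  have "middle_sum j (Suc r) w = (\<Sum>u\<in>words N j. \<Sum>x\<in>words N (Suc 0). \<Sum>v\<in>words N r. \<psi> (u @ w @ x @ v))"
    unfolding middle_sum_def
  proof (rule sum.cong[OF refl])
    fix u
    show "(\<Sum>v\<in>words N (Suc r). \<psi> (u @ w @ v)) = (\<Sum>x\<in>words N (Suc 0). \<Sum>v\<in>words N r. \<psi> (u @ w @ x @ v))"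
      using sum_words_append[of "\<lambda>y. \<psi> (u @ w @ y)" N "Suc 0" r] by simp
  qed
  also have "\<dots> = (\<Sum>x\<in>words N (Suc 0). middle_sum j r (w @ x))"
    unfolding middle_sum_def by (subst sum.swap) simp
  finally show ?thesis by (simp add: sum_words_1)
qed

lemma middle_sum_left: "(\<Sum>a\<in>letters N. middle_sum j r ([a] @ w)) = middle_sum (Suc j) r w"
proof -
  have "middle_sum (j + Suc 0) r w = (\<Sum>u\<in>words N j. \<Sum>x\<in>words N (Suc 0). \<Sum>v\<in>words N r. \<psi> ((u @ x) @ w @ v))"
    unfolding middle_sum_def sum_words_append ..
  also have "\<dots> = (\<Sum>x\<in>words N (Suc 0). middle_sum j r (x @ w))"
    unfolding middle_sum_def by (subst sum.swap) simp
  finally show ?thesis by (simp add: sum_words_1)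
qed

text \<open>Words of length \<open>2 n\<close> are weighted by \<open>\<psi>\<close>, and the probability of \<open>w\<close> is averaged over its
  first \<open>n\<close> positions; for \<open>|w| \<le> n\<close> it never runs over the end. The value \<open>0\<close> otherwise keeps all
  averages between \<open>0\<close> and \<open>1\<close>.\<close>

definition average :: "nat \<Rightarrow> nat list \<Rightarrow> real" where
  "average n w = (if length w \<le> n \<and> n > 0
     then (\<Sum>j<n. middle_sum j (2 * n - j - length w) w) / Z (2 * n) / real n else 0)"

text \<open>The probability of \<open>w\<close> satisfies the Gibbs bounds at every single position, uniformly in the
  total length \<open>n\<close>. This is why they survive averaging and passage to the limit.\<close>

lemma middle_sum_quotient:
  assumes w: "w \<in> all_words N" and n: "j + r + length w = n"
  shows "0 \<le> middle_sum j r w / Z n" "middle_sum j r w / Z n \<le> 1"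
    "\<kappa> ^ 3 * gibbs_weight w \<le> middle_sum j r w / Z n"
    "middle_sum j r w / Z n \<le> gibbs_weight w / \<kappa>\<^sup>2"
proof -
  show "0 \<le> middle_sum j r w / Z n" using middle_sum_nonneg[OF w] Z_pos[of n] by simp
  show "middle_sum j r w / Z n \<le> 1"
    using middle_sum_le_Z[OF w, of j r] Z_pos[of n] n by (simp add: add_ac)
  have e: "exp (real n * P) = exp (real j * P) * exp (real r * P) * exp (real (length w) * P)"
    using n by (auto simp: exp_add[symmetric] algebra_simps)
  have ww: "gibbs_weight w * exp (real (length w) * P) = \<psi> w"
    by (simp add: gibbs_weight_def exp_minus)
  have g: "0 < gibbs_weight w" by (rule gibbs_weight_pos[OF w])
  have "\<kappa> ^ 3 * gibbs_weight w * Z n \<le> \<kappa> ^ 3 * gibbs_weight w * (exp (real n * P) / \<kappa>)"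
    using Z_upper[of n] \<kappa>_pos g by (intro mult_left_mono) auto
  also have "\<dots> = \<kappa>\<^sup>2 * (gibbs_weight w * exp (real (length w) * P)) * (exp (real j * P) * exp (real r * P))"
    unfolding e using \<kappa>_pos by (simp add: power2_eq_square power3_eq_cube)
  also have "\<dots> \<le> \<kappa>\<^sup>2 * \<psi> w * (Z j * Z r)"
    unfolding ww using Z_lower Z_pos[of j] pos[OF w] by (intro mult_left_mono mult_mono) auto
  also have "\<dots> \<le> middle_sum j r w" using middle_sum_ge[OF w, of j r] by (simp add: mult.assoc)
  finally show "\<kappa> ^ 3 * gibbs_weight w \<le> middle_sum j r w / Z n"
    using Z_pos[of n] by (simp add: field_simps)
  have "middle_sum j r w \<le> \<psi> w * (Z j * Z r)" using middle_sum_le[OF w, of j r] by (simp add: mult.assoc)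
  also have "\<dots> \<le> \<psi> w * ((exp (real j * P) / \<kappa>) * (exp (real r * P) / \<kappa>))"
    using Z_upper Z_pos \<kappa>_pos pos[OF w] by (intro mult_left_mono mult_mono) (auto intro: less_imp_le)
  also have "\<dots> = gibbs_weight w / \<kappa>\<^sup>2 * exp (real n * P)"
    unfolding e ww[symmetric] by (simp add: power2_eq_square)
  also have "\<dots> \<le> gibbs_weight w / \<kappa>\<^sup>2 * Z n"
    using Z_lower[of n] g by (intro mult_left_mono) auto
  finally show "middle_sum j r w / Z n \<le> gibbs_weight w / \<kappa>\<^sup>2"
    using Z_pos[of n] by (simp add: field_simps)
qed

lemma average_bounds:
  assumes w: "w \<in> all_words N" and n: "length w \<le> n" "0 < n"
  shows "0 \<le> average n w" "average n w \<le> 1"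
    "\<kappa> ^ 3 * gibbs_weight w \<le> average n w" "average n w \<le> gibbs_weight w / \<kappa>\<^sup>2"
proof -
  have eq: "average n w = (\<Sum>j<n. middle_sum j (2 * n - j - length w) w / Z (2 * n)) / real n"
    using n by (simp add: average_def sum_divide_distrib)
  have mean: "L \<le> (\<Sum>j<n. f j) / real n" "(\<Sum>j<n. f j) / real n \<le> U"
    if "\<And>j. j < n \<Longrightarrow> L \<le> f j" "\<And>j. j < n \<Longrightarrow> f j \<le> U" for L U and f :: "nat \<Rightarrow> real"
    using sum_bounded_below[of "{..<n}" L f] sum_bounded_above[of "{..<n}" f U] that n
    by (auto simp: field_simps)
  have q: "j + (2 * n - j - length w) + length w = 2 * n" if "j < n" for j using that n by simp
  show "0 \<le> average n w" "average n w \<le> 1"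
    unfolding eq using middle_sum_quotient(1,2)[OF w q] by (auto intro!: mean)
  show "\<kappa> ^ 3 * gibbs_weight w \<le> average n w" "average n w \<le> gibbs_weight w / \<kappa>\<^sup>2"
    unfolding eq using middle_sum_quotient(3,4)[OF w q] by (auto intro!: mean)
qed

lemma average_right:
  assumes "length w < n"
  shows "(\<Sum>a\<in>letters N. average n (w @ [a])) = average n w"
proof -
  have "(\<Sum>a\<in>letters N. average n (w @ [a])) =
    (\<Sum>a\<in>letters N. \<Sum>j<n. middle_sum j (2 * n - j - Suc (length w)) (w @ [a])) / Z (2 * n) / real n"
    using assms by (simp add: average_def sum_divide_distrib)
  also have "(\<Sum>a\<in>letters N. \<Sum>j<n. middle_sum j (2 * n - j - Suc (length w)) (w @ [a]))
     = (\<Sum>j<n. middle_sum j (Suc (2 * n - j - Suc (length w))) w)"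
    by (subst sum.swap) (simp add: middle_sum_right)
  also have "\<dots> = (\<Sum>j<n. middle_sum j (2 * n - j - length w) w)"
    using assms by (intro sum.cong refl arg_cong2[where f = "\<lambda>r. middle_sum _ r"]) auto
  finally show ?thesis using assms by (simp add: average_def)
qed

text \<open>Prepending a letter moves the window of positions by one, so that only the two boundary terms
  remain. In the limit the averaged weights become shift invariant.\<close>

lemma average_left:
  assumes "w \<in> all_words N" "length w < n"
  shows "\<bar>(\<Sum>a\<in>letters N. average n ([a] @ w)) - average n w\<bar> \<le> 1 / real n"
proof -
  define t where "t j = middle_sum j (2 * n - j - length w) w / Z (2 * n)" for j
  have t: "0 \<le> t j" "t j \<le> 1" if "j \<le> n" for j
    unfolding t_def using assms that by (auto intro!: middle_sum_quotient)
  have "(\<Sum>a\<in>letters N. average n ([a] @ w)) =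
    (\<Sum>a\<in>letters N. \<Sum>j<n. middle_sum j (2 * n - j - Suc (length w)) ([a] @ w)) / Z (2 * n) / real n"
    using assms by (simp add: average_def sum_divide_distrib)
  also have "(\<Sum>a\<in>letters N. \<Sum>j<n. middle_sum j (2 * n - j - Suc (length w)) ([a] @ w))
     = (\<Sum>j<n. middle_sum (Suc j) (2 * n - Suc j - length w) w)"
    by (subst sum.swap) (simp only: middle_sum_left diff_diff_left add_Suc_right add_Suc)
  also have "\<dots> / Z (2 * n) = (\<Sum>j<n. t (Suc j))"
    by (simp add: t_def sum_divide_distrib)
  finally have 1: "(\<Sum>a\<in>letters N. average n ([a] @ w)) = (\<Sum>j<n. t (Suc j)) / real n" .
  have 2: "average n w = (\<Sum>j<n. t j) / real n"
    using assms by (simp add: average_def t_def sum_divide_distrib)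
  have "(\<Sum>j<n. t (Suc j)) - (\<Sum>j<n. t j) = t n - t 0"
    using sum_lessThan_telescope[of t n] by (simp add: sum_subtractf)
  hence "(\<Sum>a\<in>letters N. average n ([a] @ w)) - average n w = (t n - t 0) / real n"
    unfolding 1 2 by (simp add: diff_divide_distrib[symmetric])
  moreover have "\<bar>t n - t 0\<bar> \<le> 1" using t[of n] t[of 0] by (auto simp: abs_le_iff)
  ultimately show ?thesis by (simp add: abs_divide divide_right_mono)
qed

lemma average_Nil: "0 < n \<Longrightarrow> average n [] = 1"
proof -
  assume n: "0 < n"
  have "middle_sum j (2 * n - j) [] = Z (2 * n)" if "j < n" for j
    using sum_words_append[of \<psi> N j "2 * n - j"] that by (simp add: middle_sum_def Z_def)
  thus ?thesis using n Z_pos[of "2 * n"] by (simp add: average_def)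
qed

text \<open>The exponents of \<open>\<kappa>\<close> are those of \<open>middle_sum_quotient\<close>: two extensions and the bound on
  \<open>Z n\<close> from above for the lower estimate, two bounds on \<open>Z\<close> from above for the upper one.\<close>

definition is_gibbs :: "(nat \<Rightarrow> nat) measure \<Rightarrow> bool" where
  "is_gibbs \<mu> \<longleftrightarrow> \<mu> \<in> invariant_measures N \<and>
     (\<forall>w\<in>all_words N. \<kappa> ^ 3 * gibbs_weight w \<le> measure \<mu> (cylinder N w) \<and>
        measure \<mu> (cylinder N w) \<le> gibbs_weight w / \<kappa>\<^sup>2)"

lemma is_gibbs_positive:
  assumes "is_gibbs \<mu>" "w \<in> all_words N"
  shows "0 < measure \<mu> (cylinder N w)"
proof -
  have "0 < \<kappa> ^ 3 * gibbs_weight w" using \<kappa>_pos gibbs_weight_pos[OF assms(2)] by simp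
  also have "\<dots> \<le> measure \<mu> (cylinder N w)" using assms by (auto simp: is_gibbs_def)
  finally show ?thesis .
qed

text \<open>A subsequence of the averages converges at every word, and the limit inherits
  consistency, invariance and the Gibbs bounds.\<close>

lemma exists_gibbs: obtains \<mu> where "is_gibbs \<mu>"
proof -
  define f where "f n w = (if w \<in> all_words N then average n w else 0)" for n w
  have "f n w \<in> {0..1}" for n w
    using average_bounds(1,2)[of w n] by (cases "length w \<le> n \<and> 0 < n") (auto simp: f_def average_def)
  then obtain k where k: "strict_mono (k :: nat \<Rightarrow> nat)" "\<And>w. \<exists>l. (\<lambda>n. f (k n) w) \<longlonglongrightarrow> l"
    using bounded_pointwise_convergent_subsequence[of f 0 1] by metis
  have "\<exists>l. (\<lambda>n. average (k n) w) \<longlonglongrightarrow> l" if "w \<in> all_words N" for w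
    using k(2)[of w] that by (simp add: f_def)
  then obtain m where m: "\<And>w. w \<in> all_words N \<Longrightarrow> (\<lambda>n. average (k n) w) \<longlonglongrightarrow> m w" by metis
  have large: "\<forall>\<^sub>F n in sequentially. l < k n" for l
    using seq_suble[OF k(1)] by (intro eventually_sequentiallyI[of "Suc l"]) (meson Suc_le_lessD order_trans)
  have m_bounds: "\<kappa> ^ 3 * gibbs_weight w \<le> m w" "m w \<le> gibbs_weight w / \<kappa>\<^sup>2" if w: "w \<in> all_words N" for w
  proof -
    have ev: "\<forall>\<^sub>F n in sequentially. \<kappa> ^ 3 * gibbs_weight w \<le> average (k n) w"
      "\<forall>\<^sub>F n in sequentially. average (k n) w \<le> gibbs_weight w / \<kappa>\<^sup>2"
      using large[of "length w"] average_bounds(3,4)[OF w] by (auto elim!: eventually_mono)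
    show "\<kappa> ^ 3 * gibbs_weight w \<le> m w" by (rule tendsto_lowerbound[OF m[OF w] ev(1)]) simp
    show "m w \<le> gibbs_weight w / \<kappa>\<^sup>2" by (rule tendsto_upperbound[OF m[OF w] ev(2)]) simp
  qed
  interpret cylinder_weights N m
  proof
    fix w assume w: "w \<in> all_words N"
    have "0 < \<kappa> ^ 3 * gibbs_weight w" using \<kappa>_pos gibbs_weight_pos[OF w] by simp
    thus "0 < m w" using m_bounds(1)[OF w] by linarith
    have "(\<lambda>n. \<Sum>a\<in>letters N. average (k n) (w @ [a])) \<longlonglongrightarrow> (\<Sum>a\<in>letters N. m (w @ [a]))"
      using w by (intro tendsto_sum m) auto
    moreover have "\<forall>\<^sub>F n in sequentially. (\<Sum>a\<in>letters N. average (k n) (w @ [a])) = average (k n) w"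
      using large[of "length w"] by eventually_elim (rule average_right)
    ultimately have "(\<lambda>n. average (k n) w) \<longlonglongrightarrow> (\<Sum>a\<in>letters N. m (w @ [a]))"
      by (rule Lim_transform_eventually)
    thus "(\<Sum>a\<in>letters N. m (w @ [a])) = m w" using m[OF w] LIMSEQ_unique by blast
    have "(\<lambda>n. \<Sum>a\<in>letters N. average (k n) ([a] @ w)) \<longlonglongrightarrow> (\<Sum>a\<in>letters N. m ([a] @ w))"
      using w by (intro tendsto_sum m) auto
    hence lim1: "(\<lambda>n. (\<Sum>a\<in>letters N. average (k n) ([a] @ w)) - average (k n) w)
      \<longlonglongrightarrow> (\<Sum>a\<in>letters N. m ([a] @ w)) - m w"
      using m[OF w] by (rule tendsto_diff)
    have "(\<lambda>n. 1 / real (k n)) \<longlonglongrightarrow> 0"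
      using LIMSEQ_subseq_LIMSEQ[OF lim_const_over_n[of 1] k(1)] by (simp add: o_def)
    moreover have "\<forall>\<^sub>F n in sequentially. norm ((\<Sum>a\<in>letters N. average (k n) ([a] @ w)) - average (k n) w) \<le> 1 / real (k n)"
      using large[of "length w"] average_left[OF w] by (auto elim!: eventually_mono)
    ultimately have "(\<lambda>n. (\<Sum>a\<in>letters N. average (k n) ([a] @ w)) - average (k n) w) \<longlonglongrightarrow> 0"
      by (rule Lim_null_comparison[rotated])
    thus "(\<Sum>a\<in>letters N. m ([a] @ w)) = m w" using lim1 LIMSEQ_unique by fastforce
  next
    have "\<forall>\<^sub>F n in sequentially. average (k n) [] = 1"
      using large[of 0] by eventually_elim (rule average_Nil)
    hence "(\<lambda>n. average (k n) []) \<longlonglongrightarrow> 1" by (rule tendsto_eventually)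
    thus "m [] = 1" using m[of "[]"] LIMSEQ_unique by auto
  qed
  obtain \<mu> where "\<mu> \<in> invariant_measures N" "\<And>w. w \<in> all_words N \<Longrightarrow> measure \<mu> (cylinder N w) = m w"
    using exists_invariant_measure by blast
  hence "is_gibbs \<mu>" using m_bounds unfolding is_gibbs_def by auto
  thus ?thesis by (rule that)
qed

text \<open>Quasi-multiplicativity seen through the Gibbs bounds. The exponent \<open>7 = 3 + 2 + 2\<close> combines one
  lower bound for \<open>u w v\<close> and two upper bounds for \<open>u\<close> and \<open>v\<close>; the exponential pays for the
  length of the connecting word.\<close>

lemma gibbs_mixing:
  assumes g: "is_gibbs \<mu>" and u: "u \<in> all_words N" and v: "v \<in> all_words N"
  shows "\<exists>w\<in>all_words N. length w \<le> K \<and>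
    c * \<kappa> ^ 7 * exp (- real K * \<bar>P\<bar>) * measure \<mu> (cylinder N u) * measure \<mu> (cylinder N v)
      \<le> measure \<mu> (cylinder N (u @ w @ v))"
proof -
  let ?m = "\<lambda>w. measure \<mu> (cylinder N w)"
  obtain w where w: "w \<in> all_words N" "length w \<le> K" "c * \<psi> u * \<psi> v \<le> \<psi> (u @ w @ v)"
    using quasi[OF u v] by blast
  have gw: "\<kappa>\<^sup>2 * ?m x \<le> gibbs_weight x" if "x \<in> all_words N" for x
    using g that \<kappa>_pos by (auto simp: is_gibbs_def field_simps)
  have "real (length w) * P \<le> real (length w) * \<bar>P\<bar>" by (simp add: mult_left_mono)
  also have "\<dots> \<le> real K * \<bar>P\<bar>" using w(2) by (simp add: mult_right_mono)
  finally have e: "exp (- real K * \<bar>P\<bar>) \<le> exp (- real (length w) * P)" by simp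
  have "c * \<kappa> ^ 7 * exp (- real K * \<bar>P\<bar>) * ?m u * ?m v
      = \<kappa> ^ 3 * (c * ((\<kappa>\<^sup>2 * ?m u) * (\<kappa>\<^sup>2 * ?m v)) * exp (- real K * \<bar>P\<bar>))"
    by (simp add: eval_nat_numeral)
  also have "\<dots> \<le> \<kappa> ^ 3 * (c * (gibbs_weight u * gibbs_weight v) * exp (- real (length w) * P))"
    using gw[OF u] gw[OF v] e c \<kappa>_pos gibbs_weight_pos[OF u] gibbs_weight_pos[OF v]
    by (intro mult_left_mono mult_mono) (auto intro!: mult_nonneg_nonneg)
  also have "c * (gibbs_weight u * gibbs_weight v) * exp (- real (length w) * P) =
      (c * \<psi> u * \<psi> v) * exp (- real (length (u @ w @ v)) * P)"
    by (simp add: gibbs_weight_def exp_add[symmetric] algebra_simps)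
  also have "\<kappa> ^ 3 * ((c * \<psi> u * \<psi> v) * exp (- real (length (u @ w @ v)) * P))
     \<le> \<kappa> ^ 3 * gibbs_weight (u @ w @ v)"
    unfolding gibbs_weight_def using w(3) \<kappa>_pos by (intro mult_left_mono mult_right_mono) auto
  also have "\<dots> \<le> ?m (u @ w @ v)"
    using g u v w(1) by (auto simp: is_gibbs_def)
  finally show ?thesis using w by blast
qed

text \<open>Every pair of cylinders of length \<open>n\<close> is connected at one of the times \<open>n, \<dots>, n + K\<close>, with
  a loss that does not depend on \<open>n\<close>, hence not on how finely a set is approximated.\<close>

lemma gibbs_mixing_sets:
  assumes g: "is_gibbs \<mu>" and U: "U \<subseteq> words N n" and V: "V \<subseteq> words N n"
  defines "CU \<equiv> \<Union>w\<in>U. cylinder N w" and "CV \<equiv> \<Union>w\<in>V. cylinder N w"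
  shows "c * \<kappa> ^ 7 * exp (- real K * \<bar>P\<bar>) * measure \<mu> CU * measure \<mu> CV
    \<le> (\<Sum>l\<le>K. measure \<mu> (CU \<inter> ((shift ^^ (n + l)) -` CV \<inter> space \<mu>)))"
proof -
  interpret M: invariant_measure N \<mu> using g by unfold_locales (simp add: is_gibbs_def)
  define \<eta> where "\<eta> = c * \<kappa> ^ 7 * exp (- real K * \<bar>P\<bar>)"
  have "\<eta> * measure \<mu> CU * measure \<mu> CV = (\<Sum>u\<in>U. \<Sum>v\<in>V. \<eta> * M.wt u * M.wt v)"
    unfolding CU_def CV_def M.measure_UN_cylinders[OF U] M.measure_UN_cylinders[OF V]
    by (simp add: mult.assoc sum_product) (simp add: sum_distrib_left)
  also have "\<dots> \<le> (\<Sum>u\<in>U. \<Sum>v\<in>V. \<Sum>l\<le>K. \<Sum>w\<in>words N l. M.wt (u @ w @ v))"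
  proof (intro sum_mono)
    fix u v assume "u \<in> U" "v \<in> V"
    hence uv: "u \<in> all_words N" "v \<in> all_words N" using U V by (auto dest!: subsetD words_imp_all_words)
    obtain w where w: "w \<in> all_words N" "length w \<le> K" "\<eta> * M.wt u * M.wt v \<le> M.wt (u @ w @ v)"
      using gibbs_mixing[OF g uv] unfolding \<eta>_def by blast
    note w(3)
    also have "M.wt (u @ w @ v) \<le> (\<Sum>w\<in>words N (length w). M.wt (u @ w @ v))"
      using w(1) by (intro member_le_sum) (auto simp: words_length_iff[symmetric])
    also have "\<dots> \<le> (\<Sum>l\<le>K. \<Sum>w\<in>words N l. M.wt (u @ w @ v))"
      using w(2) by (intro member_le_sum[of "length w" _ "\<lambda>l. \<Sum>w\<in>words N l. M.wt (u @ w @ v)"] sum_nonneg) auto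
    finally show "\<eta> * M.wt u * M.wt v \<le> (\<Sum>l\<le>K. \<Sum>w\<in>words N l. M.wt (u @ w @ v))" .
  qed
  also have "\<dots> = (\<Sum>l\<le>K. \<Sum>u\<in>U. \<Sum>v\<in>V. \<Sum>w\<in>words N l. M.wt (u @ w @ v))"
    by (simp only: sum.swap[of _ _ "{..K}"])
  also have "\<dots> \<le> (\<Sum>l\<le>K. measure \<mu> (CU \<inter> ((shift ^^ (n + l)) -` CV \<inter> space \<mu>)))"
  proof (intro sum_mono)
    fix l
    define T where "T = U \<times> V \<times> words N l"
    define f where "f = (\<lambda>(u, v, w). u @ w @ v :: nat list)"
    have inj: "inj_on f T"
    proof (rule inj_onI)
      fix x y assume x: "x \<in> T" and y: "y \<in> T" and xy: "f x = f y"
      obtain u v w u' v' w' where e: "x = (u, v, w)" "y = (u', v', w')" by (metis prod_cases3)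
      have "length u = n" "length u' = n" "length w = l" "length w' = l"
        using x y U words_length unfolding e T_def by auto
      thus "x = y" using xy unfolding e f_def by auto
    qed
    have fT: "f ` T \<subseteq> words N (n + (l + n))"
      using U V unfolding T_def f_def by (auto intro!: words_append)
    have "(\<Sum>u\<in>U. \<Sum>v\<in>V. \<Sum>w\<in>words N l. M.wt (u @ w @ v)) = (\<Sum>x\<in>T. M.wt (f x))"
      by (simp add: T_def f_def sum.cartesian_product split_def)
    also have "\<dots> = (\<Sum>y\<in>f ` T. M.wt y)" by (simp add: sum.reindex[OF inj])
    also have "\<dots> = measure \<mu> (\<Union>y\<in>f ` T. cylinder N y)" by (rule M.measure_UN_cylinders[OF fT, symmetric])
    also have "\<dots> \<le> measure \<mu> (CU \<inter> ((shift ^^ (n + l)) -` CV \<inter> space \<mu>))"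
    proof (rule M.finite_measure_mono)
      have "cylinder N (u @ w @ v) \<subseteq> cylinder N u \<inter> ((shift ^^ (n + l)) -` cylinder N v \<inter> space \<mu>)"
        if "u \<in> U" "w \<in> words N l" for u v w
      proof -
        have "length u = n" "length w = l" using that U by (auto simp: words_length)
        thus ?thesis unfolding cylinder_append M.space_eq
          by (auto simp: funpow_add add.commute)
      qed
      thus "(\<Union>y\<in>f ` T. cylinder N y) \<subseteq> CU \<inter> ((shift ^^ (n + l)) -` CV \<inter> space \<mu>)"
        unfolding T_def f_def CU_def CV_def by fast
      have "CU \<in> sets \<mu>" "CV \<in> sets \<mu>"
        unfolding CU_def CV_def by (rule M.UN_cylinders_sets[OF U], rule M.UN_cylinders_sets[OF V])
      thus "CU \<inter> ((shift ^^ (n + l)) -` CV \<inter> space \<mu>) \<in> sets \<mu>"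
        by (intro sets.Int measurable_sets[OF M.measurable_shift_funpow])
    qed
    finally show "(\<Sum>u\<in>U. \<Sum>v\<in>V. \<Sum>w\<in>words N l. M.wt (u @ w @ v))
      \<le> measure \<mu> (CU \<inter> ((shift ^^ (n + l)) -` CV \<inter> space \<mu>))" .
  qed
  finally show ?thesis unfolding \<eta>_def .
qed

text \<open>An almost invariant set \<open>E\<close> and its complement are approximated by unions of cylinders of the
  same length \<open>n\<close>. Points of \<open>E\<close> stay in \<open>E\<close>, so the approximations hardly meet after any time,
  whereas \<open>gibbs_mixing_sets\<close> forces them to meet in proportion to the product of their measures.\<close>

lemma gibbs_ergodic:
  assumes g: "is_gibbs \<mu>" and E: "E \<in> sets \<mu>" and inv: "measure \<mu> (E - shift -` E) = 0"
  shows "measure \<mu> E = 0 \<or> measure \<mu> E = 1"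
proof -
  have \<mu>: "\<mu> \<in> invariant_measures N" using g by (simp add: is_gibbs_def)
  interpret M: invariant_measure N \<mu> using \<mu> by unfold_locales
  define \<eta> where "\<eta> = c * \<kappa> ^ 7 * exp (- real K * \<bar>P\<bar>)"
  have \<eta>: "0 < \<eta>" using c \<kappa>_pos by (simp add: \<eta>_def)
  have Esp: "E \<subseteq> space \<mu>" by (rule sets.sets_into_space[OF E])
  let ?S = "\<lambda>m A. (shift ^^ m) -` A \<inter> space \<mu>"
  have ms: "?S m A \<in> sets \<mu>" if "A \<in> sets \<mu>" for m A
    by (rule measurable_sets[OF M.measurable_shift_funpow that])
  have inv_m: "measure \<mu> (E - ?S m E) = 0" for m
  proof (induction m)
    case 0
    have "E - ?S 0 E = {}" using Esp by auto
    thus ?case by (simp only: measure_empty)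
  next
    case (Suc m)
    have "measure \<mu> (E - ?S (Suc m) E) \<le> measure \<mu> ((E - ?S 1 E) \<union> ?S 1 (E - ?S m E))"
    proof (rule M.finite_measure_mono)
      show "E - ?S (Suc m) E \<subseteq> (E - ?S 1 E) \<union> ?S 1 (E - ?S m E)"
        using Esp by (auto simp: funpow_swap1 M.space_eq shift_in_space)
      show "(E - ?S 1 E) \<union> ?S 1 (E - ?S m E) \<in> sets \<mu>"
        using E by (intro sets.Un sets.Diff ms)
    qed
    also have "\<dots> \<le> measure \<mu> (E - ?S 1 E) + measure \<mu> (?S 1 (E - ?S m E))"
      using E by (intro measure_Un_le sets.Diff ms)
    also have "measure \<mu> (?S 1 (E - ?S m E)) = measure \<mu> (E - ?S m E)"
      using E by (intro M.measure_shift_funpow sets.Diff ms)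
    also have "E - ?S 1 E = E - shift -` E" using Esp by auto
    finally show ?case using Suc inv measure_nonneg[of \<mu> "E - ?S (Suc m) E"] by linarith
  qed
  define p where "p = measure \<mu> E"
  have p: "0 \<le> p" "p \<le> 1" by (auto simp: p_def)
  \<comment> \<open>Here \<open>e\<close> is the error of the approximation; letting it tend to zero gives \<open>p (1 - p) = 0\<close>.\<close>
  have key: "\<eta> * (p * (1 - p)) \<le> e * (2 * \<eta> + 2 * real (Suc K))" if e: "0 < e" for e
  proof -
    obtain n U where U: "U \<subseteq> words N n"
      "measure \<mu> (E - (\<Union>w\<in>U. cylinder N w)) + measure \<mu> ((\<Union>w\<in>U. cylinder N w) - E) < e"
      using approximation_by_cylinders[OF \<mu> \<mu> E e] by blast
    define CU where "CU = (\<Union>w\<in>U. cylinder N w)"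
    define V where "V = words N n - U"
    define CV where "CV = (\<Union>w\<in>V. cylinder N w)"
    have V: "V \<subseteq> words N n" by (auto simp: V_def)
    have sU: "CU \<in> sets \<mu>" unfolding CU_def by (rule M.UN_cylinders_sets[OF U(1)])
    have CVeq: "CV = space \<mu> - CU"
      unfolding CU_def CV_def V_def M.space_eq by (rule cylinder_union_complement[OF U(1)])
    have a: "measure \<mu> (E - CU) \<le> e" "measure \<mu> (CU - E) \<le> e"
      using U(2) measure_nonneg[of \<mu> "E - CU"] measure_nonneg[of \<mu> "CU - E"] unfolding CU_def by linarith+
    have mV: "measure \<mu> CV = 1 - measure \<mu> CU" unfolding CVeq by (rule M.prob_compl[OF sU])
    have "\<bar>measure \<mu> CU - p\<bar> \<le> e"
    proof -
      have "measure \<mu> CU \<le> measure \<mu> (E \<union> (CU - E))"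
        using E sU by (intro M.finite_measure_mono) auto
      also have "\<dots> \<le> p + measure \<mu> (CU - E)" unfolding p_def using E sU by (intro measure_Un_le) auto
      finally have 1: "measure \<mu> CU \<le> p + e" using a by simp
      have "p \<le> measure \<mu> (CU \<union> (E - CU))"
        unfolding p_def using E sU by (intro M.finite_measure_mono) auto
      also have "\<dots> \<le> measure \<mu> CU + measure \<mu> (E - CU)" using E sU by (intro measure_Un_le) auto
      finally show ?thesis using 1 a by simp
    qed
    hence lowprod: "p * (1 - p) - 2 * e \<le> measure \<mu> CU * measure \<mu> CV"
    proof -
      define q where "q = measure \<mu> CU"
      have q: "0 \<le> q" "q \<le> 1" by (auto simp: q_def)
      have "\<bar>p - q\<bar> \<le> e" using \<open>\<bar>measure \<mu> CU - p\<bar> \<le> e\<close> by (simp add: q_def abs_minus_commute)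
      have "p * (1 - p) - q * (1 - q) = (p - q) * (1 - p - q)" by (simp add: algebra_simps)
      also have "\<dots> \<le> \<bar>p - q\<bar> * \<bar>1 - p - q\<bar>" by (metis abs_ge_self abs_mult)
      also have "\<dots> \<le> e * 1" using p q \<open>\<bar>p - q\<bar> \<le> e\<close> by (intro mult_mono) auto
      finally show ?thesis using e unfolding mV q_def by simp
    qed
    have up: "measure \<mu> (CU \<inter> ?S m CV) \<le> 2 * e" for m
    proof -
      have "measure \<mu> (CU \<inter> ?S m CV) \<le> measure \<mu> (((CU - E) \<union> ?S m (E - CU)) \<union> (E - ?S m E))"
      proof (rule M.finite_measure_mono)
        show "CU \<inter> ?S m CV \<subseteq> ((CU - E) \<union> ?S m (E - CU)) \<union> (E - ?S m E)"
          unfolding CVeq by auto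
        show "((CU - E) \<union> ?S m (E - CU)) \<union> (E - ?S m E) \<in> sets \<mu>"
          using E sU by (intro sets.Un sets.Diff ms)
      qed
      also have "\<dots> \<le> measure \<mu> ((CU - E) \<union> ?S m (E - CU)) + measure \<mu> (E - ?S m E)"
        using E sU by (intro measure_Un_le sets.Un sets.Diff ms)
      also have "measure \<mu> ((CU - E) \<union> ?S m (E - CU)) \<le> measure \<mu> (CU - E) + measure \<mu> (?S m (E - CU))"
        using E sU by (intro measure_Un_le sets.Un sets.Diff ms)
      also have "measure \<mu> (?S m (E - CU)) = measure \<mu> (E - CU)"
        using E sU by (intro M.measure_shift_funpow sets.Diff)
      finally show ?thesis using a inv_m[of m] by simp
    qed
    have "\<eta> * (p * (1 - p) - 2 * e) \<le> \<eta> * (measure \<mu> CU * measure \<mu> CV)"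
      using \<eta> lowprod by (intro mult_left_mono) auto
    also have "\<dots> \<le> (\<Sum>l\<le>K. measure \<mu> (CU \<inter> ?S (n + l) CV))"
      using gibbs_mixing_sets[OF g U(1) V] unfolding CU_def CV_def \<eta>_def by (simp add: mult.assoc)
    also have "\<dots> \<le> (\<Sum>l\<le>K. 2 * e)" by (intro sum_mono up)
    finally show ?thesis by (simp add: algebra_simps)
  qed
  have "\<eta> * (p * (1 - p)) \<le> 0"
  proof (rule ccontr)
    assume n: "\<not> \<eta> * (p * (1 - p)) \<le> 0"
    define D where "D = 2 * \<eta> + 2 * real (Suc K)"
    have D: "0 < D" using \<eta> by (simp add: D_def)
    have "\<eta> * (p * (1 - p)) \<le> (\<eta> * (p * (1 - p)) / (2 * D)) * D"
      using key[of "\<eta> * (p * (1 - p)) / (2 * D)"] n D unfolding D_def[symmetric] by simp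
    also have "\<dots> = \<eta> * (p * (1 - p)) / 2" using D by simp
    finally show False using n by simp
  qed
  hence "p * (1 - p) \<le> 0" using \<eta> by (simp add: mult_le_0_iff)
  hence "p = 0 \<or> p = 1" using p by (auto simp: mult_le_0_iff)
  thus ?thesis by (simp add: p_def)
qed

text \<open>The growth condition and the Gibbs lower bound give
  \<open>\<Sum> \<nu>[w] ln (\<mu>[w] / \<nu>[w]) \<ge> ln (\<kappa>\<^sup>3)\<close>. A set of small \<open>\<mu>\<close>-measure and substantial
  \<open>\<nu>\<close>-measure would make this sum very negative, which the stated inequality quantifies.\<close>

lemma gibbs_relative_entropy_bound:
  assumes g: "is_gibbs \<mu>" and \<nu>: "invariant_measure N \<nu>"
    and growth: "real n * P \<le> invariant_measure.block_entropy N \<nu> n + (\<Sum>w\<in>words N n. measure \<nu> (cylinder N w) * ln (\<psi> w))"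
    and U: "U \<subseteq> words N n" and t: "0 < t" "measure \<mu> (\<Union>w\<in>U. cylinder N w) \<le> t"
  shows "measure \<nu> (\<Union>w\<in>U. cylinder N w) * (- ln t) \<le> 2 - ln (\<kappa> ^ 3)"
proof -
  interpret M: invariant_measure N \<mu> using g by unfold_locales (simp add: is_gibbs_def)
  interpret V: invariant_measure N \<nu> by fact
  note mpos = is_gibbs_positive[OF g]
  have "ln (\<kappa> ^ 3) \<le> (\<Sum>w\<in>words N n. V.wt w * (ln (\<kappa> ^ 3) + ln (\<psi> w) - real n * P)) + V.block_entropy n"
  proof -
    have "(\<Sum>w\<in>words N n. V.wt w * (ln (\<kappa> ^ 3) + ln (\<psi> w) - real n * P))
      = (ln (\<kappa> ^ 3) - real n * P) * (\<Sum>w\<in>words N n. V.wt w) + (\<Sum>w\<in>words N n. V.wt w * ln (\<psi> w))"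
      unfolding sum_distrib_left sum.distrib[symmetric] by (intro sum.cong refl) (simp add: algebra_simps)
    thus ?thesis using growth by (simp add: V.sum_wt)
  qed
  also have "\<dots> \<le> (\<Sum>w\<in>words N n. V.wt w * ln (M.wt w)) + V.block_entropy n"
  proof (intro add_right_mono sum_mono mult_left_mono)
    fix w assume w: "w \<in> words N n"
    have wl: "w \<in> all_words N" by (rule words_imp_all_words[OF w])
    have "ln (\<kappa> ^ 3) + ln (\<psi> w) - real n * P = ln (\<kappa> ^ 3 * gibbs_weight w)"
      using \<kappa>_pos pos[OF wl] w by (simp add: gibbs_weight_def ln_mult words_length)
    also have "\<dots> \<le> ln (M.wt w)"
      using g wl \<kappa>_pos gibbs_weight_pos[OF wl] mpos[OF wl]
      by (subst ln_le_cancel_iff) (auto simp: is_gibbs_def)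
    finally show "ln (\<kappa> ^ 3) + ln (\<psi> w) - real n * P \<le> ln (M.wt w)" .
  qed auto
  also have "\<dots> = (\<Sum>w\<in>words N n. V.wt w * (ln (M.wt w) - ln (V.wt w)))"
    by (simp add: V.block_entropy_def sum.distrib[symmetric] sum_subtractf sum_negf algebra_simps)
  also have "\<dots> = (\<Sum>w\<in>U. V.wt w * (ln (M.wt w) - ln (V.wt w)))
      + (\<Sum>w\<in>words N n - U. V.wt w * (ln (M.wt w) - ln (V.wt w)))"
    using sum.subset_diff[OF U finite_words, of "\<lambda>w. V.wt w * (ln (M.wt w) - ln (V.wt w))"] by simp
  also have "\<dots> \<le> (\<Sum>w\<in>U. M.wt w / t + V.wt w * ln t) + (\<Sum>w\<in>words N n - U. M.wt w / 1 + V.wt w * ln 1)"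
  proof -
    \<comment> \<open>This is \<open>ln x \<le> x - 1\<close> at \<open>x = \<mu>[w] / (s \<nu>[w])\<close>; it is used with \<open>s = t\<close> inside \<open>U\<close> and
      with \<open>s = 1\<close> outside.\<close>
    have *: "V.wt w * (ln (M.wt w) - ln (V.wt w)) \<le> M.wt w / s + V.wt w * ln s"
      if s: "0 < s" and w: "w \<in> words N n" for s w
    proof (cases "V.wt w = 0")
      case True
      thus ?thesis using s by simp
    next
      case False
      hence v: "0 < V.wt w" by (simp add: zero_less_measure_iff)
      have m: "0 < M.wt w" by (rule mpos[OF words_imp_all_words[OF w]])
      have "ln (M.wt w / (s * V.wt w)) \<le> M.wt w / (s * V.wt w) - 1"
        using v m s by (intro ln_le_minus_one) auto
      also have "ln (M.wt w / (s * V.wt w)) = ln (M.wt w) - ln s - ln (V.wt w)"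
        using v m s by (simp add: ln_div ln_mult)
      finally have "V.wt w * (ln (M.wt w) - ln s - ln (V.wt w)) \<le> V.wt w * (M.wt w / (s * V.wt w))"
        using v by (intro mult_left_mono) auto
      also have "\<dots> = M.wt w / s" using v s by simp
      finally show ?thesis by (simp add: algebra_simps)
    qed
    show ?thesis using U t(1) by (intro add_mono sum_mono *) auto
  qed
  also have "\<dots> = measure \<mu> (\<Union>w\<in>U. cylinder N w) / t + measure \<nu> (\<Union>w\<in>U. cylinder N w) * ln t
      + measure \<mu> (\<Union>w\<in>words N n - U. cylinder N w)"
    unfolding M.measure_UN_cylinders[OF U] V.measure_UN_cylinders[OF U]
    by (subst M.measure_UN_cylinders) (auto simp: sum.distrib sum_divide_distrib sum_distrib_right)
  also have "\<dots> \<le> 1 + measure \<nu> (\<Union>w\<in>U. cylinder N w) * ln t + 1"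
    using t by (intro add_mono) auto
  finally show ?thesis by simp
qed

text \<open>A null set of \<open>\<mu>\<close> with positive \<open>\<nu>\<close>-measure \<open>p\<close> would be approximated by unions of cylinders
  of \<open>\<mu>\<close>-measure at most \<open>exp (- T)\<close> and \<open>\<nu>\<close>-measure at least \<open>p / 2\<close>, for arbitrarily large
  \<open>T\<close>. This contradicts \<open>gibbs_relative_entropy_bound\<close>.\<close>

lemma gibbs_dominates_equilibrium:
  assumes g: "is_gibbs \<mu>" and \<nu>: "\<nu> \<in> invariant_measures N"
    and growth: "\<And>n. real n * P \<le> invariant_measure.block_entropy N \<nu> n + (\<Sum>w\<in>words N n. measure \<nu> (cylinder N w) * ln (\<psi> w))"
    and E: "E \<in> sets \<mu>" and null: "measure \<mu> E = 0"
  shows "measure \<nu> E = 0"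
proof (rule ccontr)
  assume "measure \<nu> E \<noteq> 0"
  define p where "p = measure \<nu> E"
  have p: "0 < p" using \<open>measure \<nu> E \<noteq> 0\<close> by (simp add: p_def zero_less_measure_iff)
  have \<mu>: "\<mu> \<in> invariant_measures N" using g by (simp add: is_gibbs_def)
  interpret M: invariant_measure N \<mu> using \<mu> by unfold_locales
  interpret V: invariant_measure N \<nu> using \<nu> by unfold_locales
  have sets: "sets \<nu> = sets \<mu>" by (simp add: M.sets_eq V.sets_eq)
  \<comment> \<open>Chosen so that \<open>T p / 2\<close> exceeds the bound \<open>2 - ln (\<kappa>\<^sup>3)\<close>.\<close>
  define T where "T = 2 * (3 + \<bar>ln (\<kappa> ^ 3)\<bar>) / p"
  define e where "e = min (exp (- T)) (p / 2)"
  have e: "0 < e" using p by (simp add: e_def)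
  obtain n U where U: "U \<subseteq> words N n"
      "measure \<mu> (E - (\<Union>w\<in>U. cylinder N w)) + measure \<mu> ((\<Union>w\<in>U. cylinder N w) - E) < e"
      "measure \<nu> (E - (\<Union>w\<in>U. cylinder N w)) + measure \<nu> ((\<Union>w\<in>U. cylinder N w) - E) < e"
    using approximation_by_cylinders[OF \<mu> \<nu> E e] by blast
  define CU where "CU = (\<Union>w\<in>U. cylinder N w)"
  have sU: "CU \<in> sets \<mu>" unfolding CU_def by (rule M.UN_cylinders_sets[OF U(1)])
  have "measure \<mu> CU \<le> measure \<mu> (E \<union> (CU - E))"
    using E sU by (intro M.finite_measure_mono) auto
  also have "\<dots> \<le> measure \<mu> E + measure \<mu> (CU - E)" using E sU by (intro measure_Un_le) auto
  also have "\<dots> \<le> exp (- T)"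
    using U(2) null measure_nonneg[of \<mu> "E - CU"] unfolding CU_def[symmetric] e_def by linarith
  finally have 1: "measure \<mu> CU \<le> exp (- T)" .
  have "p \<le> measure \<nu> (CU \<union> (E - CU))"
    unfolding p_def using E sU sets by (intro V.finite_measure_mono) auto
  also have "\<dots> \<le> measure \<nu> CU + measure \<nu> (E - CU)" using E sU sets by (intro measure_Un_le) auto
  also have "measure \<nu> (E - CU) \<le> p / 2"
    using U(3) measure_nonneg[of \<nu> "CU - E"] unfolding CU_def[symmetric] e_def by linarith
  finally have 2: "p / 2 \<le> measure \<nu> CU" by simp
  have T: "0 \<le> T" using p by (simp add: T_def)
  have "3 + \<bar>ln (\<kappa> ^ 3)\<bar> = p / 2 * T" using p by (simp add: T_def)
  also have "\<dots> \<le> measure \<nu> CU * T" by (rule mult_right_mono[OF 2 T])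
  also have "\<dots> \<le> 2 - ln (\<kappa> ^ 3)"
    using gibbs_relative_entropy_bound[OF g V.invariant_measure_axioms growth U(1), of "exp (- T)"] 1
    by (simp add: CU_def)
  finally show False by linarith
qed

text \<open>Let \<open>f\<close> be the density of \<open>\<nu>\<close> and \<open>E = {f > 1}\<close>. For an invariant measure the points that
  leave \<open>E\<close> have the same mass as those that enter it; but \<open>\<nu>\<close> exceeds \<open>\<mu>\<close> strictly inside \<open>E\<close>
  and is at most \<open>\<mu>\<close> outside, so both masses vanish. By ergodicity \<open>E\<close> has measure \<open>0\<close> or \<open>1\<close>; the
  latter would give \<open>\<nu> E > 1\<close>. So \<open>f \<le> 1\<close> almost everywhere, and total mass \<open>1\<close> forces equality.\<close>

lemma gibbs_dominated_unique:
  assumes g: "is_gibbs \<mu>" and \<nu>: "\<nu> \<in> invariant_measures N"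
    and dom: "\<And>E. E \<in> sets \<mu> \<Longrightarrow> measure \<mu> E = 0 \<Longrightarrow> measure \<nu> E = 0"
  shows "\<nu> = \<mu>"
proof -
  have \<mu>: "\<mu> \<in> invariant_measures N" using g by (simp add: is_gibbs_def)
  interpret M: invariant_measure N \<mu> using \<mu> by unfold_locales
  interpret V: invariant_measure N \<nu> using \<nu> by unfold_locales
  have sets: "sets \<nu> = sets \<mu>" by (simp add: M.sets_eq V.sets_eq)
  have sp: "space \<nu> = space \<mu>" by (simp add: M.space_eq V.space_eq)
  have ac: "absolutely_continuous \<mu> \<nu>"
    unfolding absolutely_continuous_def
  proof
    fix A assume A: "A \<in> null_sets \<mu>"
    hence "A \<in> sets \<mu>" "measure \<mu> A = 0" by (auto simp: measure_eq_0_null_sets)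
    thus "A \<in> null_sets \<nu>" using dom sets by (simp add: null_sets_def V.emeasure_eq_measure)
  qed
  define f where "f = RN_deriv \<mu> \<nu>"
  have f[measurable]: "f \<in> borel_measurable \<mu>" by (simp add: f_def)
  have dens: "density \<mu> f = \<nu>" unfolding f_def by (rule M.density_RN_deriv[OF ac sets])
  have em: "emeasure \<nu> A = (\<integral>\<^sup>+x. f x * indicator A x \<partial>\<mu>)" if "A \<in> sets \<mu>" for A
    using emeasure_density[OF f that] by (simp add: dens)
  define E where "E = {x \<in> space \<mu>. 1 < f x}"
  have E: "E \<in> sets \<mu>" unfolding E_def by measurable
  have strict: "measure \<mu> A = 0" if A: "A \<in> sets \<mu>" "A \<subseteq> E" and le: "measure \<nu> A \<le> measure \<mu> A" for A
  proof -
    have ge: "indicator A x \<le> f x * indicator A x" for x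
      using A(2) by (auto simp: E_def indicator_def)
    have i1: "(\<integral>\<^sup>+x. indicator A x \<partial>\<mu>) = emeasure \<mu> A" using A by simp
    have "(\<integral>\<^sup>+x. f x * indicator A x - indicator A x \<partial>\<mu>)
        = (\<integral>\<^sup>+x. f x * indicator A x \<partial>\<mu>) - (\<integral>\<^sup>+x. indicator A x \<partial>\<mu>)"
      using A ge i1 by (intro nn_integral_diff) (auto simp: M.emeasure_eq_measure)
    also have "\<dots> = emeasure \<nu> A - emeasure \<mu> A" using em[OF A(1)] i1 by simp
    also have "\<dots> = 0"
      using le by (simp add: M.emeasure_eq_measure V.emeasure_eq_measure ennreal_minus ennreal_neg)
    finally have "AE x in \<mu>. f x * indicator A x - indicator A x = 0"
      using A by (subst (asm) nn_integral_0_iff_AE) auto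
    hence "AE x in \<mu>. x \<notin> A"
    proof (rule AE_mp, intro AE_I2 impI notI)
      fix x assume "f x * indicator A x - indicator A x = 0" "x \<in> A"
      moreover have "1 < f x" using \<open>x \<in> A\<close> A(2) by (auto simp: E_def)
      ultimately show False by (auto simp: diff_eq_0_iff_ennreal dest: leD)
    qed
    thus ?thesis using A(1) M.prob_eq_0 by blast
  qed
  have below: "measure \<nu> A \<le> measure \<mu> A" if A: "A \<in> sets \<mu>" "A \<inter> E = {}" for A
  proof -
    have "emeasure \<nu> A \<le> (\<integral>\<^sup>+x. indicator A x \<partial>\<mu>)"
      unfolding em[OF A(1)]
    proof (rule nn_integral_mono)
      fix x assume "x \<in> space \<mu>"
      thus "f x * indicator A x \<le> indicator A x" using A(2) by (auto simp: E_def indicator_def not_less)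
    qed
    thus ?thesis using A(1) by (simp add: M.emeasure_eq_measure V.emeasure_eq_measure)
  qed
  define F where "F = shift -` E \<inter> space \<mu>"
  have F: "F \<in> sets \<mu>" unfolding F_def by (rule measurable_sets[OF M.measurable_shift E])
  have mF: "measure \<mu> F = measure \<mu> E" "measure \<nu> F = measure \<nu> E"
    using M.measure_shift[OF E] V.measure_shift[of E] E sets sp by (simp_all add: F_def)
  have split: "measure \<rho> (E - F) = measure \<rho> (F - E)"
    if "finite_measure \<rho>" "sets \<rho> = sets \<mu>" "measure \<rho> F = measure \<rho> E" for \<rho>
  proof -
    interpret R: finite_measure \<rho> by fact
    have "measure \<rho> (E - F) = measure \<rho> E - measure \<rho> (E \<inter> F)"
      "measure \<rho> (F - E) = measure \<rho> F - measure \<rho> (F \<inter> E)"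
      using E F that(2) by (auto intro!: R.finite_measure_Diff')
    thus ?thesis using that(3) by (simp add: Int_commute)
  qed
  have "measure \<nu> (E - F) = measure \<nu> (F - E)"
    by (rule split[OF V.finite_measure_axioms sets mF(2)])
  also have "\<dots> \<le> measure \<mu> (F - E)" using E F by (intro below) auto
  also have "\<dots> = measure \<mu> (E - F)" by (rule split[OF M.finite_measure_axioms refl mF(1), symmetric])
  finally have "measure \<mu> (E - F) = 0" using E F by (intro strict) auto
  moreover have "E - F = E - shift -` E" using sets.sets_into_space[OF E] by (auto simp: F_def)
  ultimately have "measure \<mu> E = 0 \<or> measure \<mu> E = 1" using gibbs_ergodic[OF g E] by simp
  moreover have "measure \<mu> E \<noteq> 1"
  proof
    assume "measure \<mu> E = 1"
    hence "measure \<nu> E \<le> measure \<mu> E" by simp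
    from strict[OF E subset_refl this] show False using \<open>measure \<mu> E = 1\<close> by simp
  qed
  ultimately have E0: "measure \<mu> E = 0" by blast
  have le: "measure \<nu> A \<le> measure \<mu> A" if A: "A \<in> sets \<mu>" for A
  proof -
    have "measure \<nu> A \<le> measure \<nu> ((A - E) \<union> E)" using A E sets by (intro V.finite_measure_mono) auto
    also have "\<dots> \<le> measure \<nu> (A - E) + measure \<nu> E" using A E sets by (intro measure_Un_le) auto
    also have "measure \<nu> E = 0" by (rule dom[OF E E0])
    also have "measure \<nu> (A - E) \<le> measure \<mu> (A - E)" using A E by (intro below) auto
    also have "\<dots> \<le> measure \<mu> A" using A by (intro M.finite_measure_mono) auto
    finally show ?thesis by simp
  qed
  show ?thesis
  proof (rule measure_eqI)
    fix A assume "A \<in> sets \<nu>"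
    hence A: "A \<in> sets \<mu>" by (simp add: sets)
    have "measure \<nu> (space \<mu> - A) \<le> measure \<mu> (space \<mu> - A)" using A by (intro le) auto
    hence "measure \<mu> A \<le> measure \<nu> A"
      using M.prob_compl[OF A] V.prob_compl[of A] A sets sp by simp
    thus "emeasure \<nu> A = emeasure \<mu> A"
      using le[OF A] by (simp add: M.emeasure_eq_measure V.emeasure_eq_measure)
  qed (rule sets)
qed

text \<open>The potential \<open>\<phi>\<close> need not be submultiplicative itself: a bounded distance of the logarithms to
  \<open>ln \<psi>\<close> suffices to have the same pressure and Lyapunov exponents.\<close>

theorem unique_equilibrium_state:
  assumes \<phi>: "\<And>w. w \<in> all_words N \<Longrightarrow> 0 < \<phi> w"
    and comparable: "\<And>w. w \<in> all_words N \<Longrightarrow> \<bar>ln (\<phi> w) - ln (\<psi> w)\<bar> \<le> C"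
  defines "p \<equiv> lim (\<lambda>n. 1 / real n * ln (\<Sum>w\<in>words N n. \<phi> w))"
    and "\<Lambda> \<equiv> \<lambda>\<nu>. lim (\<lambda>n. 1 / real n * (\<Sum>w\<in>words N n. measure \<nu> (cylinder N w) * ln (\<phi> w)))"
  shows "\<exists>\<mu>\<in>invariant_measures N. fully_supported N \<mu> \<and> p = entropy N \<mu> + \<Lambda> \<mu> \<and>
    (\<forall>\<nu>\<in>invariant_measures N. p = entropy N \<nu> + \<Lambda> \<nu> \<longrightarrow> \<nu> = \<mu>)"
proof -
  have C: "0 \<le> C" using comparable[of "[]"] by simp
  have bounded_null: "(\<lambda>n. x n / real n) \<longlonglongrightarrow> 0" if "\<And>n. \<bar>x n\<bar> \<le> B" for x B
  proof (rule Lim_null_comparison)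
    show "\<forall>\<^sub>F n in sequentially. norm (x n / real n) \<le> B / real n"
      using that by (intro always_eventually allI) (auto simp: abs_divide intro!: divide_right_mono)
  qed (rule lim_const_over_n)
  have pP: "p = P"
  proof -
    define x where "x n = ln (\<Sum>w\<in>words N n. \<phi> w) - ln (Z n)" for n
    have "\<bar>x n\<bar> \<le> C" for n
    proof -
      have w: "exp (- C) * \<psi> w \<le> \<phi> w \<and> \<phi> w \<le> exp C * \<psi> w" if "w \<in> words N n" for w
      proof -
        have l: "w \<in> all_words N" by (rule words_imp_all_words[OF that])
        have "exp (- C + ln (\<psi> w)) \<le> exp (ln (\<phi> w))" "exp (ln (\<phi> w)) \<le> exp (C + ln (\<psi> w))"
          using comparable[OF l] by (auto simp: abs_le_iff)
        thus ?thesis using \<phi>[OF l] pos[OF l] by (simp add: exp_add exp_diff exp_minus field_simps)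
      qed
      have lo: "exp (- C) * Z n \<le> (\<Sum>w\<in>words N n. \<phi> w)"
        unfolding Z_def sum_distrib_left using w by (intro sum_mono) auto
      have hi: "(\<Sum>w\<in>words N n. \<phi> w) \<le> exp C * Z n"
        unfolding Z_def sum_distrib_left using w by (intro sum_mono) auto
      have 0: "0 < exp (- C) * Z n" using Z_pos by simp
      have 1: "0 < (\<Sum>w\<in>words N n. \<phi> w)" using 0 lo by (rule less_le_trans)
      have "ln (exp (- C) * Z n) \<le> ln (\<Sum>w\<in>words N n. \<phi> w)"
        using lo 0 1 by (subst ln_le_cancel_iff)
      moreover have "ln (\<Sum>w\<in>words N n. \<phi> w) \<le> ln (exp C * Z n)"
        using hi 1 Z_pos by (subst ln_le_cancel_iff) auto
      ultimately show ?thesis using Z_pos[of n] by (simp add: x_def ln_mult abs_le_iff)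
    qed
    hence "(\<lambda>n. x n / real n + ln (Z n) / real n) \<longlonglongrightarrow> 0 + P"
      by (intro tendsto_add bounded_null P_tendsto)
    hence "(\<lambda>n. 1 / real n * ln (\<Sum>w\<in>words N n. \<phi> w)) \<longlonglongrightarrow> P"
      by (simp add: x_def add_divide_distrib[symmetric])
    thus ?thesis unfolding p_def by (rule limI)
  qed
  \<comment> \<open>The limits in the definitions of entropy and Lyapunov exponent exist for every invariant
    measure, and their sum bounds all finite stages from below.\<close>
  have growth: "\<exists>L. (\<lambda>n. (invariant_measure.block_entropy N \<nu> n + (\<Sum>w\<in>words N n. measure \<nu> (cylinder N w) * ln (\<psi> w))) / real n) \<longlonglongrightarrow> L
     \<and> entropy N \<nu> + \<Lambda> \<nu> = L \<and> (\<forall>n. real n * L \<le> invariant_measure.block_entropy N \<nu> n + (\<Sum>w\<in>words N n. measure \<nu> (cylinder N w) * ln (\<psi> w)))"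
    if \<nu>: "\<nu> \<in> invariant_measures N" for \<nu>
  proof -
    interpret V: invariant_measure N \<nu> using \<nu> by unfold_locales
    define \<Lambda>0 where "\<Lambda>0 n = (\<Sum>w\<in>words N n. V.wt w * ln (\<psi> w))" for n
    have \<Lambda>sub: "\<Lambda>0 (m + n) \<le> \<Lambda>0 m + \<Lambda>0 n" for m n
      unfolding \<Lambda>0_def by (rule V.weighted_log_subadditive[OF pos submult])
    have \<Lambda>low: "- (- ln \<delta>) * real n \<le> \<Lambda>0 n" for n
    proof -
      have "(\<Sum>w\<in>words N n. V.wt w * (real n * ln \<delta>)) \<le> \<Lambda>0 n"
        unfolding \<Lambda>0_def
      proof (intro sum_mono mult_left_mono)
        fix w assume w: "w \<in> words N n"
        have "ln (\<delta> ^ n) \<le> ln (\<psi> w)"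
          using lower[OF words_imp_all_words[OF w]] pos[OF words_imp_all_words[OF w]] \<delta> w
          by (subst ln_le_cancel_iff) (auto simp: words_length)
        thus "real n * ln \<delta> \<le> ln (\<psi> w)" using \<delta> by (simp add: ln_realpow)
      qed auto
      thus ?thesis unfolding sum_distrib_right[symmetric] V.sum_wt by (simp add: mult.commute)
    qed
    obtain l where l: "(\<lambda>n. \<Lambda>0 n / real n) \<longlonglongrightarrow> l" "\<And>n. real n * l \<le> \<Lambda>0 n"
      using fekete[of \<Lambda>0 "- ln \<delta>", OF \<Lambda>sub \<Lambda>low] by blast
    obtain h where h: "(\<lambda>n. V.block_entropy n / real n) \<longlonglongrightarrow> h" "\<And>n. real n * h \<le> V.block_entropy n"
      using fekete[of V.block_entropy 0, OF V.block_entropy_subadditive] V.block_entropy_nonneg by auto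
    have "entropy N \<nu> = h"
      using limI[OF h(1)] by (simp add: entropy_def V.block_entropy_def)
    moreover have "\<Lambda> \<nu> = l"
    proof -
      define x where "x n = (\<Sum>w\<in>words N n. V.wt w * ln (\<phi> w)) - \<Lambda>0 n" for n
      have "\<bar>x n\<bar> \<le> C" for n
      proof -
        have "x n = (\<Sum>w\<in>words N n. V.wt w * (ln (\<phi> w) - ln (\<psi> w)))"
          by (simp add: x_def \<Lambda>0_def sum_subtractf right_diff_distrib)
        also have "\<bar>\<dots>\<bar> \<le> (\<Sum>w\<in>words N n. \<bar>V.wt w * (ln (\<phi> w) - ln (\<psi> w))\<bar>)" by (rule sum_abs)
        also have "\<dots> \<le> (\<Sum>w\<in>words N n. V.wt w * C)"
          using comparable[OF words_imp_all_words] by (intro sum_mono) (auto simp: abs_mult intro!: mult_left_mono)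
        also have "\<dots> = C" by (simp add: sum_distrib_right[symmetric] V.sum_wt)
        finally show ?thesis .
      qed
      hence "(\<lambda>n. x n / real n + \<Lambda>0 n / real n) \<longlonglongrightarrow> 0 + l"
        by (intro tendsto_add bounded_null l)
      hence "(\<lambda>n. 1 / real n * (\<Sum>w\<in>words N n. V.wt w * ln (\<phi> w))) \<longlonglongrightarrow> l"
        by (simp add: x_def add_divide_distrib[symmetric])
      thus ?thesis unfolding \<Lambda>_def by (rule limI)
    qed
    moreover have "(\<lambda>n. (V.block_entropy n + \<Lambda>0 n) / real n) \<longlonglongrightarrow> h + l"
      unfolding add_divide_distrib by (intro tendsto_add h l)
    moreover have "real n * (h + l) \<le> V.block_entropy n + \<Lambda>0 n" for n
      using h(2)[of n] l(2)[of n] by (simp add: distrib_left)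
    ultimately show ?thesis unfolding \<Lambda>0_def by blast
  qed
  obtain \<mu> where g: "is_gibbs \<mu>" by (rule exists_gibbs)
  have \<mu>: "\<mu> \<in> invariant_measures N" using g by (simp add: is_gibbs_def)
  interpret M: invariant_measure N \<mu> using \<mu> by unfold_locales
  note mpos = is_gibbs_positive[OF g]
  have eq: "entropy N \<mu> + \<Lambda> \<mu> = P"
  proof -
    define G where "G n = M.block_entropy n + (\<Sum>w\<in>words N n. M.wt w * ln (\<psi> w))" for n
    define B where "B = \<bar>ln (\<kappa> ^ 3)\<bar> + \<bar>ln (\<kappa>\<^sup>2)\<bar>"
    have "\<bar>G n - real n * P\<bar> \<le> B" for n
    proof -
      have "G n - real n * P = (\<Sum>w\<in>words N n. M.wt w * (ln (\<psi> w) - real n * P - ln (M.wt w)))"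
      proof -
        have "(\<Sum>w\<in>words N n. M.wt w * (ln (\<psi> w) - real n * P - ln (M.wt w)))
          = M.block_entropy n + (\<Sum>w\<in>words N n. M.wt w * ln (\<psi> w)) - real n * P * (\<Sum>w\<in>words N n. M.wt w)"
          unfolding M.block_entropy_def sum_distrib_left sum.distrib[symmetric] sum_subtractf[symmetric]
          by (intro sum.cong refl) (simp add: algebra_simps)
        thus ?thesis by (simp add: G_def M.sum_wt)
      qed
      also have "\<bar>\<dots>\<bar> \<le> (\<Sum>w\<in>words N n. \<bar>M.wt w * (ln (\<psi> w) - real n * P - ln (M.wt w))\<bar>)" by (rule sum_abs)
      also have "\<dots> \<le> (\<Sum>w\<in>words N n. M.wt w * B)"
      proof (intro sum_mono)
        fix w assume w: "w \<in> words N n"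
        have l: "w \<in> all_words N" by (rule words_imp_all_words[OF w])
        have e: "ln (gibbs_weight w) = ln (\<psi> w) - real n * P"
          using pos[OF l] w by (simp add: gibbs_weight_def ln_mult words_length)
        have "ln (\<kappa> ^ 3 * gibbs_weight w) \<le> ln (M.wt w)"
          using g l \<kappa>_pos gibbs_weight_pos[OF l] mpos[OF l]
          by (subst ln_le_cancel_iff) (auto simp: is_gibbs_def)
        moreover have "ln (M.wt w) \<le> ln (gibbs_weight w / \<kappa>\<^sup>2)"
          using g l \<kappa>_pos gibbs_weight_pos[OF l] mpos[OF l]
          by (subst ln_le_cancel_iff) (auto simp: is_gibbs_def)
        moreover have "ln (\<kappa> ^ 3 * gibbs_weight w) = ln (\<kappa> ^ 3) + ln (gibbs_weight w)"
          using \<kappa>_pos gibbs_weight_pos[OF l] by (intro ln_mult_pos) auto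
        moreover have "ln (gibbs_weight w / \<kappa>\<^sup>2) = ln (gibbs_weight w) - ln (\<kappa>\<^sup>2)"
          using \<kappa>_pos gibbs_weight_pos[OF l] by (intro ln_divide_pos) auto
        ultimately have "\<bar>ln (\<psi> w) - real n * P - ln (M.wt w)\<bar> \<le> B" unfolding B_def e by linarith
        thus "\<bar>M.wt w * (ln (\<psi> w) - real n * P - ln (M.wt w))\<bar> \<le> M.wt w * B"
          by (simp add: abs_mult mult_left_mono)
      qed
      also have "\<dots> = B" by (simp add: sum_distrib_right[symmetric] M.sum_wt)
      finally show ?thesis .
    qed
    hence "(\<lambda>n. (G n - real n * P) / real n) \<longlonglongrightarrow> 0" by (rule bounded_null)
    hence "(\<lambda>n. (G n - real n * P) / real n + P) \<longlonglongrightarrow> 0 + P" by (intro tendsto_add tendsto_const)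
    moreover have "\<forall>\<^sub>F n in sequentially. (G n - real n * P) / real n + P = G n / real n"
      using eventually_gt_at_top[of 0] by eventually_elim (simp add: field_simps)
    ultimately have "(\<lambda>n. G n / real n) \<longlonglongrightarrow> P" by (simp add: Lim_transform_eventually)
    thus ?thesis using growth[OF \<mu>] LIMSEQ_unique unfolding G_def by blast
  qed
  have supp: "fully_supported N \<mu>"
    unfolding fully_supported_def using mpos words_imp_all_words by blast
  have uniq: "\<nu> = \<mu>" if \<nu>: "\<nu> \<in> invariant_measures N" and e: "p = entropy N \<nu> + \<Lambda> \<nu>" for \<nu>
    using growth[OF \<nu>] e pP
    by (intro gibbs_dominated_unique[OF g \<nu>] gibbs_dominates_equilibrium[OF g \<nu>]) auto
  have "p = entropy N \<mu> + \<Lambda> \<mu>" using eq pP by (simp only:)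
  thus ?thesis using \<mu> supp uniq by blast
qed

end


section \<open>Minimal finite unions of subspaces\<close>

text \<open>The linear analogue of the Zariski closure: every finite cover of \<open>S\<close> by subspaces contains each
  member of \<open>\<F>\<close> in one of its members. If \<open>S\<close> cannot be covered by finitely many proper subspaces
  of its span, then the span alone will do; otherwise \<open>S\<close> is cut into pieces of smaller span.\<close>

lemma minimal_subspace_cover:
  fixes S :: "'a::euclidean_space set"
  obtains \<F> where "finite \<F>" "\<forall>W\<in>\<F>. subspace W" "S \<subseteq> \<Union>\<F>" "\<forall>W\<in>\<F>. W \<inter> S \<noteq> {}"
    "\<forall>\<G>. finite \<G> \<and> (\<forall>G\<in>\<G>. subspace G) \<and> S \<subseteq> \<Union>\<G> \<longrightarrow> (\<forall>W\<in>\<F>. \<exists>G\<in>\<G>. W \<subseteq> G)"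
proof -
  define good where "good \<F> S \<longleftrightarrow> finite \<F> \<and> (\<forall>W\<in>\<F>. subspace W) \<and> S \<subseteq> \<Union>\<F> \<and> (\<forall>W\<in>\<F>. W \<inter> S \<noteq> {}) \<and>
    (\<forall>\<G>. finite \<G> \<and> (\<forall>G\<in>\<G>. subspace G) \<and> S \<subseteq> \<Union>\<G> \<longrightarrow> (\<forall>W\<in>\<F>. \<exists>G\<in>\<G>. W \<subseteq> G))"
    for \<F> and S :: "'a set"
  have goodD: "finite \<F>" "W \<in> \<F> \<Longrightarrow> subspace W" "S \<subseteq> \<Union>\<F>" "W \<in> \<F> \<Longrightarrow> W \<inter> S \<noteq> {}"
      "\<lbrakk>finite \<G>; \<And>G. G \<in> \<G> \<Longrightarrow> subspace G; S \<subseteq> \<Union>\<G>; W \<in> \<F>\<rbrakk> \<Longrightarrow> \<exists>G\<in>\<G>. W \<subseteq> G"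
    if "good \<F> S" for \<F> S W \<G>
    using that unfolding good_def by simp_all
  have "\<exists>\<F>. good \<F> S"
  proof (induction "dim S" arbitrary: S rule: less_induct)
    case less
    show ?case
    proof (cases "\<exists>\<H>. finite \<H> \<and> (\<forall>H\<in>\<H>. subspace H \<and> H \<subset> span S) \<and> S \<subseteq> \<Union>\<H>")
      case True
      then obtain \<H> where \<H>: "finite \<H>" "\<And>H. H \<in> \<H> \<Longrightarrow> subspace H" "\<And>H. H \<in> \<H> \<Longrightarrow> H \<subset> span S" "S \<subseteq> \<Union>\<H>"
        by blast
      have "\<exists>\<F>. good \<F> (S \<inter> H)" if "H \<in> \<H>" for H
      proof (rule less)
        have "dim (S \<inter> H) \<le> dim H" by (rule dim_subset) auto
        also have "dim H < dim (span S)"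
          using \<H>(2,3)[OF that] by (intro dim_psubset) (metis span_eq_iff subspace_span)
        finally show "dim (S \<inter> H) < dim S" by simp
      qed
      then obtain \<F> where \<F>: "\<And>H. H \<in> \<H> \<Longrightarrow> good (\<F> H) (S \<inter> H)" by metis
      have "good (\<Union>H\<in>\<H>. \<F> H) S"
        unfolding good_def
      proof (intro conjI allI impI ballI)
        show "finite (\<Union>H\<in>\<H>. \<F> H)" using \<H>(1) goodD(1)[OF \<F>] by blast
        show "S \<subseteq> \<Union>(\<Union>H\<in>\<H>. \<F> H)"
        proof
          fix x assume "x \<in> S"
          then obtain H where "H \<in> \<H>" "x \<in> S \<inter> H" using \<H>(4) by blast
          thus "x \<in> \<Union>(\<Union>H\<in>\<H>. \<F> H)" using goodD(3)[OF \<F>[of H]] by blast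
        qed
        fix W assume "W \<in> (\<Union>H\<in>\<H>. \<F> H)"
        then obtain H where H: "H \<in> \<H>" "W \<in> \<F> H" by blast
        show "subspace W" "W \<inter> S \<noteq> {}"
          using goodD(2)[OF \<F>[OF H(1)] H(2)] goodD(4)[OF \<F>[OF H(1)] H(2)] by blast+
        fix \<G> assume \<G>: "finite \<G> \<and> (\<forall>G\<in>\<G>. subspace G) \<and> S \<subseteq> \<Union>\<G>"
        hence "S \<inter> H \<subseteq> \<Union>\<G>" by blast
        thus "\<exists>G\<in>\<G>. W \<subseteq> G" using goodD(5)[OF \<F>[OF H(1)], of \<G> W] H(2) \<G> by simp
      qed
      thus ?thesis by blast
    next
      case False
      have "S \<noteq> {}"
      proof
        assume "S = {}"
        hence "finite {} \<and> (\<forall>H\<in>{}. subspace H \<and> H \<subset> span S) \<and> S \<subseteq> \<Union>{}" by simp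
        thus False using False by blast
      qed
      have "good {span S} S"
        unfolding good_def
      proof (intro conjI allI impI ballI)
        show "S \<subseteq> \<Union>{span S}" by (auto intro: span_base)
        fix W assume "W \<in> {span S}"
        thus "subspace W" "W \<inter> S \<noteq> {}" using \<open>S \<noteq> {}\<close> by (auto intro: span_base)
        fix \<G> assume \<G>: "finite \<G> \<and> (\<forall>G\<in>\<G>. subspace G) \<and> S \<subseteq> \<Union>\<G>"
        let ?H = "(\<lambda>G. G \<inter> span S) ` \<G>"
        have H: "finite ?H" "\<forall>H\<in>?H. subspace H" "S \<subseteq> \<Union>?H"
          using \<G> by (auto intro: subspace_inter span_base)
        have "\<not> (\<forall>H\<in>?H. H \<subset> span S)"
        proof
          assume "\<forall>H\<in>?H. H \<subset> span S"
          hence "finite ?H \<and> (\<forall>H\<in>?H. subspace H \<and> H \<subset> span S) \<and> S \<subseteq> \<Union>?H" using H by simp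
          hence "\<exists>\<H>. finite \<H> \<and> (\<forall>H\<in>\<H>. subspace H \<and> H \<subset> span S) \<and> S \<subseteq> \<Union>\<H>"
            by (rule exI[of _ ?H])
          with False show False by (rule notE)
        qed
        then obtain G where "G \<in> \<G>" "\<not> G \<inter> span S \<subset> span S" by auto
        thus "\<exists>G\<in>\<G>. W \<subseteq> G" using \<open>W \<in> {span S}\<close> by (intro bexI[of _ G]) auto
      qed simp
      thus ?thesis by blast
    qed
  qed
  then obtain \<F> where g: "good \<F> S" by blast
  show ?thesis by (rule that[of \<F>]) (use g in \<open>simp_all add: good_def\<close>)
qed


section \<open>Linear representations of words\<close>

lemma onorm_attained:
  fixes f :: "'a::euclidean_space \<Rightarrow> 'b::real_normed_vector"
  assumes "bounded_linear f"
  obtains x where "norm x = 1" "norm (f x) = onorm f"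
proof -
  have "sphere (0::'a) 1 \<noteq> {}" by simp
  moreover have "continuous_on (sphere 0 1) (\<lambda>x. norm (f x))"
    by (intro continuous_on_norm linear_continuous_on assms)
  ultimately obtain x where x: "x \<in> sphere 0 1" "\<And>y. y \<in> sphere 0 1 \<Longrightarrow> norm (f y) \<le> norm (f x)"
    using continuous_attains_sup[OF compact_sphere] by metis
  have "norm (f y) \<le> norm (f x) * norm y" for y
  proof (cases "y = 0")
    case True
    thus ?thesis using assms by (simp add: linear_0 bounded_linear.linear)
  next
    case False
    have "norm (f ((1 / norm y) *\<^sub>R y)) \<le> norm (f x)" using False by (intro x) simp
    thus ?thesis
      using False assms by (simp add: linear_scale bounded_linear.linear field_simps)
  qed
  hence "onorm f \<le> norm (f x)" by (intro onorm_bound) auto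
  moreover have "norm (f x) \<le> onorm f" using onorm[OF assms, of x] x by simp
  ultimately show ?thesis using x that by auto
qed

text \<open>A linear action of the free monoid of words on \<open>V\<close>, extended to the ambient Euclidean space by
  the orthogonal projection \<open>F []\<close> onto \<open>V\<close>. Thus \<open>F w\<close> vanishes on the orthogonal complement of
  \<open>V\<close>, and its operator norm is that of its restriction to \<open>V\<close>.\<close>

locale word_representation =
  fixes N :: nat and V :: "'a::euclidean_space set" and F :: "nat list \<Rightarrow> 'a \<Rightarrow> 'a"
  assumes linear_F: "linear (F w)"
    and range_F: "F w x \<in> V"
    and F_Nil: "x \<in> V \<Longrightarrow> F [] x = x"
    and F_Nil_symmetric: "F [] x \<bullet> y = x \<bullet> F [] y"
    and F_append: "F (u @ v) x = F u (F v x)"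
    and F_injective: "w \<in> all_words N \<Longrightarrow> x \<in> V \<Longrightarrow> F w x = 0 \<Longrightarrow> x = 0"
    and V_nontrivial: "\<exists>x\<in>V. x \<noteq> 0"
begin

lemma subspace_V: "subspace V"
proof -
  have "V = range (F [])"
  proof (intro equalityI subsetI)
    fix x assume "x \<in> V"
    thus "x \<in> range (F [])" by (metis F_Nil rangeI)
  qed (use range_F in auto)
  thus ?thesis using linear_subspace_image[OF linear_F subspace_UNIV] by simp
qed

lemma bounded_linear_F: "bounded_linear (F w)"
  using linear_F linear_conv_bounded_linear by blast

lemma onorm_pos:
  assumes "w \<in> all_words N"
  shows "0 < onorm (F w)"
proof -
  obtain x where "x \<in> V" "x \<noteq> 0" using V_nontrivial by blast
  hence "F w x \<noteq> 0" using F_injective[OF assms] by blast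
  thus ?thesis using onorm_pos_lt[OF bounded_linear_F] by blast
qed

lemma onorm_submult: "onorm (F (u @ v)) \<le> onorm (F u) * onorm (F v)"
proof -
  have "F (u @ v) = F u \<circ> F v" by (auto simp: F_append)
  thus ?thesis using onorm_compose[OF bounded_linear_F bounded_linear_F] by simp
qed

lemma F_letter_surj:
  assumes "i \<in> {1..N}"
  shows "F [i] ` V = V"
proof -
  have "inj_on (F [i]) V"
  proof (rule inj_onI)
    fix x y assume "x \<in> V" "y \<in> V" "F [i] x = F [i] y"
    hence "x - y \<in> V" "F [i] (x - y) = 0"
      using subspace_V by (auto simp: subspace_diff linear_diff[OF linear_F])
    thus "x = y" using F_injective[of "[i]" "x - y"] assms by (simp add: letters_def)
  qed
  moreover have "span V = V" using subspace_V by (simp only: span_eq_iff)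
  ultimately have "dim (F [i] ` V) = dim V"
    by (intro dim_image_eq linear_F) (simp only:)
  moreover have "F [i] ` V \<subseteq> V" using range_F by auto
  ultimately show ?thesis
    using subspace_V linear_subspace_image[OF linear_F subspace_V] by (intro subspace_dim_equal) auto
qed

lemma onorm_lower_bound:
  obtains \<delta> where "0 < \<delta>" "\<And>w. w \<in> all_words N \<Longrightarrow> \<delta> ^ length w \<le> onorm (F w)"
proof -
  have "\<exists>e>0. \<forall>x\<in>V. e * norm x \<le> norm (F [i] x)" if "i \<in> {1..N}" for i
  proof (rule injective_imp_isometric)
    show "\<forall>x\<in>V. F [i] x = 0 \<longrightarrow> x = 0" using F_injective[of "[i]"] that by (auto simp: letters_def)
  qed (use subspace_V bounded_linear_F in \<open>auto simp: closed_subspace\<close>)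
  then obtain e where e: "\<And>i. i \<in> {1..N} \<Longrightarrow> 0 < e i"
    "\<And>i x. i \<in> {1..N} \<Longrightarrow> x \<in> V \<Longrightarrow> e i * norm x \<le> norm (F [i] x)" by metis
  define \<delta> where "\<delta> = Min (insert 1 (e ` {1..N}))"
  have \<delta>: "0 < \<delta>" unfolding \<delta>_def using e(1) by (subst Min_gr_iff) auto
  have \<delta>_le: "\<delta> \<le> e i" if "i \<in> {1..N}" for i unfolding \<delta>_def using that by (intro Min_le) auto
  have *: "\<delta> ^ length w * norm x \<le> norm (F w x)" if "w \<in> all_words N" "x \<in> V" for w x
    using that
  proof (induction w)
    case Nil
    thus ?case by (simp add: F_Nil)
  next
    case (Cons i w)
    have i: "i \<in> {1..N}" and w: "w \<in> all_words N" using Cons.prems(1) unfolding all_words_Cons letters_def by blast+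
    have "\<delta> ^ length (i # w) * norm x \<le> \<delta> * norm (F w x)"
      using Cons.IH[OF w Cons.prems(2)] \<delta> by (simp add: mult.assoc)
    also have "\<dots> \<le> e i * norm (F w x)" using \<delta>_le[OF i] by (intro mult_right_mono) auto
    also have "\<dots> \<le> norm (F [i] (F w x))" using i by (intro e range_F)
    also have "F [i] (F w x) = F (i # w) x" using F_append[of "[i]" w x] by simp
    finally show ?case .
  qed
  have "\<delta> ^ length w \<le> onorm (F w)" if w: "w \<in> all_words N" for w
  proof -
    obtain x where x: "x \<in> V" "x \<noteq> 0" using V_nontrivial by blast
    have "\<delta> ^ length w * norm x \<le> onorm (F w) * norm x"
      using *[OF w x(1)] onorm[OF bounded_linear_F, of w x] by linarith
    thus ?thesis using x by simp
  qed
  thus ?thesis using \<delta> that by blast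
qed

text \<open>Take \<open>x\<close> in the direction in which \<open>F v\<close> maps a unit vector of maximal stretch, and \<open>z\<close> in the
  direction of the adjoint of \<open>F u\<close> applied to its own direction of maximal stretch. Then \<open>F w\<close>
  connects \<open>v\<close> to \<open>u\<close> well as soon as the single matrix coefficient \<open>z \<bullet> F w x\<close> is not small.\<close>

lemma norming_vectors:
  assumes u: "u \<in> all_words N" and v: "v \<in> all_words N"
  obtains x z where "x \<in> V" "z \<in> V" "norm x = 1" "norm z = 1"
    "\<And>w. onorm (F u) * onorm (F v) * \<bar>z \<bullet> F w x\<bar> \<le> onorm (F (u @ w @ v))"
proof -
  define a b where "a = onorm (F u)" and "b = onorm (F v)"
  have ab: "0 < a" "0 < b" unfolding a_def b_def using onorm_pos u v by auto
  obtain x0 where x0: "norm x0 = 1" "norm (F v x0) = b"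
    unfolding b_def by (rule onorm_attained[OF bounded_linear_F])
  obtain y0 where y0: "norm y0 = 1" "norm (F u y0) = a"
    unfolding a_def by (rule onorm_attained[OF bounded_linear_F])
  define x where "x = (1 / b) *\<^sub>R F v x0"
  define e where "e = (1 / a) *\<^sub>R F u y0"
  define y where "y = adjoint (F u) e"
  have e1: "norm e = 1" using y0 ab by (simp add: e_def)
  have adj: "y \<bullet> p = e \<bullet> F u p" for p
    unfolding y_def using adjoint_works[OF linear_F[of u], of p e] by (simp add: inner_commute)
  have "y \<bullet> y0 = a"
    unfolding adj e_def using y0 ab by (simp add: power2_norm_eq_inner[symmetric] power2_eq_square)
  hence ny: "a \<le> norm y" using norm_cauchy_schwarz[of y y0] y0 by simp
  \<comment> \<open>The adjoint maps into \<open>V\<close> because \<open>F u = F u \<circ> F []\<close> and \<open>F []\<close> is an orthogonal projection.\<close>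
  have yV: "y \<in> V"
  proof -
    have "p \<bullet> F [] y = p \<bullet> y" for p
    proof -
      have "p \<bullet> F [] y = y \<bullet> F [] p" by (metis F_Nil_symmetric inner_commute)
      also have "\<dots> = e \<bullet> F u p" using F_append[of u "[]" p] by (simp add: adj)
      finally show ?thesis by (metis adj inner_commute)
    qed
    hence "F [] y = y" by (metis vector_eq_rdot inner_commute)
    thus ?thesis by (metis range_F)
  qed
  define z where "z = (1 / norm y) *\<^sub>R y"
  have "y \<noteq> 0" using ny ab by auto
  have "norm x = 1" using x0 ab by (simp add: x_def)
  moreover have "norm z = 1" using \<open>y \<noteq> 0\<close> by (simp add: z_def)
  moreover have "x \<in> V" "z \<in> V" unfolding x_def z_def using yV range_F subspace_V by (auto simp: subspace_scale)
  moreover have "a * b * \<bar>z \<bullet> F w x\<bar> \<le> onorm (F (u @ w @ v))" for w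
  proof -
    have "F w (F v x0) = b *\<^sub>R F w x" using ab by (simp add: x_def linear_scale[OF linear_F])
    hence "e \<bullet> F (u @ w @ v) x0 = b * norm y * (z \<bullet> F w x)"
      using \<open>y \<noteq> 0\<close> by (simp add: F_append adj[symmetric] z_def)
    hence "b * norm y * \<bar>z \<bullet> F w x\<bar> = \<bar>e \<bullet> F (u @ w @ v) x0\<bar>"
      using ab by (simp add: abs_mult)
    also have "\<dots> \<le> norm (F (u @ w @ v) x0)"
      using Cauchy_Schwarz_ineq2[of e "F (u @ w @ v) x0"] e1 by simp
    also have "\<dots> \<le> onorm (F (u @ w @ v))"
      using onorm[OF bounded_linear_F, of "u @ w @ v" x0] x0 by simp
    finally have 1: "b * norm y * \<bar>z \<bullet> F w x\<bar> \<le> onorm (F (u @ w @ v))" .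
    have "a * b * \<bar>z \<bullet> F w x\<bar> \<le> norm y * b * \<bar>z \<bullet> F w x\<bar>"
      using ny ab by (intro mult_right_mono) auto
    thus ?thesis using 1 by (simp add: mult.commute)
  qed
  ultimately show ?thesis using that unfolding a_def b_def by blast
qed

end


section \<open>Simultaneous non-vanishing and quasi-multiplicativity\<close>

text \<open>One and the same word \<open>w\<close> has to make both matrix coefficients nonzero.\<close>

definition jointly_connecting :: "nat \<Rightarrow> 'a::euclidean_space set \<Rightarrow> (nat list \<Rightarrow> 'a \<Rightarrow> 'a) \<Rightarrow>
    'b::euclidean_space set \<Rightarrow> (nat list \<Rightarrow> 'b \<Rightarrow> 'b) \<Rightarrow> bool" where
  "jointly_connecting N V F V' F' \<longleftrightarrow>
    (\<forall>x\<in>V - {0}. \<forall>z\<in>V - {0}. \<forall>x'\<in>V' - {0}. \<forall>z'\<in>V' - {0}.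
       \<exists>w\<in>all_words N. z \<bullet> F w x \<noteq> 0 \<and> z' \<bullet> F' w x' \<noteq> 0)"

lemma jointly_connecting_commute:
  "jointly_connecting N V F V' F' \<Longrightarrow> jointly_connecting N V' F' V F"
  unfolding jointly_connecting_def by blast

text \<open>Suppose every word fails in one of the two factors, and let \<open>\<F>\<close> be the minimal cover of the
  orbit \<open>S\<close> of \<open>(x, x')\<close>. Minimality makes each member of \<open>\<F>\<close> map into another under every letter,
  and puts it inside the kernel of \<open>z\<close> or of \<open>z'\<close>. Members that project onto all of \<open>V\<close> are not in
  the kernel of \<open>z\<close>, and they map to members of the same kind, so the span of their projections to
  \<open>V'\<close> would be an invariant subspace in the kernel of \<open>z'\<close>, against irreducibility of \<open>V'\<close>. Hence
  there are no such members, and the projections to \<open>V\<close> form an invariant finite union of proper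
  nontrivial subspaces, against strong irreducibility of \<open>V\<close>.\<close>

lemma strongly_irreducible_jointly_connecting:
  fixes V :: "'a::euclidean_space set" and V' :: "'b::euclidean_space set"
  assumes R: "word_representation N V F" and R': "word_representation N V' F'"
    and strong: "strongly_irreducible_tuple V N (\<lambda>i. F [i])"
    and irred: "irreducible_tuple V' N (\<lambda>i. F' [i])"
  shows "jointly_connecting N V F V' F'"
  unfolding jointly_connecting_def
proof (intro ballI)
  interpret R: word_representation N V F by fact
  interpret R': word_representation N V' F' by fact
  fix x z x' z' assume x: "x \<in> V - {0}" and z: "z \<in> V - {0}" and x': "x' \<in> V' - {0}" and z': "z' \<in> V' - {0}"
  show "\<exists>w\<in>all_words N. z \<bullet> F w x \<noteq> 0 \<and> z' \<bullet> F' w x' \<noteq> 0"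
  proof (rule ccontr)
    assume "\<not> ?thesis"
    hence zero: "z \<bullet> F w x = 0 \<or> z' \<bullet> F' w x' = 0" if "w \<in> all_words N" for w using that by blast
    define S where "S = (\<lambda>w. (F w x, F' w x')) ` all_words N"
    obtain \<F> where cover: "finite \<F>" "\<forall>W\<in>\<F>. subspace W" "S \<subseteq> \<Union>\<F>" "\<forall>W\<in>\<F>. W \<inter> S \<noteq> {}"
      "\<forall>\<G>. finite \<G> \<and> (\<forall>G\<in>\<G>. subspace G) \<and> S \<subseteq> \<Union>\<G> \<longrightarrow> (\<forall>W\<in>\<F>. \<exists>G\<in>\<G>. W \<subseteq> G)"
      by (rule minimal_subspace_cover[of S])
    note \<F> = cover(1) bspec[OF cover(2)] cover(3) bspec[OF cover(4)]
    have minimal: "\<exists>G\<in>\<G>. W \<subseteq> G"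
      if "finite \<G>" "\<And>G. G \<in> \<G> \<Longrightarrow> subspace G" "S \<subseteq> \<Union>\<G>" "W \<in> \<F>" for \<G> W
      using cover(5) that by simp
    have meets: "\<exists>w\<in>all_words N. (F w x, F' w x') \<in> W" if "W \<in> \<F>" for W
      using \<F>(4)[OF that] by (auto simp: S_def)
    have nz: "F w x \<noteq> 0" "F' w x' \<noteq> 0" if "w \<in> all_words N" for w
      using R.F_injective[OF that, of x] R'.F_injective[OF that, of x'] x x' by blast+
    have inV: "W \<subseteq> V \<times> V'" if "W \<in> \<F>" for W
      using minimal[of "{V \<times> V'}" W] that R.range_F R'.range_F R.subspace_V R'.subspace_V
      by (auto simp: S_def intro: subspace_Times)
    have ker: "W \<subseteq> {p. z \<bullet> fst p = 0} \<or> W \<subseteq> {p. z' \<bullet> snd p = 0}" if "W \<in> \<F>" for W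
    proof -
      have "\<exists>G\<in>{{p. z \<bullet> fst p = 0}, {p. z' \<bullet> snd p = 0}}. W \<subseteq> G"
      proof (rule minimal[OF _ _ _ that])
        fix G assume "G \<in> {{p :: 'a \<times> 'b. z \<bullet> fst p = 0}, {p. z' \<bullet> snd p = 0}}"
        thus "subspace G" by (auto simp: subspace_def inner_add_right)
      next
        show "S \<subseteq> \<Union>{{p. z \<bullet> fst p = 0}, {p. z' \<bullet> snd p = 0}}"
        proof
          fix p assume "p \<in> S"
          then obtain w where w: "w \<in> all_words N" "p = (F w x, F' w x')" by (auto simp: S_def)
          show "p \<in> \<Union>{{p. z \<bullet> fst p = 0}, {p. z' \<bullet> snd p = 0}}" using zero[OF w(1)] w(2) by auto
        qed
      qed simp
      thus ?thesis by blast
    qed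
    define C where "C i = (\<lambda>p. (F [i] (fst p), F' [i] (snd p)))" for i
    have linC: "linear (C i)" for i
      unfolding C_def
      by (intro linearI) (auto simp: linear_add[OF R.linear_F] linear_add[OF R'.linear_F]
          linear_scale[OF R.linear_F] linear_scale[OF R'.linear_F])
    have step: "\<exists>W'\<in>\<F>. C i ` W \<subseteq> W'" if W: "W \<in> \<F>" and i: "i \<in> {1..N}" for W i
    proof -
      have "\<exists>G\<in>(\<lambda>W. C i -` W) ` \<F>. W \<subseteq> G"
      proof (rule minimal[OF _ _ _ W])
        fix G assume "G \<in> (\<lambda>W. C i -` W) ` \<F>"
        thus "subspace G" using \<F>(2) linear_subspace_vimage[OF linC] by auto
      next
        show "S \<subseteq> \<Union>((\<lambda>W. C i -` W) ` \<F>)"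
        proof
          fix p assume "p \<in> S"
          then obtain w where w: "w \<in> all_words N" "p = (F w x, F' w x')" by (auto simp: S_def)
          have "C i p = (F ([i] @ w) x, F' ([i] @ w) x')"
            by (simp only: w C_def fst_conv snd_conv R.F_append R'.F_append)
          hence "C i p \<in> S" unfolding S_def using w i by (auto simp: letters_def)
          thus "p \<in> \<Union>((\<lambda>W. C i -` W) ` \<F>)" using \<F>(3) by blast
        qed
      qed (use \<F>(1) in auto)
      thus ?thesis by blast
    qed
    define full where "full = {W \<in> \<F>. fst ` W = V}"
    show False
    proof (cases "full = {}")
      case True
      define \<U> where "\<U> = (\<lambda>W. fst ` W) ` \<F>"
      have "(F [] x, F' [] x') \<in> S" unfolding S_def by (intro imageI) simp
      hence "\<F> \<noteq> {}" using \<F>(3) by blast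
      have "proper_nontrivial_subspace V U" if "U \<in> \<U>" for U
      proof -
        obtain W where W: "W \<in> \<F>" "U = fst ` W" using \<open>U \<in> \<U>\<close> by (auto simp: \<U>_def)
        have "subspace U" unfolding W using \<F>(2)[OF W(1)] linear_fst by (rule linear_subspace_image[rotated])
        moreover have "U \<subseteq> V" using inV[OF W(1)] W by auto
        moreover have "U \<noteq> {0}"
        proof -
          obtain w where "w \<in> all_words N" "(F w x, F' w x') \<in> W" using meets[OF W(1)] by blast
          thus ?thesis using nz W by force
        qed
        moreover have "U \<noteq> V" using True W by (auto simp: full_def)
        ultimately show ?thesis by (simp add: proper_nontrivial_subspace_def)
      qed
      moreover have "F [i] ` \<Union>\<U> \<subseteq> \<Union>\<U>" if i: "i \<in> {1..N}" for i
      proof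
        fix y assume "y \<in> F [i] ` \<Union>\<U>"
        then obtain W p where W: "W \<in> \<F>" "p \<in> W" "y = F [i] (fst p)" by (auto simp: \<U>_def)
        obtain W' where W': "W' \<in> \<F>" "C i ` W \<subseteq> W'" using step[OF W(1) i] by blast
        hence "C i p \<in> W'" using W by blast
        moreover have "fst (C i p) = y" by (simp add: C_def W)
        ultimately have "y \<in> fst ` W'" by force
        thus "y \<in> \<Union>\<U>" using W' by (auto simp: \<U>_def)
      qed
      moreover have "finite \<U>" "\<U> \<noteq> {}" using \<F>(1) \<open>\<F> \<noteq> {}\<close> by (auto simp: \<U>_def)
      ultimately have "finite \<U> \<and> \<U> \<noteq> {} \<and> (\<forall>U\<in>\<U>. proper_nontrivial_subspace V U) \<and>
          (\<forall>i\<in>{1..N}. F [i] ` \<Union>\<U> \<subseteq> \<Union>\<U>)" by simp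
      hence "\<not> strongly_irreducible_tuple V N (\<lambda>i. F [i])"
        unfolding strongly_irreducible_tuple_def not_not by (rule exI)
      thus False using strong by contradiction
    next
      case False
      have full_ker: "W \<subseteq> {p. z' \<bullet> snd p = 0}" if "W \<in> full" for W
      proof -
        have "z \<in> fst ` W" using that z by (simp add: full_def)
        hence "\<not> W \<subseteq> {p. z \<bullet> fst p = 0}" using z by auto
        thus ?thesis using ker[of W] that by (auto simp: full_def)
      qed
      define T where "T = span (\<Union>W\<in>full. snd ` W)"
      have TV: "T \<subseteq> V'"
        unfolding T_def
      proof (rule span_minimal[OF _ R'.subspace_V])
        show "(\<Union>W\<in>full. snd ` W) \<subseteq> V'"
        proof
          fix y assume "y \<in> (\<Union>W\<in>full. snd ` W)"
          then obtain W p where "W \<in> \<F>" "p \<in> W" "y = snd p" by (auto simp: full_def)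
          thus "y \<in> V'" using inV[of W] by auto
        qed
      qed
      have Tz: "T \<subseteq> {y. z' \<bullet> y = 0}"
        unfolding T_def using full_ker
        by (intro span_minimal) (auto simp: subspace_def inner_add_right)
      have "proper_nontrivial_subspace V' T"
      proof -
        obtain W where W: "W \<in> full" using False by blast
        then obtain w where w: "w \<in> all_words N" "(F w x, F' w x') \<in> W" using meets[of W] by (auto simp: full_def)
        hence "F' w x' \<in> T" unfolding T_def using W by (intro span_base) force
        hence "T \<noteq> {0}" using nz(2)[OF w(1)] by auto
        moreover have "T \<noteq> V'" using Tz z' by auto
        ultimately show ?thesis using TV by (simp add: proper_nontrivial_subspace_def T_def)
      qed
      moreover have "F' [i] ` T \<subseteq> T" if i: "i \<in> {1..N}" for i
      proof -
        have "F' [i] ` (\<Union>W\<in>full. snd ` W) \<subseteq> (\<Union>W\<in>full. snd ` W)"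
        proof
          fix y assume "y \<in> F' [i] ` (\<Union>W\<in>full. snd ` W)"
          then obtain W p where W: "W \<in> full" "p \<in> W" "y = F' [i] (snd p)" by auto
          obtain W' where W': "W' \<in> \<F>" "C i ` W \<subseteq> W'" using step[of W i] W i by (auto simp: full_def)
          have "V = F [i] ` fst ` W" using R.F_letter_surj[OF i] W(1) by (simp add: full_def)
          also have "\<dots> = fst ` C i ` W" by (auto simp: C_def image_image)
          also have "\<dots> \<subseteq> fst ` W'" using W' by blast
          finally have "W' \<in> full" using inV[OF W'(1)] W'(1) by (auto simp: full_def)
          moreover have "C i p \<in> W'" using W W' by blast
          moreover have "y = snd (C i p)" by (simp add: C_def W)
          ultimately show "y \<in> (\<Union>W\<in>full. snd ` W)" by blast
        qed
        hence "span (F' [i] ` (\<Union>W\<in>full. snd ` W)) \<subseteq> T" unfolding T_def by (rule span_mono)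
        thus ?thesis unfolding T_def using linear_span_image[OF R'.linear_F] by metis
      qed
      ultimately have "proper_nontrivial_subspace V' T \<and> (\<forall>i\<in>{1..N}. F' [i] ` T \<subseteq> T)" by simp
      hence "\<not> irreducible_tuple V' N (\<lambda>i. F' [i])"
        unfolding irreducible_tuple_def not_not by (rule exI)
      thus False using irred by contradiction
    qed
  qed
qed

text \<open>The quadruples of unit vectors form a compact set, covered by the open sets on which a given word
  works with a given margin.\<close>

lemma jointly_connecting_uniform:
  fixes V :: "'a::euclidean_space set" and V' :: "'b::euclidean_space set"
  assumes R: "word_representation N V F" and R': "word_representation N V' F'"
    and J: "jointly_connecting N V F V' F'"
  obtains c K where "0 < c"
    "\<And>x z x' z'. x \<in> V \<Longrightarrow> z \<in> V \<Longrightarrow> x' \<in> V' \<Longrightarrow> z' \<in> V' \<Longrightarrow> norm x = 1 \<Longrightarrow> norm z = 1 \<Longrightarrow> norm x' = 1 \<Longrightarrow> norm z' = 1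
       \<Longrightarrow> \<exists>w\<in>all_words N. length w \<le> K \<and> c \<le> \<bar>z \<bullet> F w x\<bar> \<and> c \<le> \<bar>z' \<bullet> F' w x'\<bar>"
proof -
  interpret R: word_representation N V F by fact
  interpret R': word_representation N V' F' by fact
  define X where "X = ((V \<inter> sphere 0 1) \<times> (V \<inter> sphere 0 1)) \<times> ((V' \<inter> sphere 0 1) \<times> (V' \<inter> sphere 0 1))"
  define U where "U = (\<lambda>(w, n). {p :: ('a \<times> 'a) \<times> ('b \<times> 'b).
     inverse (real (Suc n)) < \<bar>snd (fst p) \<bullet> F w (fst (fst p))\<bar> \<and>
     inverse (real (Suc n)) < \<bar>snd (snd p) \<bullet> F' w (fst (snd p))\<bar>})"
  have "compact (V \<inter> sphere 0 1)" "compact (V' \<inter> sphere 0 1)"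
    using R.subspace_V R'.subspace_V by (auto intro!: closed_Int_compact closed_subspace)
  hence X: "compact X" unfolding X_def by (intro compact_Times)
  have "open (U t)" if "t \<in> all_words N \<times> UNIV" for t
    unfolding U_def split_def
    by (intro open_Collect_conj open_Collect_less continuous_intros
        bounded_linear.continuous_on[OF R.bounded_linear_F] bounded_linear.continuous_on[OF R'.bounded_linear_F])
  moreover have "X \<subseteq> \<Union>(U ` (all_words N \<times> UNIV))"
  proof
    fix p assume p: "p \<in> X"
    obtain x z x' z' where e: "p = ((x, z), (x', z'))" by (metis prod.collapse)
    have "x \<in> V - {0}" "z \<in> V - {0}" "x' \<in> V' - {0}" "z' \<in> V' - {0}" using p by (auto simp: X_def e)
    then obtain w where w: "w \<in> all_words N" "z \<bullet> F w x \<noteq> 0" "z' \<bullet> F' w x' \<noteq> 0"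
      using J unfolding jointly_connecting_def by blast
    define m where "m = min \<bar>z \<bullet> F w x\<bar> \<bar>z' \<bullet> F' w x'\<bar>"
    have "0 < m" using w by (simp add: m_def)
    then obtain n where "inverse (real (Suc n)) < m" using reals_Archimedean by blast
    hence "p \<in> U (w, n)" by (auto simp: U_def e m_def)
    thus "p \<in> \<Union>(U ` (all_words N \<times> UNIV))" using w by blast
  qed
  ultimately obtain D where D: "D \<subseteq> all_words N \<times> UNIV" "finite D" "X \<subseteq> \<Union>(U ` D)"
    using compactE_image[OF X] by metis
  define M where "M = (\<Sum>t\<in>D. snd t)"
  define K where "K = (\<Sum>t\<in>D. length (fst t))"
  define c where "c = inverse (real (Suc M))"
  show ?thesis
  proof (rule that[of c K])
    show "0 < c" by (simp add: c_def)
    fix x z x' z' assume "x \<in> V" "z \<in> V" "x' \<in> V'" "z' \<in> V'" "norm x = 1" "norm z = 1" "norm x' = 1" "norm z' = 1"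
    hence "((x, z), (x', z')) \<in> X" by (simp add: X_def)
    then obtain w n where t: "(w, n) \<in> D" "((x, z), (x', z')) \<in> U (w, n)" using D(3) by fast
    have "n \<le> M" unfolding M_def using member_le_sum[OF t(1), of snd] D(2) by simp
    hence "c \<le> inverse (real (Suc n))" unfolding c_def by (intro le_imp_inverse_le) auto
    moreover have "length w \<le> K" unfolding K_def using member_le_sum[OF t(1), of "\<lambda>t. length (fst t)"] D(2) by simp
    ultimately show "\<exists>w\<in>all_words N. length w \<le> K \<and> c \<le> \<bar>z \<bullet> F w x\<bar> \<and> c \<le> \<bar>z' \<bullet> F' w x'\<bar>"
      using t D(1) by (intro bexI[of _ w]) (auto simp: U_def)
  qed
qed

lemma jointly_connecting_quasi_multiplicative:
  fixes V :: "'a::euclidean_space set" and V' :: "'b::euclidean_space set"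
  assumes R: "word_representation N V F" and R': "word_representation N V' F'"
    and J: "jointly_connecting N V F V' F'"
  obtains c K where "0 < c"
    "\<And>u v. u \<in> all_words N \<Longrightarrow> v \<in> all_words N \<Longrightarrow> \<exists>w\<in>all_words N. length w \<le> K \<and>
       c * onorm (F u) * onorm (F v) \<le> onorm (F (u @ w @ v)) \<and>
       c * onorm (F' u) * onorm (F' v) \<le> onorm (F' (u @ w @ v))"
proof -
  interpret R: word_representation N V F by fact
  interpret R': word_representation N V' F' by fact
  obtain c K where c: "0 < c" and unif:
    "\<And>x z x' z'. x \<in> V \<Longrightarrow> z \<in> V \<Longrightarrow> x' \<in> V' \<Longrightarrow> z' \<in> V' \<Longrightarrow> norm x = 1 \<Longrightarrow> norm z = 1 \<Longrightarrow> norm x' = 1 \<Longrightarrow> norm z' = 1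
       \<Longrightarrow> \<exists>w\<in>all_words N. length w \<le> K \<and> c \<le> \<bar>z \<bullet> F w x\<bar> \<and> c \<le> \<bar>z' \<bullet> F' w x'\<bar>"
    using jointly_connecting_uniform[OF R R' J] by metis
  show ?thesis
  proof (rule that[of c K])
    fix u v assume u: "u \<in> all_words N" and v: "v \<in> all_words N"
    obtain x z where xz: "x \<in> V" "z \<in> V" "norm x = 1" "norm z = 1"
      and F: "\<And>w. onorm (F u) * onorm (F v) * \<bar>z \<bullet> F w x\<bar> \<le> onorm (F (u @ w @ v))"
      using R.norming_vectors[OF u v] by metis
    obtain x' z' where xz': "x' \<in> V'" "z' \<in> V'" "norm x' = 1" "norm z' = 1"
      and F': "\<And>w. onorm (F' u) * onorm (F' v) * \<bar>z' \<bullet> F' w x'\<bar> \<le> onorm (F' (u @ w @ v))"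
      using R'.norming_vectors[OF u v] by metis
    obtain w where w: "w \<in> all_words N" "length w \<le> K" "c \<le> \<bar>z \<bullet> F w x\<bar>" "c \<le> \<bar>z' \<bullet> F' w x'\<bar>"
      using unif[OF xz(1,2) xz'(1,2) xz(3,4) xz'(3,4)] by blast
    have "onorm (F u) * onorm (F v) * c \<le> onorm (F u) * onorm (F v) * \<bar>z \<bullet> F w x\<bar>"
      using w(3) R.onorm_pos[OF u] R.onorm_pos[OF v] by (intro mult_left_mono) auto
    moreover have "onorm (F' u) * onorm (F' v) * c \<le> onorm (F' u) * onorm (F' v) * \<bar>z' \<bullet> F' w x'\<bar>"
      using w(4) R'.onorm_pos[OF u] R'.onorm_pos[OF v] by (intro mult_left_mono) auto
    ultimately show "\<exists>w\<in>all_words N. length w \<le> K \<and>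
       c * onorm (F u) * onorm (F v) \<le> onorm (F (u @ w @ v)) \<and>
       c * onorm (F' u) * onorm (F' v) \<le> onorm (F' (u @ w @ v))"
      using F[of w] F'[of w] w by (intro bexI[of _ w]) (auto simp: mult_ac)
  qed (rule c)
qed


section \<open>Orthonormal eigenbases and singular values\<close>

lemma symmetric_matrix_inner:
  fixes B :: "real^'n^'n"
  assumes "transpose B = B"
  shows "x \<bullet> (B *v y) = (B *v x) \<bullet> y"
  using dot_lmul_matrix[of x B y] transpose_matrix_vector[of B x] assms by simp

text \<open>A unit vector of \<open>S\<close> that maximizes the quadratic form is an eigenvector, since the first
  variation of the form vanishes in all orthogonal directions.\<close>

lemma symmetric_matrix_eigenvector:
  fixes B :: "real^'n^'n"
  assumes sym: "transpose B = B" and S: "subspace S" "S \<noteq> {0}" and inv: "\<And>x. x \<in> S \<Longrightarrow> B *v x \<in> S"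
  obtains x where "x \<in> S" "norm x = 1" "B *v x = (x \<bullet> (B *v x)) *\<^sub>R x"
proof -
  obtain x0 where x0: "x0 \<in> S" "x0 \<noteq> 0" using S subspace_0[OF S(1)] by blast
  let ?X = "S \<inter> sphere 0 1"
  have "(1 / norm x0) *\<^sub>R x0 \<in> ?X" using x0 S by (auto simp: subspace_scale)
  hence ne: "?X \<noteq> {}" by blast
  have comp: "compact ?X" using S by (intro closed_Int_compact closed_subspace) auto
  have cont: "continuous_on ?X (\<lambda>x. x \<bullet> (B *v x))" by (intro continuous_intros)
  obtain x where x: "x \<in> ?X" and max: "\<And>y. y \<in> ?X \<Longrightarrow> y \<bullet> (B *v y) \<le> x \<bullet> (B *v x)"
    using continuous_attains_sup[OF comp ne cont] by blast
  define t where "t = x \<bullet> (B *v x)"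
  have nx: "norm x = 1" and xS: "x \<in> S" using x by auto
  have xx: "x \<bullet> x = 1" using nx by (simp add: norm_eq_1)
  have max': "y \<bullet> (B *v y) \<le> t * (y \<bullet> y)" if "y \<in> S" for y
  proof (cases "y = 0")
    case False
    have "(1 / norm y) *\<^sub>R y \<in> ?X" using that False S by (auto simp: subspace_scale)
    from max[OF this] have "(y \<bullet> (B *v y)) / (norm y)\<^sup>2 \<le> t"
      by (simp add: t_def matrix_vector_mult_scaleR power2_eq_square)
    thus ?thesis using False by (simp add: field_simps power2_norm_eq_inner)
  qed simp
  have orth: "y \<bullet> (B *v x) = 0" if y: "y \<in> S" "x \<bullet> y = 0" for y
  proof (rule ccontr)
    define a where "a = y \<bullet> (B *v x)"
    define b where "b = t * (y \<bullet> y) - y \<bullet> (B *v y)"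
    assume "y \<bullet> (B *v x) \<noteq> 0"
    hence a: "a \<noteq> 0" by (simp add: a_def)
    have b0: "0 \<le> b" using max'[OF y(1)] by (simp add: b_def)
    have key: "2 * s * a \<le> s\<^sup>2 * b" for s
    proof -
      have "x + s *\<^sub>R y \<in> S" using xS y S by (auto intro: subspace_add subspace_scale)
      from max'[OF this]
      have "(x + s *\<^sub>R y) \<bullet> (B *v (x + s *\<^sub>R y)) \<le> t * ((x + s *\<^sub>R y) \<bullet> (x + s *\<^sub>R y))" .
      also have "(x + s *\<^sub>R y) \<bullet> (x + s *\<^sub>R y) = 1 + s\<^sup>2 * (y \<bullet> y)"
        using y(2) xx by (simp add: inner_add_left inner_add_right power2_eq_square inner_commute)
      also have "(x + s *\<^sub>R y) \<bullet> (B *v (x + s *\<^sub>R y)) = t + 2 * s * a + s\<^sup>2 * (y \<bullet> (B *v y))"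
        using symmetric_matrix_inner[OF sym, of x y]
        by (simp add: matrix_vector_mult_scaleR matrix_vector_right_distrib inner_add_left inner_add_right
            a_def t_def power2_eq_square inner_commute algebra_simps)
      finally show ?thesis by (simp add: b_def algebra_simps)
    qed
    \<comment> \<open>For small \<open>s\<close> the linear term in \<open>key\<close> dominates the quadratic one; this value is small enough.\<close>
    define s where "s = a / (b + 1)"
    have s: "a = s * (b + 1)" "s \<noteq> 0" using a b0 by (simp_all add: s_def)
    have "s\<^sup>2 * (2 * (b + 1)) \<le> s\<^sup>2 * b" using key[of s] unfolding s(1) by (simp add: power2_eq_square algebra_simps)
    hence "2 * (b + 1) \<le> b" by (rule mult_left_le_imp_le) (use s(2) in simp)
    thus False using b0 by simp
  qed
  define y where "y = B *v x - t *\<^sub>R x"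
  have "x \<bullet> y = 0" using xx by (simp add: y_def inner_diff_right t_def)
  moreover have "y \<in> S" unfolding y_def using xS S inv by (auto intro: subspace_diff subspace_scale)
  ultimately have "y \<bullet> (B *v x) = 0" by (intro orth)
  hence "y \<bullet> y = 0" using \<open>x \<bullet> y = 0\<close> by (simp add: y_def inner_diff_right inner_diff_left inner_commute)
  hence "B *v x = t *\<^sub>R x" by (simp add: y_def)
  thus ?thesis using that xS nx unfolding t_def by blast
qed

lemma symmetric_matrix_eigenbasis_subspace:
  fixes B :: "real^'n^'n"
  assumes sym: "transpose B = B"
  shows "subspace S \<Longrightarrow> (\<And>x. x \<in> S \<Longrightarrow> B *v x \<in> S) \<Longrightarrow>
    \<exists>E. pairwise orthogonal E \<and> (\<forall>x\<in>E. norm x = 1 \<and> B *v x = (x \<bullet> (B *v x)) *\<^sub>R x) \<and> E \<subseteq> S \<and> span E = S"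
proof (induction "dim S" arbitrary: S rule: less_induct)
  case less
  show ?case
  proof (cases "S = {0}")
    case True
    thus ?thesis by (intro exI[of _ "{}"]) auto
  next
    case False
    obtain x where x: "x \<in> S" "norm x = 1" "B *v x = (x \<bullet> (B *v x)) *\<^sub>R x"
      using symmetric_matrix_eigenvector[OF sym less(2) False less(3)] by blast
    define S' where "S' = {y \<in> S. x \<bullet> y = 0}"
    have xx: "x \<bullet> x = 1" using x by (simp add: norm_eq_1)
    have S': "subspace S'" using less(2) unfolding S'_def
      by (auto simp: subspace_def inner_add_right)
    have inv: "B *v y \<in> S'" if "y \<in> S'" for y
    proof -
      have "x \<bullet> (B *v y) = (x \<bullet> (B *v x)) * (x \<bullet> y)"
        using symmetric_matrix_inner[OF sym, of x y] x(3) by (metis inner_scaleR_left)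
      thus ?thesis using that less(3) by (auto simp: S'_def)
    qed
    have "x \<notin> S'" "S' \<subseteq> S" using xx by (auto simp: S'_def)
    hence "S' \<subset> S" using x(1) by blast
    moreover have "span S = S" "span S' = S'" using S' less(2) by (simp_all only: span_eq_iff)
    ultimately have "dim S' < dim S" by (intro dim_psubset) (simp only:)
    then obtain E where E: "pairwise orthogonal E"
      "\<forall>x\<in>E. norm x = 1 \<and> B *v x = (x \<bullet> (B *v x)) *\<^sub>R x" "E \<subseteq> S'" "span E = S'"
      using less(1)[OF _ S' inv] by blast
    have "span (insert x E) = S"
    proof (intro equalityI subsetI)
      fix y assume "y \<in> span (insert x E)"
      thus "y \<in> S" using span_minimal[OF _ less(2), of "insert x E"] x E(3) by (auto simp: S'_def)
    next
      fix y assume y: "y \<in> S"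
      have "y - (x \<bullet> y) *\<^sub>R x \<in> S'"
        using y x(1) less(2) xx by (auto simp: S'_def inner_diff_right intro: subspace_diff subspace_scale)
      thus "y \<in> span (insert x E)" using E(4) by (auto simp: span_insert)
    qed
    moreover have "pairwise orthogonal (insert x E)"
      using E(1,3) by (auto simp: pairwise_insert orthogonal_def S'_def inner_commute)
    ultimately show ?thesis
      using E x by (intro exI[of _ "insert x E"]) (auto simp: S'_def)
  qed
qed

lemma symmetric_matrix_eigenbasis:
  fixes B :: "real^'n^'n"
  assumes sym: "transpose B = B"
  obtains E where "pairwise orthogonal E" "\<And>x. x \<in> E \<Longrightarrow> norm x = 1"
    "\<And>x. x \<in> E \<Longrightarrow> B *v x = (x \<bullet> (B *v x)) *\<^sub>R x" "span E = UNIV" "finite E" "card E = CARD('n)"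
proof -
  obtain E where E: "pairwise orthogonal E" "\<forall>x\<in>E. norm x = 1 \<and> B *v x = (x \<bullet> (B *v x)) *\<^sub>R x" "span E = UNIV"
    using symmetric_matrix_eigenbasis_subspace[OF sym, of UNIV] by auto
  have "0 \<notin> E" using E(2) by fastforce
  hence ind: "independent E" by (rule pairwise_orthogonal_independent[OF E(1)])
  have "card E = dim (span E)" using dim_eq_card_independent[OF ind] by simp
  also have "\<dots> = CARD('n)" unfolding E(3) by simp
  finally show ?thesis using E pairwise_orthogonal_imp_finite[OF E(1)] that by blast
qed

text \<open>The eigenspace of \<open>t\<close> is spanned by those members of the orthonormal eigenbasis that have
  eigenvalue \<open>t\<close>, so counting eigenvalues by the dimensions of eigenspaces is counting them along
  the basis.\<close>

lemma singular_values_eigenbasis: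
  fixes A :: "real^'n^'n"
  defines "B \<equiv> transpose A ** A"
  assumes E: "pairwise orthogonal E" "\<And>x. x \<in> E \<Longrightarrow> norm x = 1"
    "\<And>x. x \<in> E \<Longrightarrow> B *v x = (x \<bullet> (B *v x)) *\<^sub>R x" "span E = UNIV" "finite E"
  shows "(\<Sum>t | eigenspace B t \<noteq> {0}. replicate_mset (dim (eigenspace B t)) (sqrt t)) =
    image_mset (\<lambda>x. sqrt (x \<bullet> (B *v x))) (mset_set E)"
proof -
  define l where "l x = x \<bullet> (B *v x)" for x
  have sym: "transpose B = B" by (simp add: B_def matrix_transpose_mul)
  have eig: "B *v x = l x *\<^sub>R x" if "x \<in> E" for x using E(3)[OF that] by (simp add: l_def)
  have nz: "x \<noteq> 0" if "x \<in> E" for x using E(2)[OF that] by auto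
  hence "0 \<notin> E" by blast
  hence ind: "independent E" by (rule pairwise_orthogonal_independent[OF E(1)])
  define Et where "Et t = {x \<in> E. l x = t}" for t
  have espan: "eigenspace B t = span (Et t)" for t
  proof (intro equalityI subsetI)
    fix v assume "v \<in> span (Et t)"
    moreover have "Et t \<subseteq> eigenspace B t" by (auto simp: Et_def eigenspace_def eig)
    moreover have "subspace (eigenspace B t)"
      by (auto simp: subspace_def eigenspace_def matrix_vector_right_distrib matrix_vector_mult_scaleR algebra_simps)
    ultimately show "v \<in> eigenspace B t" using span_minimal by blast
  next
    fix v assume "v \<in> eigenspace B t"
    hence v: "B *v v = t *\<^sub>R v" by (simp add: eigenspace_def)
    have "v = (\<Sum>x\<in>E. (v \<bullet> x) *\<^sub>R x)"
      using orthonormal_basis_expand[OF E(1,2) _ E(5), of v] E(4) by simp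
    also have "\<dots> \<in> span (Et t)"
    proof (rule span_sum)
      fix x assume x: "x \<in> E"
      show "(v \<bullet> x) *\<^sub>R x \<in> span (Et t)"
      proof (cases "l x = t")
        case True
        thus ?thesis using x by (intro span_scale span_base) (simp add: Et_def)
      next
        case False
        have "t * (v \<bullet> x) = l x * (v \<bullet> x)"
          using symmetric_matrix_inner[OF sym, of v x] v eig[OF x] by auto
        hence "v \<bullet> x = 0" using False by simp
        thus ?thesis by (simp add: span_zero)
      qed
    qed
    finally show "v \<in> span (Et t)" .
  qed
  have dim: "dim (eigenspace B t) = card (Et t)" for t
  proof -
    have "independent (Et t)" by (rule independent_mono[OF ind]) (auto simp: Et_def)
    thus ?thesis unfolding espan using dim_eq_card_independent by simp
  qed
  have T: "{t. eigenspace B t \<noteq> {0}} = l ` E"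
  proof (intro equalityI subsetI)
    fix t assume "t \<in> {t. eigenspace B t \<noteq> {0}}"
    hence "Et t \<noteq> {}" unfolding espan by auto
    thus "t \<in> l ` E" by (auto simp: Et_def)
  next
    fix t assume "t \<in> l ` E"
    then obtain x where "x \<in> E" "t = l x" by blast
    hence "x \<in> eigenspace B t" "x \<noteq> 0" using eig nz by (auto simp: eigenspace_def)
    thus "t \<in> {t. eigenspace B t \<noteq> {0}}" by auto
  qed
  have const_sum: "(\<Sum>x\<in>X. {#c#}) = replicate_mset (card X) (c :: real)" for X :: "(real^'n) set" and c
    by (induction X rule: infinite_finite_induct) auto
  have "(\<Sum>t\<in>l ` E. replicate_mset (dim (eigenspace B t)) (sqrt t)) =
      (\<Sum>t\<in>l ` E. \<Sum>x\<in>Et t. {#sqrt (l x)#})"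
  proof (rule sum.cong[OF refl])
    fix t
    have "(\<Sum>x\<in>Et t. {#sqrt (l x)#}) = (\<Sum>x\<in>Et t. {#sqrt t#})"
      by (rule sum.cong) (auto simp: Et_def)
    also have "\<dots> = replicate_mset (card (Et t)) (sqrt t)"
      by (rule const_sum)
    finally show "replicate_mset (dim (eigenspace B t)) (sqrt t) = (\<Sum>x\<in>Et t. {#sqrt (l x)#})"
      by (simp add: dim)
  qed
  also have "\<dots> = (\<Sum>x\<in>E. {#sqrt (l x)#})"
    unfolding Et_def by (rule sum.group) (use E(5) in auto)
  also have "\<dots> = image_mset (\<lambda>x. sqrt (l x)) (mset_set E)"
    by (simp add: sum_unfold_sum_mset)
  finally show ?thesis unfolding T l_def .
qed

text \<open>The eigenbasis is listed by decreasing singular value; its images under \<open>A\<close> are orthogonal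
  because \<open>(A x) \<bullet> (A y) = x \<bullet> (B y)\<close> for \<open>B = A\<^sup>T A\<close>.\<close>

lemma singular_vectors:
  fixes A :: "real^'n^'n"
  obtains v :: "nat \<Rightarrow> real^'n" where
    "\<And>i j. i < CARD('n) \<Longrightarrow> j < CARD('n) \<Longrightarrow> v i \<bullet> v j = (if i = j then 1 else 0)"
    "\<And>i j. i < CARD('n) \<Longrightarrow> j < CARD('n) \<Longrightarrow>
       (A *v v i) \<bullet> (A *v v j) = (if i = j then (singular_values A ! i)\<^sup>2 else 0)"
    "\<And>i j. i \<le> j \<Longrightarrow> j < CARD('n) \<Longrightarrow> singular_values A ! j \<le> singular_values A ! i"
    "\<And>i. i < CARD('n) \<Longrightarrow> 0 \<le> singular_values A ! i"
proof -
  define B where "B = transpose A ** A"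
  have sym: "transpose B = B" by (simp add: B_def matrix_transpose_mul)
  obtain E where E: "pairwise orthogonal E" "\<And>x. x \<in> E \<Longrightarrow> norm x = 1"
    "\<And>x. x \<in> E \<Longrightarrow> B *v x = (x \<bullet> (B *v x)) *\<^sub>R x" "span E = UNIV" "finite E" "card E = CARD('n)"
    using symmetric_matrix_eigenbasis[OF sym] by blast
  define f where "f x = sqrt (x \<bullet> (B *v x))" for x
  have AA: "(A *v x) \<bullet> (A *v y) = x \<bullet> (B *v y)" for x y
    using dot_lmul_matrix[of "A *v x" A y] transpose_matrix_vector[of A "A *v x"]
      symmetric_matrix_inner[OF sym, of x y]
    by (simp add: B_def matrix_vector_mul_assoc)
  have f2: "(f x)\<^sup>2 = x \<bullet> (B *v x)" for x
    using AA[of x x] inner_ge_zero[of "A *v x"] by (simp add: f_def)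
  obtain l where l: "set l = E" "distinct l" using finite_distinct_list[OF E(5)] by blast
  define vs where "vs = rev (sort_key f l)"
  have vs: "set vs = E" "distinct vs" "length vs = CARD('n)"
    using l E(6) distinct_card[OF l(2)] by (auto simp: vs_def)
  have "sort (map f l) = map f (sort_key f l)"
    by (rule properties_for_sort) auto
  moreover have "mset (map f l) = image_mset f (mset_set E)"
    using mset_set_set[OF l(2)] l(1) by simp
  ultimately have "sorted_list_of_multiset (image_mset f (mset_set E)) = map f (sort_key f l)"
    by (metis sorted_list_of_multiset_mset)
  hence sv: "singular_values A = map f vs"
    using singular_values_eigenbasis[of E A] E unfolding singular_values_def B_def[symmetric] f_def[symmetric]
    by (simp add: vs_def rev_map Let_def)
  have "sorted_wrt (\<le>) (rev (map f vs))" by (simp add: vs_def rev_map)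
  hence srt: "sorted_wrt (\<lambda>x y. y \<le> x) (map f vs)" by (simp only: sorted_wrt_rev)
  have vsE: "vs ! i \<in> E" if "i < CARD('n)" for i using vs that nth_mem by metis
  have ortho: "vs ! i \<bullet> vs ! j = (if i = j then 1 else 0)" if "i < CARD('n)" "j < CARD('n)" for i j
  proof (cases "i = j")
    case True
    thus ?thesis using E(2)[OF vsE[OF that(1)]] by (simp add: norm_eq_1)
  next
    case False
    hence "vs ! i \<noteq> vs ! j" using vs that by (simp add: nth_eq_iff_index_eq)
    thus ?thesis using E(1) vsE[OF that(1)] vsE[OF that(2)] False by (auto simp: pairwise_def orthogonal_def)
  qed
  show ?thesis
  proof (rule that[of "\<lambda>i. vs ! i"])
    fix i j assume ij: "i < CARD('n)" "j < CARD('n)"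
    show "vs ! i \<bullet> vs ! j = (if i = j then 1 else 0)" by (rule ortho[OF ij])
    have "(A *v (vs ! i)) \<bullet> (A *v (vs ! j)) = vs ! i \<bullet> (B *v (vs ! j))" by (rule AA)
    also have "\<dots> = (vs ! j \<bullet> (B *v (vs ! j))) * (vs ! i \<bullet> vs ! j)"
      using E(3)[OF vsE[OF ij(2)]] by (metis inner_scaleR_right)
    finally show "(A *v (vs ! i)) \<bullet> (A *v (vs ! j)) = (if i = j then (singular_values A ! i)\<^sup>2 else 0)"
      using ortho[OF ij] ij vs(3) by (simp add: sv f2)
  next
    fix i j assume ij: "i \<le> j" "j < CARD('n)"
    show "singular_values A ! j \<le> singular_values A ! i"
      using srt ij vs(3) by (cases "i = j") (auto simp: sv sorted_wrt_iff_nth_less)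
  next
    fix i assume "i < CARD('n)"
    hence "singular_values A ! i = f (vs ! i)" using vs(3) by (simp add: sv)
    also have "0 \<le> f (vs ! i)" using AA[of "vs ! i" "vs ! i"] inner_ge_zero[of "A *v (vs ! i)"] by (simp add: f_def)
    finally show "0 \<le> singular_values A ! i" .
  qed
qed

definition diagonal_matrix :: "('n \<Rightarrow> real) \<Rightarrow> real^'n^'n" where
  "diagonal_matrix s = (\<chi> i j. if i = j then s i else 0)"

lemma diagonal_matrix_axis: "diagonal_matrix s *v axis i 1 = s i *\<^sub>R axis i 1"
  unfolding matrix_vector_mult_basis by (simp add: column_def diagonal_matrix_def vec_eq_iff axis_def)

text \<open>The columns of \<open>V\<close> are the singular vectors, those of \<open>U\<close> their normalized images. Matrix
  indices carry no order, so \<open>b\<close> records which index belongs to the \<open>i\<close>-th singular value.\<close>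

lemma singular_value_decomposition:
  fixes A :: "real^'n^'n"
  assumes "invertible A"
  obtains U V :: "real^'n^'n" and b :: "nat \<Rightarrow> 'n" and s :: "'n \<Rightarrow> real" where
    "orthogonal_matrix U" "orthogonal_matrix V" "bij_betw b {..<CARD('n)} UNIV"
    "\<And>i. i < CARD('n) \<Longrightarrow> s (b i) = singular_values A ! i" "\<And>i. 0 < s i"
    "\<And>i j. i \<le> j \<Longrightarrow> j < CARD('n) \<Longrightarrow> singular_values A ! j \<le> singular_values A ! i"
    "A = U ** diagonal_matrix s ** transpose V"
proof -
  let ?d = "CARD('n)"
  obtain v :: "nat \<Rightarrow> real^'n" where v:
    "\<And>i j. i < CARD('n) \<Longrightarrow> j < CARD('n) \<Longrightarrow> v i \<bullet> v j = (if i = j then 1 else 0)"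
    "\<And>i j. i < CARD('n) \<Longrightarrow> j < CARD('n) \<Longrightarrow>
       (A *v v i) \<bullet> (A *v v j) = (if i = j then (singular_values A ! i)\<^sup>2 else 0)"
    "\<And>i j. i \<le> j \<Longrightarrow> j < CARD('n) \<Longrightarrow> singular_values A ! j \<le> singular_values A ! i"
    "\<And>i. i < CARD('n) \<Longrightarrow> 0 \<le> singular_values A ! i"
    using singular_vectors[of A] by blast
  obtain b :: "nat \<Rightarrow> 'n" where b: "bij_betw b {..<?d} UNIV"
    using ex_bij_betw_nat_finite[of "UNIV :: 'n set"] by (auto simp: lessThan_atLeast0)
  define idx where "idx = inv_into {..<?d} b"
  have idx: "bij_betw idx UNIV {..<?d}" unfolding idx_def by (rule bij_betw_inv_into[OF b])
  have idx_lt: "idx i < ?d" for i using idx by (auto simp: bij_betw_def)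
  have idx_b: "idx (b i) = i" if "i < ?d" for i
    unfolding idx_def using b that by (simp add: bij_betw_inv_into_left)
  have idx_inj: "idx i = idx j \<longleftrightarrow> i = j" for i j using idx by (auto simp: bij_betw_def inj_on_def)
  define s where "s i = singular_values A ! idx i" for i
  have spos: "0 < s i" for i
  proof -
    have "A *v v (idx i) \<noteq> 0"
    proof
      assume "A *v v (idx i) = 0"
      hence "v (idx i) = 0" using assms by (metis matrix_left_invertible_ker invertible_left_inverse)
      thus False using v(1)[OF idx_lt idx_lt, of i i] by simp
    qed
    hence "s i \<noteq> 0" using v(2)[OF idx_lt idx_lt, of i i] by (auto simp: s_def)
    thus ?thesis using v(4)[OF idx_lt, of i] by (simp add: s_def)
  qed
  define V :: "real^'n^'n" where "V = (\<chi> r c. v (idx c) $ r)"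
  define U :: "real^'n^'n" where "U = (\<chi> r c. (1 / s c) * (A *v v (idx c)) $ r)"
  have Vc: "column c V = v (idx c)" for c by (simp add: V_def column_def vec_eq_iff)
  have Uc: "column c U = (1 / s c) *\<^sub>R (A *v v (idx c))" for c by (simp add: U_def column_def vec_eq_iff)
  have V: "orthogonal_matrix V"
    unfolding orthogonal_matrix_orthonormal_columns
    using v(1)[OF idx_lt idx_lt] by (auto simp: Vc norm_eq_1 orthogonal_def idx_inj)
  have "column c U \<bullet> column c' U = (if c = c' then 1 else 0)" for c c'
    using v(2)[OF idx_lt idx_lt, of c c'] spos[of c] spos[of c']
    by (cases "c = c'") (simp_all add: Uc idx_inj s_def[symmetric] power2_eq_square)
  hence U: "orthogonal_matrix U"
    unfolding orthogonal_matrix_orthonormal_columns by (auto simp: norm_eq_1 orthogonal_def)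
  have "A ** V = U ** diagonal_matrix s"
  proof -
    have "(A ** V) *v axis c 1 = (U ** diagonal_matrix s) *v axis c 1" for c
    proof -
      have "(A ** V) *v axis c 1 = A *v v (idx c)"
        by (metis matrix_vector_mul_assoc matrix_vector_mult_basis Vc)
      also have "\<dots> = s c *\<^sub>R (U *v axis c 1)"
        using spos[of c] by (simp add: matrix_vector_mult_basis Uc)
      also have "\<dots> = (U ** diagonal_matrix s) *v axis c 1"
        by (simp only: matrix_vector_mul_assoc[symmetric] diagonal_matrix_axis matrix_vector_mult_scaleR)
      finally show ?thesis .
    qed
    thus ?thesis by (simp add: matrix_vector_mult_basis column_def vec_eq_iff)
  qed
  hence "A = U ** diagonal_matrix s ** transpose V"
    using V by (metis matrix_mul_assoc matrix_mul_rid orthogonal_matrix_def)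
  moreover have "s (b i) = singular_values A ! i" if "i < ?d" for i
    using idx_b[OF that] by (simp add: s_def)
  ultimately show ?thesis using that[of U V b s] U V b spos v(3) by blast
qed


section \<open>Norms of exterior powers\<close>

lemma wedge_scale: "wedge k (\<lambda>i. c i *\<^sub>R u i) = (\<Prod>i<k. c i) *\<^sub>R wedge k u"
  by (auto simp: wedge_def vec_eq_iff prod.distrib sum_distrib_left mult_ac)

lemma ext_map_mult: "ext_map k (A ** B) x = ext_map k A (ext_map k B x)"
proof -
  have "ext_map k A (ext_map k B x) =
      (\<Sum>S | card S = k. x $ S *\<^sub>R ext_map k A (wedge k (\<lambda>j. B *v axis (from_nat_into S j) 1)))"
    unfolding ext_map_def[of k B] by (simp add: linear_sum[OF linear_ext_map] linear_scale[OF linear_ext_map])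
  thus ?thesis by (simp add: ext_map_wedge ext_map_def[of k "A ** B"] matrix_vector_mul_assoc)
qed

lemma bounded_linear_ext_map: "bounded_linear (ext_map k A)"
  using linear_ext_map linear_conv_bounded_linear by blast

lemma onorm_ext_map_mult: "onorm (ext_map k (A ** B)) \<le> onorm (ext_map k A) * onorm (ext_map k B)"
proof -
  have "ext_map k (A ** B) = ext_map k A \<circ> ext_map k B" by (auto simp: ext_map_mult)
  thus ?thesis using onorm_compose[OF bounded_linear_ext_map bounded_linear_ext_map] by metis
qed

text \<open>A crude bound for the norm of the \<open>k\<close>-th exterior power of a matrix with entries in
  \<open>[-1, 1]\<close>: each coordinate of a wedge of columns is a sum of \<open>k!\<close> products of entries. Only its
  independence of the matrix matters.\<close>

definition wedge_bound :: "'n::finite itself \<Rightarrow> nat \<Rightarrow> real" where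
  "wedge_bound _ k = real (CARD('n set)) * (real (CARD('n set)) * fact k)"

lemma onorm_ext_map_bound:
  fixes M :: "real^'n^'n"
  assumes "\<And>i j. \<bar>M $ i $ j\<bar> \<le> 1"
  shows "onorm (ext_map k M) \<le> wedge_bound TYPE('n) k"
proof (rule onorm_bound)
  show "0 \<le> wedge_bound TYPE('n) k" by (simp add: wedge_bound_def)
  fix x :: "real^('n set)"
  have wedge_le: "norm (wedge k (\<lambda>j. M *v axis (from_nat_into S j) 1)) \<le> real (CARD('n set)) * fact k" for S :: "'n set"
  proof -
    let ?w = "wedge k (\<lambda>j. M *v axis (from_nat_into S j) 1)"
    have "\<bar>?w $ T\<bar> \<le> fact k" for T
    proof (cases "card T = k")
      case True
      have "\<bar>?w $ T\<bar> \<le> (\<Sum>p | p permutes {..<k}. \<bar>of_int (sign p) * (\<Prod>i<k. (M *v axis (from_nat_into S i) 1) $ from_nat_into T (p i))\<bar>)"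
        unfolding wedge_nth[OF True] by (rule sum_abs)
      also have "\<dots> \<le> (\<Sum>p | p permutes {..<k}. 1)"
      proof (intro sum_mono)
        fix p
        have "(\<Prod>i<k. \<bar>(M *v axis (from_nat_into S i) 1) $ from_nat_into T (p i)\<bar>) \<le> 1"
          using assms by (intro prod_le_1) (auto simp: matrix_vector_mult_basis column_def)
        thus "\<bar>of_int (sign p) * (\<Prod>i<k. (M *v axis (from_nat_into S i) 1) $ from_nat_into T (p i))\<bar> \<le> (1::real)"
          by (simp add: abs_mult abs_prod sign_def)
      qed
      also have "\<dots> = fact k" using card_permutations[of "{..<k}" k] by simp
      finally show ?thesis .
    qed (simp add: wedge_nth_0)
    hence "(\<Sum>T\<in>UNIV. \<bar>?w $ T\<bar>) \<le> (\<Sum>T\<in>(UNIV::'n set set). fact k)" by (intro sum_mono)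
    thus ?thesis using norm_le_l1_cart[of ?w] by simp
  qed
  have "norm (ext_map k M x) \<le> (\<Sum>S | card S = k. norm (x $ S *\<^sub>R wedge k (\<lambda>j. M *v axis (from_nat_into S j) 1)))"
    unfolding ext_map_def by (rule norm_sum)
  also have "\<dots> \<le> (\<Sum>S\<in>{S :: 'n set. card S = k}. norm x * (real (CARD('n set)) * fact k))"
    using wedge_le component_le_norm_cart[of x] by (intro sum_mono) (auto intro!: mult_mono)
  also have "\<dots> \<le> (\<Sum>S\<in>(UNIV::'n set set). norm x * (real (CARD('n set)) * fact k))"
    by (intro sum_mono2) auto
  also have "\<dots> = wedge_bound TYPE('n) k * norm x" by (simp add: wedge_bound_def)
  finally show "norm (ext_map k M x) \<le> wedge_bound TYPE('n) k * norm x" .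
qed

lemma onorm_ext_map_orthogonal:
  fixes U :: "real^'n^'n"
  assumes "orthogonal_matrix U"
  shows "onorm (ext_map k U) \<le> wedge_bound TYPE('n) k"
proof (rule onorm_ext_map_bound)
  fix i j
  have "norm (column j U) = 1" using assms by (simp add: orthogonal_matrix_orthonormal_columns)
  thus "\<bar>U $ i $ j\<bar> \<le> 1" using component_le_norm_cart[of "column j U" i] by (simp add: column_def)
qed

lemma prod_le_prod_initial:
  fixes f :: "nat \<Rightarrow> real"
  assumes "\<And>i j. i \<le> j \<Longrightarrow> j < d \<Longrightarrow> f j \<le> f i" and "\<And>i. i < d \<Longrightarrow> 0 \<le> f i"
    and "T \<subseteq> {..<d}" "card T = k"
  shows "prod f T \<le> (\<Prod>i<k. f i)"
  using assms(3,4)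
proof (induction k arbitrary: T)
  case 0
  hence "T = {}" using finite_subset by fastforce
  thus ?case by simp
next
  case (Suc k)
  have fin: "finite T" using Suc.prems finite_subset by blast
  have ne: "T \<noteq> {}" using Suc.prems by auto
  define m where "m = Max T"
  have m: "m \<in> T" unfolding m_def using fin ne by simp
  have "T \<subseteq> {..m}" unfolding m_def using fin by auto
  hence "card T \<le> card {..m}" by (intro card_mono) auto
  hence km: "k \<le> m" using Suc.prems by simp
  have md: "m < d" using m Suc.prems by auto
  have "prod f T = f m * prod f (T - {m})" using fin m by (simp add: prod.remove)
  also have "\<dots> \<le> f k * (\<Prod>i<k. f i)"
    using Suc.prems m fin md km assms(1)[OF km md] assms(2)
    by (intro mult_mono Suc.IH prod_nonneg) auto
  finally show ?case by (simp add: mult.commute)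
qed

text \<open>The exterior power of a diagonal matrix is diagonal in the basis of the \<open>e\<^sub>S\<close>; its entries are
  the products of the diagonal entries over \<open>S\<close>. For \<open>card S \<noteq> k\<close> the coordinate is killed, as
  \<open>ext_map k\<close> projects to the degree \<open>k\<close> part of the exterior algebra.\<close>

lemma ext_map_diagonal:
  fixes s :: "'n::finite \<Rightarrow> real"
  shows "ext_map k (diagonal_matrix s) x $ S = (if card S = k then (\<Prod>i\<in>S. s i) * x $ S else 0)"
proof -
  have "ext_map k (diagonal_matrix s) x = (\<Sum>S | card S = k. (x $ S * (\<Prod>i\<in>S. s i)) *\<^sub>R axis S 1)"
    unfolding ext_map_def
  proof (rule sum.cong[OF refl])
    fix S :: "'n set" assume "S \<in> {S. card S = k}"
    hence S: "card S = k" by simp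
    have "(\<Prod>j<k. s (from_nat_into S j)) = (\<Prod>i\<in>S. s i)"
      using bij_betw_from_nat_into_finite[of S] S by (intro prod.reindex_bij_betw) simp
    thus "x $ S *\<^sub>R wedge k (\<lambda>j. diagonal_matrix s *v axis (from_nat_into S j) 1) =
        (x $ S * (\<Prod>i\<in>S. s i)) *\<^sub>R axis S 1"
      unfolding diagonal_matrix_axis wedge_scale wedge_axis[OF S] by simp
  qed
  also have "\<dots> $ S = (\<Sum>T | card T = k. if T = S then x $ S * (\<Prod>i\<in>S. s i) else 0)"
    unfolding sum_component by (intro sum.cong refl) (auto simp: axis_def)
  also have "\<dots> = (if card S = k then (\<Prod>i\<in>S. s i) * x $ S else 0)"
    by (subst sum.delta) (auto simp: mult.commute)
  finally show ?thesis .
qed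

text \<open>By multiplicativity of exterior powers, the orthogonal factors of a singular value decomposition
  cost at most the constant \<open>c\<close> each, in either direction. For the diagonal factor the norm is the
  largest product of \<open>k\<close> singular values, namely \<open>p\<close>.\<close>

lemma onorm_ext_map_singular_values:
  fixes A :: "real^'n^'n"
  assumes "invertible A" and k: "k \<le> CARD('n)"
  defines "p \<equiv> \<Prod>i<k. singular_values A ! i" and "c \<equiv> wedge_bound TYPE('n) k"
  shows "0 < p" "p \<le> c * c * onorm (ext_map k A)" "onorm (ext_map k A) \<le> c * c * p"
proof -
  let ?d = "CARD('n)"
  obtain U V :: "real^'n^'n" and b :: "nat \<Rightarrow> 'n" and s :: "'n \<Rightarrow> real" where svd:
    "orthogonal_matrix U" "orthogonal_matrix V" "bij_betw b {..<CARD('n)} UNIV"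
    "\<And>i. i < CARD('n) \<Longrightarrow> s (b i) = singular_values A ! i" "\<And>i. 0 < s i"
    "\<And>i j. i \<le> j \<Longrightarrow> j < CARD('n) \<Longrightarrow> singular_values A ! j \<le> singular_values A ! i"
    "A = U ** diagonal_matrix s ** transpose V"
    using singular_value_decomposition[OF assms(1)] by blast
  let ?D = "diagonal_matrix s"
  have c: "0 \<le> c" by (simp add: c_def wedge_bound_def)
  have pos: "0 < singular_values A ! i" if "i < ?d" for i using svd(4)[OF that] svd(5)[of "b i"] by simp
  show p: "0 < p" unfolding p_def using pos k by (intro prod_pos) auto
  have le: "(\<Prod>i\<in>S. s i) \<le> p" if S: "card S = k" for S :: "'n set"
  proof -
    define T where "T = inv_into {..<?d} b ` S"
    have bi: "bij_betw (inv_into {..<?d} b) UNIV {..<?d}" by (rule bij_betw_inv_into[OF svd(3)])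
    have T: "T \<subseteq> {..<?d}" using bi by (auto simp: T_def bij_betw_def)
    have bT: "b ` T = S" unfolding T_def
      using svd(3) by (auto simp: image_image bij_betw_inv_into_right)
    have inj: "inj_on b T" using svd(3) T by (auto simp: bij_betw_def intro: inj_on_subset)
    have "card T = k" using card_image[OF inj] bT S by simp
    have "(\<Prod>i\<in>S. s i) = (\<Prod>i\<in>T. s (b i))" unfolding bT[symmetric] by (simp add: prod.reindex[OF inj])
    also have "\<dots> = (\<Prod>i\<in>T. singular_values A ! i)" using T svd(4) by (intro prod.cong) auto
    also have "\<dots> \<le> p" unfolding p_def
      using svd(6) pos T \<open>card T = k\<close> by (intro prod_le_prod_initial[of ?d]) (auto intro: less_imp_le)
    finally show ?thesis .
  qed
  have Dle: "onorm (ext_map k ?D) \<le> p"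
  proof (rule onorm_bound)
    fix x :: "real^('n set)"
    have "norm (ext_map k ?D x) \<le> norm (p *\<^sub>R x)"
    proof (rule norm_le_componentwise_cart)
      fix S
      have "\<bar>\<Prod>i\<in>S. s i\<bar> \<le> p" if "card S = k"
      proof -
        have "0 < (\<Prod>i\<in>S. s i)" by (intro prod_pos svd(5))
        thus ?thesis using le[OF that] by (simp only: abs_of_pos)
      qed
      thus "norm (ext_map k ?D x $ S) \<le> norm ((p *\<^sub>R x) $ S)"
        using p by (auto simp: ext_map_diagonal abs_mult intro!: mult_right_mono)
    qed
    thus "norm (ext_map k ?D x) \<le> p * norm x" using p by simp
  qed (use p in simp)
  have leD: "p \<le> onorm (ext_map k ?D)"
  proof -
    define S where "S = b ` {..<k}"
    have inj: "inj_on b {..<k}" using svd(3) k by (auto simp: bij_betw_def intro: inj_on_subset)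
    have S: "card S = k" unfolding S_def by (simp add: card_image[OF inj])
    have "(\<Prod>i\<in>S. s i) = (\<Prod>i<k. s (b i))" unfolding S_def by (simp add: prod.reindex[OF inj])
    also have "\<dots> = p" unfolding p_def using k svd(4) by (intro prod.cong) auto
    finally have Sp: "(\<Prod>i\<in>S. s i) = p" .
    have "p = \<bar>ext_map k ?D (axis S 1) $ S\<bar>" using S Sp p by (simp add: ext_map_diagonal)
    also have "\<dots> \<le> norm (ext_map k ?D (axis S 1))" by (rule component_le_norm_cart)
    also have "\<dots> \<le> onorm (ext_map k ?D)"
      using onorm[OF bounded_linear_ext_map, of k ?D "axis S 1"] by simp
    finally show ?thesis .
  qed
  have tV: "orthogonal_matrix (transpose V)" and tU: "orthogonal_matrix (transpose U)"
    using svd(1,2) by (simp_all add: orthogonal_matrix_transpose)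
  note bU = onorm_ext_map_orthogonal[OF svd(1), of k, folded c_def]
    and bV = onorm_ext_map_orthogonal[OF svd(2), of k, folded c_def]
    and btU = onorm_ext_map_orthogonal[OF tU, of k, folded c_def]
    and btV = onorm_ext_map_orthogonal[OF tV, of k, folded c_def]
  note nn = onorm_pos_le[OF bounded_linear_ext_map]
  have three: "onorm (ext_map k (X ** Y ** Z)) \<le> c * c * q"
    if "onorm (ext_map k X) \<le> c" "onorm (ext_map k Y) \<le> q" "onorm (ext_map k Z) \<le> c" "0 \<le> q" for X Y Z q
  proof -
    have "onorm (ext_map k (X ** Y ** Z)) \<le> onorm (ext_map k (X ** Y)) * onorm (ext_map k Z)"
      by (rule onorm_ext_map_mult)
    also have "\<dots> \<le> (onorm (ext_map k X) * onorm (ext_map k Y)) * onorm (ext_map k Z)"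
      by (intro mult_right_mono onorm_ext_map_mult nn)
    also have "\<dots> \<le> (c * q) * c" using that c nn by (intro mult_mono) auto
    finally show ?thesis by (simp add: mult_ac)
  qed
  show "onorm (ext_map k A) \<le> c * c * p"
    unfolding svd(7) using bU Dle btV p by (intro three) auto
  have "transpose U ** A ** V = ?D"
  proof -
    have "transpose U ** A ** V = (transpose U ** U) ** ?D ** (transpose V ** V)"
      unfolding svd(7) by (simp add: matrix_mul_assoc)
    thus ?thesis using svd(1,2) by (simp add: orthogonal_matrix)
  qed
  hence "onorm (ext_map k ?D) \<le> c * c * onorm (ext_map k A)"
    using three[OF btU order_refl bV nn[of k A]] by simp
  thus "p \<le> c * c * onorm (ext_map k A)" using leD by linarith
qed


section \<open>Matrix products on exterior powers\<close>

lemma word_product_append: "word_product A (u @ v) = word_product A u ** word_product A v"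
  by (induction u) (simp_all add: word_product_def matrix_mul_assoc)

lemma word_product_singleton: "word_product A [i] = A i"
  by (simp add: word_product_def)

lemma invertible_word_product:
  fixes A :: "nat \<Rightarrow> real^'n^'n"
  assumes "\<And>i. i \<in> {1..N} \<Longrightarrow> invertible (A i)" and "w \<in> all_words N"
  shows "invertible (word_product A w)"
  using assms(2)
proof (induction w)
  case Nil
  show ?case unfolding invertible_def by (intro exI[of _ "mat 1"]) (simp add: word_product_def)
next
  case (Cons i w)
  have i: "i \<in> {1..N}" and w: "w \<in> all_words N" using Cons.prems unfolding all_words_Cons letters_def by blast+
  have "word_product A (i # w) = A i ** word_product A w" by (simp add: word_product_def)
  thus ?case using invertible_mult[OF assms(1)[OF i] Cons.IH[OF w]] by simp
qed

lemma ext_map_in_ext_power: "ext_map k A x \<in> ext_power k"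
  unfolding ext_map_def ext_power_def by (intro span_sum span_scale span_base rangeI)

lemma ext_map_mat_1:
  fixes x :: "real^('n::finite set)"
  shows "ext_map k (mat 1) x $ S = (if card S = k then x $ S else 0)"
proof -
  have "(mat 1 :: real^'n^'n) = diagonal_matrix (\<lambda>_. 1)" by (simp add: mat_def diagonal_matrix_def)
  thus ?thesis by (simp add: ext_map_diagonal)
qed

text \<open>The map of the empty word is the projection of the exterior algebra to its degree \<open>k\<close> part.
  The bound \<open>k \<le> CARD('n)\<close> makes that part nonzero.\<close>

lemma word_representation_ext_map:
  fixes A :: "nat \<Rightarrow> real^'n^'n"
  assumes inv: "\<And>i. i \<in> {1..N} \<Longrightarrow> invertible (A i)" and k: "k \<le> CARD('n)"
  shows "word_representation N (ext_power k) (\<lambda>w. ext_map k (word_product A w))"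
proof (rule word_representation.intro)
  have Nil: "ext_map k (mat 1) x = x" if "x \<in> ext_power k" for x :: "real^('n set)"
    using that by (auto simp: vec_eq_iff ext_map_mat_1 ext_power_eq)
  fix w u v :: "nat list" and x y :: "real^('n set)"
  show "linear (ext_map k (word_product A w))" by (rule linear_ext_map)
  show "ext_map k (word_product A w) x \<in> ext_power k" by (rule ext_map_in_ext_power)
  show "ext_map k (word_product A []) x = x" if "x \<in> ext_power k"
    using Nil[OF that] by (simp add: word_product_def)
  show "ext_map k (word_product A []) x \<bullet> y = x \<bullet> ext_map k (word_product A []) y"
    unfolding inner_vec_def by (intro sum.cong) (auto simp: word_product_def ext_map_mat_1)
  show "ext_map k (word_product A (u @ v)) x = ext_map k (word_product A u) (ext_map k (word_product A v) x)"
    by (simp add: word_product_append ext_map_mult)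
  show "x = 0" if w: "w \<in> all_words N" and x: "x \<in> ext_power k" and z: "ext_map k (word_product A w) x = 0"
  proof -
    have "invertible (word_product A w)" by (rule invertible_word_product[OF _ w]) (rule inv)
    then obtain B where "B ** word_product A w = mat 1" unfolding invertible_def by blast
    hence "x = ext_map k B (ext_map k (word_product A w) x)"
      using Nil[OF x] by (simp add: ext_map_mult[symmetric])
    thus ?thesis unfolding z using linear_0[OF linear_ext_map] by simp
  qed
  obtain S :: "'n set" where "card S = k" using obtain_subset_with_card_n[OF k] by blast
  hence "axis S 1 \<in> ext_power k" by (auto simp: ext_power_eq axis_def)
  moreover have "axis S 1 \<noteq> (0 :: real^('n set))" by (simp add: axis_eq_0_iff)
  ultimately show "\<exists>x\<in>ext_power k. x \<noteq> (0 :: real^('n set))" by blast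
qed


section \<open>Equilibrium states of the singular value function\<close>

theorem theorem3:
  fixes A :: "nat \<Rightarrow> real^'n^'n" and N k :: nat and s :: real
  assumes "N \<ge> 2"
    and "k < CARD('n)"
    and "real k < s" and "s < real k + 1"
    and "\<And>i. i \<in> {1..N} \<Longrightarrow> invertible (A i)"
    and "irreducible_tuple (ext_power k) N (\<lambda>i. ext_map k (A i))"
    and "irreducible_tuple (ext_power (k + 1)) N (\<lambda>i. ext_map (k + 1) (A i))"
    and "strongly_irreducible_tuple (ext_power k) N (\<lambda>i. ext_map k (A i)) \<or>
         strongly_irreducible_tuple (ext_power (k + 1)) N (\<lambda>i. ext_map (k + 1) (A i))"
  shows "\<exists>\<mu>. equilibrium_state N A s \<mu> \<and> fully_supported N \<mu> \<and>
             (\<forall>\<nu>. equilibrium_state N A s \<nu> \<longrightarrow> \<nu> = \<mu>)"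
proof -
  define F where "F l w = ext_map l (word_product A w)" for l w
  define t where "t = s - real k"
  have t: "0 < t" "t < 1" using assms(3,4) by (simp_all add: t_def)
  define \<psi> where "\<psi> w = onorm (F k w) powr (1 - t) * onorm (F (k + 1) w) powr t" for w
  have R: "word_representation N (ext_power k) (F k)"
    and R': "word_representation N (ext_power (k + 1)) (F (k + 1))"
    unfolding F_def using assms(2,5) by (intro word_representation_ext_map; simp)+
  interpret R: word_representation N "ext_power k" "F k" by (rule R)
  interpret R': word_representation N "ext_power (k + 1)" "F (k + 1)" by (rule R')
  have letter: "F l [i] = ext_map l (A i)" for l i by (simp add: F_def word_product_singleton)
  have "jointly_connecting N (ext_power k) (F k) (ext_power (k + 1)) (F (k + 1))"
    using assms(8)
  proof
    assume "strongly_irreducible_tuple (ext_power k) N (\<lambda>i. ext_map k (A i))"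
    thus ?thesis using assms(7) unfolding letter[symmetric]
      by (rule strongly_irreducible_jointly_connecting[OF R R'])
  next
    assume "strongly_irreducible_tuple (ext_power (k + 1)) N (\<lambda>i. ext_map (k + 1) (A i))"
    thus ?thesis using assms(6) unfolding letter[symmetric]
      by (intro jointly_connecting_commute[OF strongly_irreducible_jointly_connecting[OF R' R]])
  qed
  then obtain c K where c: "0 < c" and quasi:
    "\<And>u v. u \<in> all_words N \<Longrightarrow> v \<in> all_words N \<Longrightarrow> \<exists>w\<in>all_words N. length w \<le> K \<and>
       c * onorm (F k u) * onorm (F k v) \<le> onorm (F k (u @ w @ v)) \<and>
       c * onorm (F (k + 1) u) * onorm (F (k + 1) v) \<le> onorm (F (k + 1) (u @ w @ v))"
    using jointly_connecting_quasi_multiplicative[OF R R'] by metis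
  obtain \<delta>1 where \<delta>1: "0 < \<delta>1" "\<And>w. w \<in> all_words N \<Longrightarrow> \<delta>1 ^ length w \<le> onorm (F k w)"
    using R.onorm_lower_bound by blast
  obtain \<delta>2 where \<delta>2: "0 < \<delta>2" "\<And>w. w \<in> all_words N \<Longrightarrow> \<delta>2 ^ length w \<le> onorm (F (k + 1) w)"
    using R'.onorm_lower_bound by blast
  define \<delta> where "\<delta> = min \<delta>1 \<delta>2"
  have \<delta>: "0 < \<delta>" using \<delta>1 \<delta>2 by (simp add: \<delta>_def)
  have nn: "0 \<le> onorm (F k w)" "0 \<le> onorm (F (k + 1) w)" for w
    using onorm_pos_le[OF R.bounded_linear_F] onorm_pos_le[OF R'.bounded_linear_F] by blast+
  \<comment> \<open>The exponents add up to \<open>1\<close>, so that a factor common to both norms passes to \<open>\<psi>\<close> unchanged.\<close>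
  have geometric: "a powr (1 - t) * a powr t = a" if "0 < a" for a :: real
    using that by (simp add: powr_add[symmetric])
  interpret quasi_multiplicative N \<psi> c \<delta> K
  proof
    fix u v w assume u: "u \<in> all_words N" and v: "v \<in> all_words N"
    have "\<psi> (u @ v) \<le> (onorm (F k u) * onorm (F k v)) powr (1 - t) *
        (onorm (F (k + 1) u) * onorm (F (k + 1) v)) powr t"
      unfolding \<psi>_def using t nn
      by (intro mult_mono powr_mono2 R.onorm_submult R'.onorm_submult) auto
    also have "\<dots> = \<psi> u * \<psi> v" using nn by (simp add: \<psi>_def powr_mult mult_ac)
    finally show "\<psi> (u @ v) \<le> \<psi> u * \<psi> v" .
    obtain w where w: "w \<in> all_words N" "length w \<le> K"
       "c * onorm (F k u) * onorm (F k v) \<le> onorm (F k (u @ w @ v))"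
       "c * onorm (F (k + 1) u) * onorm (F (k + 1) v) \<le> onorm (F (k + 1) (u @ w @ v))"
      using quasi[OF u v] by blast
    have "c * \<psi> u * \<psi> v = (c * onorm (F k u) * onorm (F k v)) powr (1 - t) *
        (c * onorm (F (k + 1) u) * onorm (F (k + 1) v)) powr t"
      using nn c geometric[OF c] by (simp add: \<psi>_def powr_mult mult_ac)
    also have "\<dots> \<le> \<psi> (u @ w @ v)"
      unfolding \<psi>_def using t nn c w(3,4) by (intro mult_mono powr_mono2) auto
    finally show "\<exists>w\<in>all_words N. length w \<le> K \<and> c * \<psi> u * \<psi> v \<le> \<psi> (u @ w @ v)" using w by blast
  next
    fix w assume w: "w \<in> all_words N"
    have "\<delta> ^ length w = (\<delta> ^ length w) powr (1 - t) * (\<delta> ^ length w) powr t"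
      using \<delta> by (simp add: geometric)
    also have "\<dots> \<le> (\<delta>1 ^ length w) powr (1 - t) * (\<delta>2 ^ length w) powr t"
      using \<delta> t by (intro mult_mono powr_mono2 power_mono) (auto simp: \<delta>_def)
    also have "\<dots> \<le> \<psi> w"
      unfolding \<psi>_def using t \<delta>1 \<delta>2 w by (intro mult_mono powr_mono2) auto
    finally show "\<delta> ^ length w \<le> \<psi> w" .
  qed (use assms(1) c \<delta> in auto)
  define \<phi> where "\<phi> w = singular_value_function s (word_product A w)" for w
  define p where "p l w = (\<Prod>i<l. singular_values (word_product A w) ! i)" for l w
  define b where "b l = (wedge_bound TYPE('n) l)\<^sup>2" for l
  have b: "0 < b l" for l by (simp add: b_def wedge_bound_def)
  have p: "0 < p l w" "p l w \<le> b l * onorm (F l w)" "onorm (F l w) \<le> b l * p l w"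
    if w: "w \<in> all_words N" and l: "l \<le> CARD('n)" for l w
  proof -
    have "invertible (word_product A w)" by (rule invertible_word_product[OF _ w]) (rule assms(5))
    from onorm_ext_map_singular_values[OF this l]
    show "0 < p l w" "p l w \<le> b l * onorm (F l w)" "onorm (F l w) \<le> b l * p l w"
      by (simp_all add: p_def b_def F_def power2_eq_square)
  qed
  \<comment> \<open>Here \<open>\<alpha>\<^sub>k\<^sub>+\<^sub>1\<close> is the quotient of \<open>p (k + 1)\<close> by \<open>p k\<close>, and one factor \<open>p k\<close> splits into two powers.\<close>
  have \<phi>_eq: "\<phi> w = p k w powr (1 - t) * p (k + 1) w powr t" if w: "w \<in> all_words N" for w
  proof -
    have pk: "0 < p k w" "0 < p (k + 1) w" using p(1)[OF w] assms(2) by auto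
    have sk: "p (k + 1) w = p k w * singular_values (word_product A w) ! k" by (simp add: p_def)
    hence a: "0 < singular_values (word_product A w) ! k" using pk by (simp add: zero_less_mult_iff)
    have "\<lfloor>s\<rfloor> = int k" using assms(3,4) by (intro floor_unique) auto
    hence "nat \<lfloor>s\<rfloor> = k" by simp
    hence "\<phi> w = p k w * (singular_values (word_product A w) ! k) powr t"
      by (simp add: \<phi>_def singular_value_function_def p_def t_def)
    also have "\<dots> = p k w powr (1 - t) * p k w powr t * (singular_values (word_product A w) ! k) powr t"
      using geometric[OF pk(1)] by simp
    also have "\<dots> = p k w powr (1 - t) * p (k + 1) w powr t"
      unfolding sk using pk a by (simp add: powr_mult)
    finally show ?thesis .
  qed
  have \<phi>_pos: "0 < \<phi> w" if "w \<in> all_words N" for w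
    using \<phi>_eq[OF that] p(1)[OF that, of k] p(1)[OF that, of "k + 1"] assms(2) by simp
  have comparable: "\<bar>ln (\<phi> w) - ln (\<psi> w)\<bar> \<le> \<bar>ln (b k)\<bar> + \<bar>ln (b (k + 1))\<bar>" if w: "w \<in> all_words N" for w
  proof -
    have close: "\<bar>ln (p l w) - ln (onorm (F l w))\<bar> \<le> \<bar>ln (b l)\<bar>"
      if l: "l \<le> CARD('n)" and o: "0 < onorm (F l w)" for l
    proof -
      have "ln (p l w) \<le> ln (b l * onorm (F l w))" "ln (onorm (F l w)) \<le> ln (b l * p l w)"
        using p[OF w l] o b[of l] by (simp_all)
      thus ?thesis using p(1)[OF w l] o b[of l] by (auto simp: ln_mult abs_le_iff)
    qed
    have o: "0 < onorm (F k w)" "0 < onorm (F (k + 1) w)" using R.onorm_pos[OF w] R'.onorm_pos[OF w] .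
    have pk: "0 < p k w" "0 < p (k + 1) w" using p(1)[OF w] assms(2) by auto
    have "ln (\<phi> w) - ln (\<psi> w) = (1 - t) * (ln (p k w) - ln (onorm (F k w)))
        + t * (ln (p (k + 1) w) - ln (onorm (F (k + 1) w)))"
      unfolding \<phi>_eq[OF w] \<psi>_def using o pk by (simp add: ln_mult ln_powr algebra_simps)
    also have "\<bar>\<dots>\<bar> \<le> \<bar>(1 - t) * (ln (p k w) - ln (onorm (F k w)))\<bar>
        + \<bar>t * (ln (p (k + 1) w) - ln (onorm (F (k + 1) w)))\<bar>" by (rule abs_triangle_ineq)
    also have "\<dots> \<le> 1 * \<bar>ln (b k)\<bar> + 1 * \<bar>ln (b (k + 1))\<bar>"
      unfolding abs_mult using t close[of k] close[of "k + 1"] o assms(2)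
      by (intro add_mono mult_mono) simp_all
    finally show ?thesis by simp
  qed
  have "\<exists>\<mu>\<in>invariant_measures N. fully_supported N \<mu> \<and> pressure N A s = entropy N \<mu> + lyapunov N A s \<mu> \<and>
    (\<forall>\<nu>\<in>invariant_measures N. pressure N A s = entropy N \<nu> + lyapunov N A s \<nu> \<longrightarrow> \<nu> = \<mu>)"
    using unique_equilibrium_state[of \<phi>, OF \<phi>_pos comparable]
    unfolding pressure_def lyapunov_def \<phi>_def by blast
  thus ?thesis unfolding equilibrium_state_def by blast
qed

end
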